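(* For every $a\in\mathbb C^\times$ there exists a $\mathcal B$-equivariant algebra homomorphism $\mathrm{ev}_a\colon \widetilde{\mathbf U}^\imath_{\mathsf{aff}}\to\widetilde{\mathbf U}^\imath$ (i.e. commuting with the automorphisms $\mathbf T_1,\dots,\mathbf T_n$) given by $$B_i\mapsto B_i,\quad \mathbb K_i\mapsto \mathbb K_i\quad(1\le i\le n),\qquad B_0\mapsto a\,\mathbf T_{\pi^{-1}\omega_1}(B_1),\qquad \mathbb K_0\mapsto a^2\,\mathbf T_{\pi^{-1}\omega_1}(\mathbb K_1).$$ More explicitly, $$\mathrm{ev}_a(B_0)=a\,\mathbf T_n\cdots\mathbf T_1(B_1)=a\,\mathbb K_1^{-1}\cdots\mathbb K_n^{-1}[B_1,[B_2,\cdots,[B_{n-1},B_n]_q\cdots]_q]_q,$$ $$\mathrm{ev}_a(\mathbb K_0)=a^2\,\mathbf T_n\cdots\mathbf T_1(\mathbb K_1)=a^2\,\mathbb K_1^{-1}\cdots\mathbb K_n^{-1},\qquad \mathrm{ev}_a(\mathfrak C)=a^2.$$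
   Context: $q\in\mathbb C^\times$ is not a root of unity, $n\ge 2$, $[k]=\frac{q^k-q^{-k}}{q-q^{-1}}$, and $[x,y]_v=xy-v\,yx$. $I_0=\{1,\dots,n\}$, $I=I_0\cup\{0\}$, and $(a_{ij})_{i,j\in I}$ is the Cartan matrix of $\widehat{\mathfrak{sl}}_{n+1}$ (nodes $i$ and $i+1$ mod $n+1$ are adjacent). $\widetilde{\mathbf U}^\imath_{\mathsf{aff}}$ is the $\mathbb C$-algebra generated by $B_i$ and central invertible elements $\mathbb K_i$ ($i\in I$) subject to: $B_iB_j=B_jB_i$ if $a_{ij}=0$; $B_i^2B_j-[2]B_iB_jB_i+B_jB_i^2=-q^{-1}\mathbb K_iB_j$ if $a_{ij}=-1$. $\widetilde{\mathbf U}^\imath$ is the subalgebra generated by $B_i,\mathbb K_i^{\pm1}$ ($i\in I_0$). For $\mu=\sum d_i\alpha_i$ in the lattice $\bigoplus_{i\in I}\mathbb Z\alpha_i$ put $\mathbb K_\mu=\prod\mathbb K_i^{d_i}$, and $\mathfrak C=\mathbb K_\delta=\mathbb K_0\mathbb K_1\cdots\mathbb K_n$. Braid group action: for $i\in I$, $\mathbf T_i$ is the automorphism of $\widetilde{\mathbf U}^\imath_{\mathsf{aff}}$ with $\mathbf T_i(\mathbb K_\mu)=\mathbb K_{s_i\mu}$, $\mathbf T_i(B_i)=\mathbb K_i^{-1}B_i$, $\mathbf T_i(B_j)=B_j$ if $a_{ij}=0$, $\mathbf T_i(B_j)=B_jB_i-qB_iB_j$ if $a_{ij}=-1$; $\mathbf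 T_\pi$ is the automorphism $B_i\mapsto B_{i+1}$, $\mathbb K_i\mapsto\mathbb K_{i+1}$ (indices mod $n+1$). They define an action of the braid group of the extended affine Weyl group $\widetilde W=W_0\ltimes P$ ($W_0$ the Weyl group and $P$ the weight lattice of $\mathfrak{sl}_{n+1}$); for a reduced expression $w=\pi^k s_{i_1}\cdots s_{i_m}$ one sets $\mathbf T_w=\mathbf T_\pi^k\mathbf T_{i_1}\cdots\mathbf T_{i_m}$. Here $\omega_1$ is the first fundamental weight and $\pi^{-1}\omega_1=s_n\cdots s_1$ in $\widetilde W$. $\mathcal B$ is the braid group of $W_0$, acting on $\widetilde{\mathbf U}^\imath_{\mathsf{aff}}$ and on $\widetilde{\mathbf U}^\imath$ by $\mathbf T_1,\dots,\mathbf T_n$. *)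

theory Defs
  imports Complex_Main "HOL-Library.Poly_Mapping" "HOL-Library.FuncSet"
    "HOL-Algebra.QuotRing" "HOL-Algebra.Generated_Rings"
begin

section \<open>Free associative algebras over the complex numbers\<close>

text \<open>
  A copy of the list type, written additively so that \<open>'g free_monoid \<Rightarrow>\<^sub>0 complex\<close> with the
  convolution product of \<^theory>\<open>HOL-Library.Poly_Mapping\<close> is the free associative algebra.
\<close>

datatype 'g free_monoid = Word (letters: "'g list")

instantiation free_monoid :: (type) monoid_add
begin

definition zero_free_monoid :: "'a free_monoid" where
  "0 = Word []"

definition plus_free_monoid :: "'a free_monoid \<Rightarrow> 'a free_monoid \<Rightarrow> 'a free_monoid" where
  "u + v = Word (letters u @ letters v)"

instance
  by standard (simp_all add: zero_free_monoid_def plus_free_monoid_def)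

end

type_synonym 'g free_alg = "'g free_monoid \<Rightarrow>\<^sub>0 complex"

definition fgen :: "'g \<Rightarrow> 'g free_alg" where
  "fgen g = Poly_Mapping.single (Word [g]) 1"

definition fconst :: "complex \<Rightarrow> 'g free_alg" where
  "fconst c = Poly_Mapping.single 0 c"

definition free_algebra :: "'g set \<Rightarrow> 'g free_alg ring" where
  "free_algebra G =
     \<lparr>carrier = {f. \<forall>w \<in> Poly_Mapping.keys f. set (letters w) \<subseteq> G},
      mult = (*), one = 1, zero = 0, add = (+)\<rparr>"


section \<open>The affine iquantum group and its finite-type subalgebra\<close>

text \<open>Affine Cartan matrix on the nodes \<open>{0..n}\<close>, where \<open>n \<ge> 2\<close>.\<close>

definition cartan :: "nat \<Rightarrow> nat \<Rightarrow> nat \<Rightarrow> int" where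
  "cartan n i j =
     (if i = j then 2
      else if j = (i + 1) mod (n + 1) \<or> i = (j + 1) mod (n + 1) then -1
      else 0)"

definition qnum :: "complex \<Rightarrow> int \<Rightarrow> complex" where
  "qnum q k = (q powi k - q powi (- k)) / (q - inverse q)"

datatype gen = GB nat | GK nat | GKinv nat

definition gens :: "nat \<Rightarrow> gen set" where
  "gens n = GB ` {0..n} \<union> GK ` {0..n} \<union> GKinv ` {0..n}"

definition relators :: "nat \<Rightarrow> complex \<Rightarrow> gen free_alg set" where
  "relators n q =
     {fgen (GK i) * fgen g - fgen g * fgen (GK i) | i g. i \<le> n \<and> g \<in> gens n}
   \<union> {fgen (GK i) * fgen (GKinv i) - 1 | i. i \<le> n}
   \<union> {fgen (GKinv i) * fgen (GK i) - 1 | i. i \<le> n}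
   \<union> {fgen (GB i) * fgen (GB j) - fgen (GB j) * fgen (GB i)
        | i j. i \<le> n \<and> j \<le> n \<and> cartan n i j = 0}
   \<union> {fgen (GB i) ^ 2 * fgen (GB j)
        - fconst (qnum q 2) * fgen (GB i) * fgen (GB j) * fgen (GB i)
        + fgen (GB j) * fgen (GB i) ^ 2
        - fconst (- inverse q) * fgen (GK i) * fgen (GB j)
        | i j. i \<le> n \<and> j \<le> n \<and> cartan n i j = -1}"

definition rel_ideal :: "nat \<Rightarrow> complex \<Rightarrow> gen free_alg set" where
  "rel_ideal n q = genideal (free_algebra (gens n)) (relators n q)"

definition Uaff :: "nat \<Rightarrow> complex \<Rightarrow> gen free_alg set ring" where
  "Uaff n q = free_algebra (gens n) Quot rel_ideal n q"

definition quot_class :: "nat \<Rightarrow> complex \<Rightarrow> gen free_alg \<Rightarrow> gen free_alg set" where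
  "quot_class n q f = rel_ideal n q +>\<^bsub>free_algebra (gens n)\<^esub> f"

definition Bg :: "nat \<Rightarrow> complex \<Rightarrow> nat \<Rightarrow> gen free_alg set" where
  "Bg n q i = quot_class n q (fgen (GB i))"

definition Kg :: "nat \<Rightarrow> complex \<Rightarrow> nat \<Rightarrow> gen free_alg set" where
  "Kg n q i = quot_class n q (fgen (GK i))"

text \<open>
  The \<open>\<complex>\<close>-algebra structure of \<open>Uaff n q\<close> and of its subalgebras is given by the structure map
  \<open>scal n q\<close>.
\<close>

definition scal :: "nat \<Rightarrow> complex \<Rightarrow> complex \<Rightarrow> gen free_alg set" where
  "scal n q c = quot_class n q (fconst c)"

definition smul :: "nat \<Rightarrow> complex \<Rightarrow> complex \<Rightarrow> gen free_alg set \<Rightarrow> gen free_alg set" where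
  "smul n q c x = scal n q c \<otimes>\<^bsub>Uaff n q\<^esub> x"

definition Ufin :: "nat \<Rightarrow> complex \<Rightarrow> gen free_alg set ring" where
  "Ufin n q =
     (Uaff n q)\<lparr>carrier :=
        generate_ring (Uaff n q)
          (range (scal n q) \<union> Bg n q ` {1..n} \<union> Kg n q ` {1..n}
           \<union> (\<lambda>i. inv\<^bsub>Uaff n q\<^esub> Kg n q i) ` {1..n})\<rparr>"

text \<open>
  Homomorphisms of \<open>\<complex>\<close>-algebras, for algebras \<open>R\<close> and \<open>S\<close> sharing the structure map \<open>\<iota>\<close>.
\<close>

definition alg_hom :: "(complex \<Rightarrow> 'a) \<Rightarrow> 'a ring \<Rightarrow> 'a ring \<Rightarrow> ('a \<Rightarrow> 'a) set" where
  "alg_hom \<iota> R S = {h \<in> ring_hom R S. \<forall>c. h (\<iota> c) = \<iota> c}"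

definition alg_aut :: "(complex \<Rightarrow> 'a) \<Rightarrow> 'a ring \<Rightarrow> ('a \<Rightarrow> 'a) set" where
  "alg_aut \<iota> R = {h \<in> ring_iso R R. \<forall>c. h (\<iota> c) = \<iota> c}"

definition prod_of :: "('a, 'b) ring_scheme \<Rightarrow> 'a list \<Rightarrow> 'a" where
  "prod_of R xs = foldr (\<lambda>x y. x \<otimes>\<^bsub>R\<^esub> y) xs \<one>\<^bsub>R\<^esub>"

text \<open>
  An element \<open>\<Sum> d\<^sub>i \<alpha>\<^sub>i\<close> of the affine root lattice is given by its coefficient function \<open>d\<close>, of which
  only the values on \<open>{0..n}\<close> matter.
\<close>

definition Kmon :: "nat \<Rightarrow> complex \<Rightarrow> (nat \<Rightarrow> int) \<Rightarrow> gen free_alg set" where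
  "Kmon n q d = prod_of (Uaff n q) (map (\<lambda>i. Kg n q i [^]\<^bsub>Uaff n q\<^esub> d i) [0..<n + 1])"

definition Celt :: "nat \<Rightarrow> complex \<Rightarrow> gen free_alg set" where
  "Celt n q = Kmon n q (\<lambda>_. 1)"

definition root_refl :: "nat \<Rightarrow> nat \<Rightarrow> (nat \<Rightarrow> int) \<Rightarrow> (nat \<Rightarrow> int)" where
  "root_refl n i d = d(i := d i - (\<Sum>j = 0..n. cartan n i j * d j))"

definition vbracket ::
    "nat \<Rightarrow> complex \<Rightarrow> complex \<Rightarrow> gen free_alg set \<Rightarrow> gen free_alg set \<Rightarrow> gen free_alg set" where
  "vbracket n q v x y =
     (x \<otimes>\<^bsub>Uaff n q\<^esub> y) \<ominus>\<^bsub>Uaff n q\<^esub> smul n q v (y \<otimes>\<^bsub>Uaff n q\<^esub> x)"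

text \<open>\<open>nested_vbracket n q v [x\<^sub>1, \<dots>, x\<^sub>m] = [x\<^sub>1, [x\<^sub>2, \<dots> [x\<^bsub>m-1\<^esub>, x\<^sub>m]\<^sub>v \<dots>]\<^sub>v]\<^sub>v\<close>\<close>

fun nested_vbracket ::
    "nat \<Rightarrow> complex \<Rightarrow> complex \<Rightarrow> gen free_alg set list \<Rightarrow> gen free_alg set" where
  "nested_vbracket n q v [] = \<one>\<^bsub>Uaff n q\<^esub>"
| "nested_vbracket n q v [x] = x"
| "nested_vbracket n q v (x # y # ys) = vbracket n q v x (nested_vbracket n q v (y # ys))"


section \<open>Braid group operators\<close>

text \<open>
  The prescribed values determine an automorphism on the carrier; membership in
  \<^const>\<open>extensional\<close> fixes the irrelevant values off the carrier, so that \<open>THE\<close> applies.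
\<close>

definition braidT ::
    "nat \<Rightarrow> complex \<Rightarrow> nat \<Rightarrow> gen free_alg set \<Rightarrow> gen free_alg set" where
  "braidT n q i =
     (THE f. f \<in> alg_aut (scal n q) (Uaff n q) \<and> f \<in> extensional (carrier (Uaff n q)) \<and>
        (\<forall>d. f (Kmon n q d) = Kmon n q (root_refl n i d)) \<and>
        f (Bg n q i) = inv\<^bsub>Uaff n q\<^esub> (Kg n q i) \<otimes>\<^bsub>Uaff n q\<^esub> Bg n q i \<and>
        (\<forall>j \<le> n. cartan n i j = 0 \<longrightarrow> f (Bg n q j) = Bg n q j) \<and>
        (\<forall>j \<le> n. cartan n i j = -1 \<longrightarrow>
           f (Bg n q j) =
             (Bg n q j \<otimes>\<^bsub>Uaff n q\<^esub> Bg n q i)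
             \<ominus>\<^bsub>Uaff n q\<^esub> smul n q q (Bg n q i \<otimes>\<^bsub>Uaff n q\<^esub> Bg n q j)))"

definition braidTpi :: "nat \<Rightarrow> complex \<Rightarrow> gen free_alg set \<Rightarrow> gen free_alg set" where
  "braidTpi n q =
     (THE f. f \<in> alg_aut (scal n q) (Uaff n q) \<and> f \<in> extensional (carrier (Uaff n q)) \<and>
        (\<forall>i \<le> n. f (Bg n q i) = Bg n q ((i + 1) mod (n + 1)) \<and>
                 f (Kg n q i) = Kg n q ((i + 1) mod (n + 1))))"

text \<open>\<open>comp_word F [i\<^sub>1, \<dots>, i\<^sub>m] = F i\<^sub>1 \<circ> \<dots> \<circ> F i\<^sub>m\<close>\<close>

definition comp_word :: "('i \<Rightarrow> 'a \<Rightarrow> 'a) \<Rightarrow> 'i list \<Rightarrow> 'a \<Rightarrow> 'a" where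
  "comp_word F is = foldr (\<circ>) (map F is) id"


section \<open>The extended affine Weyl group\<close>

text \<open>
  \<open>W\<^sub>0 \<ltimes> P\<close> acts faithfully on the weight lattice \<open>P\<close> by affine transformations, and its elements are
  represented by these transformations; the product is composition. A weight \<open>\<Sum> x\<^sub>j \<omega>\<^sub>j\<close> is given by
  its coefficient function on \<open>{1..n}\<close>; other coefficients are left untouched by \<open>W\<^sub>0\<close>.
\<close>

type_synonym weight = "nat \<Rightarrow> int"

definition fund_weight :: "nat \<Rightarrow> weight" where
  "fund_weight i = (\<lambda>j. if j = i then 1 else 0)"

definition simple_root :: "nat \<Rightarrow> nat \<Rightarrow> weight" where
  "simple_root n i = (\<lambda>j. if j \<in> {1..n} then cartan n j i else 0)"

definition highest_root :: "nat \<Rightarrow> weight" where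
  "highest_root n = (\<lambda>j. \<Sum>i = 1..n. simple_root n i j)"

definition transl :: "weight \<Rightarrow> weight \<Rightarrow> weight" where
  "transl y x = (\<lambda>j. x j + y j)"

text \<open>
  \<open>s\<^sub>0 = t\<^sub>\<theta> s\<^sub>\<theta>\<close> is the reflection in the wall \<open>\<langle>x, \<theta>\<^sup>\<or>\<rangle> = 1\<close> of the fundamental alcove, where
  \<open>\<langle>x, \<theta>\<^sup>\<or>\<rangle> = x\<^sub>1 + \<dots> + x\<^sub>n\<close>.
\<close>

definition aff_refl :: "nat \<Rightarrow> nat \<Rightarrow> weight \<Rightarrow> weight" where
  "aff_refl n i x =
     (if i = 0 then (\<lambda>j. x j - ((\<Sum>k = 1..n. x k) - 1) * highest_root n j)
      else (\<lambda>j. x j - x i * simple_root n i j))"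

text \<open>
  The length-zero element \<open>\<pi> = \<omega>\<^sub>1 s\<^sub>1 \<cdots> s\<^sub>n\<close>; it satisfies \<open>\<pi> s\<^sub>i \<pi>\<^sup>-\<^sup>1 = s\<^bsub>i+1\<^esub>\<close> with
  indices modulo \<open>n + 1\<close>.
\<close>

definition weyl_pi :: "nat \<Rightarrow> weight \<Rightarrow> weight" where
  "weyl_pi n = transl (fund_weight 1) \<circ> comp_word (aff_refl n) [1..<n + 1]"

definition weyl_expr :: "nat \<Rightarrow> (weight \<Rightarrow> weight) \<Rightarrow> nat \<Rightarrow> nat list \<Rightarrow> bool" where
  "weyl_expr n w k is \<longleftrightarrow>
     set is \<subseteq> {0..n} \<and> w = (weyl_pi n ^^ k) \<circ> comp_word (aff_refl n) is"

definition reduced_expr :: "nat \<Rightarrow> (weight \<Rightarrow> weight) \<Rightarrow> nat \<Rightarrow> nat list \<Rightarrow> bool" where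
  "reduced_expr n w k is \<longleftrightarrow>
     weyl_expr n w k is \<and> (\<forall>k' is'. weyl_expr n w k' is' \<longrightarrow> length is \<le> length is')"

text \<open>
  \<open>T\<^sub>w\<close>, computed from an arbitrarily chosen reduced expression; it does not depend on the choice.
\<close>

definition braidTw ::
    "nat \<Rightarrow> complex \<Rightarrow> (weight \<Rightarrow> weight) \<Rightarrow> gen free_alg set \<Rightarrow> gen free_alg set" where
  "braidTw n q w =
     (let (k, is) = (SOME (k, is). reduced_expr n w k is)
      in (braidTpi n q ^^ k) \<circ> comp_word (braidT n q) is)"

definition pi_inv_omega1 :: "nat \<Rightarrow> weight \<Rightarrow> weight" where
  "pi_inv_omega1 n = inv_into UNIV (weyl_pi n) \<circ> transl (fund_weight 1)"

end

theory Submission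
  imports Defs
begin

text \<open>
  The affine algebra is given by generators and relations, so a homomorphism out of it is a family
  of elements \<open>b\<^sub>0, \<dots>, b\<^sub>n, k\<^sub>0, \<dots>, k\<^sub>n\<close> that satisfies these relations (\<open>iquantum_rels\<close>), and two
  homomorphisms agree as soon as they agree on the generators. Hence the existence of the braid
  operators, the existence of the evaluation map and its equivariance all become identities between
  iterated \<open>q\<close>-brackets \<open>[x, y]\<^sub>q = x y - q y x\<close>.

  \<^emph>\<open>Braid operators.\<close> The Serre relation for the pair \<open>(x, y)\<close> says
  \<open>[[y, x]\<^sub>q, x]\<^bsub>1/q\<^esub> = - q\<^sup>-\<^sup>1 k y\<close>. In this form it can be used to move \<open>x\<close> past the bracket
  \<open>[y, x]\<^sub>q\<close>, and the images of the relations under \<open>T\<^sub>i\<close> reduce to four statements about two or three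
  elements: \<open>qserre_bracket\<close> (a bond at \<open>i\<close>), \<open>qserre_bracket_left\<close> (a bond \<open>j - l\<close> with only \<open>j\<close>
  adjacent to \<open>i\<close>), \<open>qbr_commute_right\<close> (\<open>j\<close> and \<open>l\<close> adjacent to \<open>i\<close> but not to each other) and
  \<open>qserre_bracket_both\<close> (a triangle \<open>i, j, l\<close>, which occurs for \<open>n = 2\<close>). Only the entries
  \<open>a\<^sub>i\<^sub>j, a\<^sub>i\<^sub>l, a\<^sub>j\<^sub>l\<close> of the Cartan matrix enter, never the shape of the diagram. The inverse operator
  arises from the same argument in the opposite algebra.

  \<^emph>\<open>Evaluation.\<close> Let \<open>X = [B\<^sub>1, [B\<^sub>2, \<dots> [B\<^bsub>n-1\<^esub>, B\<^sub>n]\<^sub>q \<dots>]\<^sub>q]\<^sub>q\<close> and \<open>M = K\<^sub>1 \<cdots> K\<^sub>n\<close>. Building \<open>X\<close> up one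
  factor at a time, \<open>qserre_bracket_left\<close> and its mirror image \<open>qserre_bracket_right\<close> show that \<open>X\<close> and
  each end generator \<open>B\<^sub>1\<close>, \<open>B\<^sub>n\<close> satisfy both Serre relations, with \<open>M\<close> as the central element of \<open>X\<close>;
  \<open>qbr_middle_commute\<close> shows that \<open>X\<close> commutes with the inner generators. Rescaling \<open>X\<close> to
  \<open>E = a M\<^sup>-\<^sup>1 X\<close> turns its central element into \<open>(a M\<^sup>-\<^sup>1)\<^sup>2 M = a\<^sup>2 M\<^sup>-\<^sup>1\<close>, so \<open>E\<close> and \<open>a\<^sup>2 M\<^sup>-\<^sup>1\<close> can take the
  places of \<open>B\<^sub>0\<close> and \<open>K\<^sub>0\<close> (\<open>iquantum_rels_ev\<close>). Since \<open>T\<^sub>i\<close> changes only the factors of \<open>X\<close> next to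
  position \<open>i\<close>, one finds \<open>T\<^sub>i E = E\<close> for \<open>1 < i < n\<close> and \<open>T\<^sub>i E = [E, B\<^sub>i]\<^sub>q\<close> for \<open>i = 1, n\<close>, which is how
  \<open>T\<^sub>i\<close> acts on \<open>B\<^sub>0\<close>; this is the equivariance (\<open>eval_braid\<close>). The same bookkeeping gives
  \<open>T\<^sub>n \<cdots> T\<^sub>1 (B\<^sub>1) = M\<^sup>-\<^sup>1 X\<close>.

  \<^emph>\<open>The Weyl group element.\<close> The reduced expressions of \<open>\<pi>\<^sup>-\<^sup>1 \<omega>\<^sub>1\<close> are exactly the
  \<open>\<pi>\<^sup>r s\<^sub>n \<cdots> s\<^sub>1\<close> with \<open>n + 1\<close> dividing \<open>r\<close> (\<open>coxeter_expr_unique\<close>), and \<open>T\<^sub>\<pi>\<close> has order dividing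
  \<open>n + 1\<close>; so every choice of a reduced expression yields \<open>T\<^sub>n \<cdots> T\<^sub>1\<close>.

  The identities are proved in a type class of complex algebras, where equational reasoning is
  convenient. The rings \<open>Uaff n q\<close> depend on parameters and are not types; they are reached as the
  components of one product algebra \<open>Uprod\<close> over all \<open>n\<close> and \<open>q\<close>.
\<close>

section \<open>Complex algebras and the Serre relation\<close>

text \<open>
  The zero algebra is admitted, so that a quotient by relations is an instance without a proof that
  it is nontrivial.
\<close>

class complex_algebra = ring + monoid_mult +
  fixes scaleC :: "complex \<Rightarrow> 'a \<Rightarrow> 'a" (infixr "*\<^sub>C" 75)
  assumes scaleC_add_right: "c *\<^sub>C (x + y) = c *\<^sub>C x + c *\<^sub>C y"
    and scaleC_add_left: "(c + d) *\<^sub>C x = c *\<^sub>C x + d *\<^sub>C x"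
    and scaleC_scaleC [simp]: "c *\<^sub>C d *\<^sub>C x = (c * d) *\<^sub>C x"
    and scaleC_one [simp]: "1 *\<^sub>C x = x"
    and mult_scaleC_left [simp]: "(c *\<^sub>C x) * y = c *\<^sub>C (x * y)"
    and mult_scaleC_right [simp]: "x * (c *\<^sub>C y) = c *\<^sub>C (x * y)"
begin

lemma scaleC_zero_right [simp]: "c *\<^sub>C 0 = 0"
  using scaleC_add_right[of c 0 0] by simp

lemma scaleC_zero_left [simp]: "0 *\<^sub>C x = 0"
  using scaleC_add_left[of 0 0 x] by simp

lemma scaleC_minus_right [simp]: "c *\<^sub>C (- x) = - (c *\<^sub>C x)"
  using scaleC_add_right[of c x "- x"] by (simp add: eq_neg_iff_add_eq_0 add.commute)

lemma scaleC_minus_left [simp]: "(- c) *\<^sub>C x = - (c *\<^sub>C x)"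
  using scaleC_add_left[of c "- c" x] by (simp add: eq_neg_iff_add_eq_0 add.commute)

lemma scaleC_diff_right: "c *\<^sub>C (x - y) = c *\<^sub>C x - c *\<^sub>C y"
  using scaleC_add_right[of c x "- y"] by simp

lemma scaleC_diff_left: "(c - d) *\<^sub>C x = c *\<^sub>C x - d *\<^sub>C x"
  using scaleC_add_left[of c "- d" x] by simp

lemma scaleC_cancel: "c \<noteq> 0 \<Longrightarrow> c *\<^sub>C x = c *\<^sub>C y \<longleftrightarrow> x = y"
  by (metis left_inverse scaleC_one scaleC_scaleC)

lemma scaleC_eq_zero: "c \<noteq> 0 \<Longrightarrow> c *\<^sub>C x = 0 \<longleftrightarrow> x = 0"
  by (metis scaleC_cancel scaleC_zero_right)

lemmas scaleC_distribs = scaleC_add_right scaleC_add_left scaleC_diff_right scaleC_diff_left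

end

text \<open>
  With words kept right-associated, a relation \<open>a b = c\<close> must also fire in the middle of a word. The
  two forms give a terminating rewrite rule for an ordering relation and for a commutation.
\<close>

lemma assoc_rewrite: "a * b = c \<Longrightarrow> a * (b * w) = c * (w :: 'a :: semigroup_mult)"
  by (metis mult.assoc)

lemma comm_rewrite: "a * b = b * a \<Longrightarrow> a * (b * w) = b * (a * (w :: 'a :: semigroup_mult))"
  by (metis mult.assoc)

definition qbr :: "complex \<Rightarrow> 'a :: complex_algebra \<Rightarrow> 'a \<Rightarrow> 'a" where
  "qbr q x y = x * y - q *\<^sub>C (y * x)"

text \<open>
  The relation satisfied by \<open>x = B\<^sub>i\<close>, \<open>y = B\<^sub>j\<close>, \<open>k = K\<^sub>i\<close> for adjacent \<open>i\<close>, \<open>j\<close>. The central element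
  is an argument because the same relation holds for iterated brackets with products of the \<open>K\<^sub>i\<close>.
\<close>

definition qserre :: "complex \<Rightarrow> 'a :: complex_algebra \<Rightarrow> 'a \<Rightarrow> 'a \<Rightarrow> bool" where
  "qserre q k x y \<longleftrightarrow>
     x * x * y - qnum q 2 *\<^sub>C (x * y * x) + y * x * x
       = (- inverse q) *\<^sub>C (k * y)"

lemma qnum_two:
  assumes "q \<noteq> 0" "q ^ 2 \<noteq> 1"
  shows "qnum q 2 = q + inverse q"
proof -
  have "q - inverse q \<noteq> 0"
    using assms by (simp add: field_simps power2_eq_square)
  moreover have "q powi 2 - q powi (- 2) = (q + inverse q) * (q - inverse q)"
    using assms by (simp add: field_simps power2_eq_square power_int_def)
  ultimately show ?thesis
    by (simp add: qnum_def)
qed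

text \<open>
  The inverse of \<open>q\<close> gets a name of its own: the rules \<open>qp\<close> then normalise Laurent monomials in \<open>q\<close>,
  and identities between brackets become comparisons of monomials.
\<close>

locale qparam =
  fixes q p :: complex
  assumes q0: "q \<noteq> 0" and not_root: "\<And>m. m > 0 \<Longrightarrow> q ^ m \<noteq> 1" and p_def: "p = inverse q"
begin

lemma qp [simp]: "q * p = 1" "p * q = 1" "q * (p * z) = z" "p * (q * z) = z"
  using q0 by (simp_all add: p_def)

lemma qnum2: "qnum q 2 = q + p"
  using qnum_two[OF q0 not_root[of 2]] by (simp add: p_def)

lemma qp_nonzero: "q + p \<noteq> 0" "q * q + 1 + p * p \<noteq> 0"
proof -
  have 1: "q * q * (q * q) \<noteq> 1"
    using not_root[of 4] by (simp add: power4_eq_xxxx ac_simps)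
  then have 2: "1 + q * q \<noteq> 0"
    by (metis add_eq_0_iff minus_mult_minus mult_1)
  have "q * (q + p) = 1 + q * q" by (simp add: distrib_left)
  with 2 show "q + p \<noteq> 0" by force
  have "q ^ 6 = 1" if "q * q + 1 + p * p = 0"
  proof -
    have "q ^ 2 * (q * q + 1 + p * p) = q ^ 4 + q ^ 2 + 1"
      by (simp add: power2_eq_square power4_eq_xxxx distrib_left mult.assoc)
    then have "q ^ 4 + q ^ 2 + 1 = 0" using that by simp
    moreover have "q ^ 6 - 1 = (q ^ 2 - 1) * (q ^ 4 + q ^ 2 + 1)"
      by (simp add: algebra_simps flip: power_add)
    ultimately show ?thesis by simp
  qed
  then show "q * q + 1 + p * p \<noteq> 0" using not_root[of 6] by auto
qed

text \<open>
  The quadratic polynomial \<open>t\<^sup>2 - [2] t + 1\<close> factors as \<open>(t - q) (t - q\<^sup>-\<^sup>1)\<close>, so the Serre relation is a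
  commutation rule between \<open>x\<close> and the bracket of \<open>x\<close> and \<open>y\<close>, in either order of the bracket.
\<close>

lemma qserre_right_iff:
  "qserre q k x y \<longleftrightarrow> qbr q y x * x = p *\<^sub>C (x * qbr q y x) - p *\<^sub>C (k * y)"
  unfolding qserre_def qnum2 qbr_def p_def[symmetric]
  by (auto simp: algebra_simps scaleC_distribs)

lemma qserre_left_iff:
  "qserre q k x y \<longleftrightarrow> x * qbr q x y = p *\<^sub>C (qbr q x y * x) - p *\<^sub>C (k * y)"
  unfolding qserre_def qnum2 qbr_def p_def[symmetric]
  by (auto simp: algebra_simps scaleC_distribs)

lemma qserre_right:
  "qserre q k x y \<Longrightarrow> qbr q y x * x = p *\<^sub>C (x * qbr q y x) - p *\<^sub>C (k * y)"
  "qserre q k x y \<Longrightarrow> x * qbr q y x = q *\<^sub>C (qbr q y x * x) + k * y"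
  by (simp_all add: qserre_right_iff scaleC_distribs)

lemma qserre_left:
  "qserre q k x y \<Longrightarrow> x * qbr q x y = p *\<^sub>C (qbr q x y * x) - p *\<^sub>C (k * y)"
  "qserre q k x y \<Longrightarrow> qbr q x y * x = q *\<^sub>C (x * qbr q x y) + k * y"
  by (simp_all add: qserre_left_iff scaleC_distribs)

end

section \<open>The opposite algebra\<close>

text \<open>
  The Serre relation is invariant under reversal of words, while \<open>[x, y]\<^sub>q\<close> becomes \<open>[y, x]\<^sub>q\<close>. Passing to
  the opposite algebra therefore yields the mirror image of every identity below.
\<close>

datatype 'a op = Op (unop: 'a)

instantiation op :: (complex_algebra) complex_algebra
begin

definition "0 = Op 0"
definition "1 = Op 1"
definition "x + y = Op (unop x + unop y)"
definition "x - y = Op (unop x - unop y)"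
definition "- x = Op (- unop x)"
definition "x * y = Op (unop y * unop x)"
definition "c *\<^sub>C x = Op (c *\<^sub>C unop x)"

lemmas op_defs = zero_op_def one_op_def plus_op_def minus_op_def uminus_op_def times_op_def
  scaleC_op_def

instance
  by standard (simp_all add: op_defs algebra_simps scaleC_distribs)

end

lemma Op_simps:
  "Op x + Op y = Op (x + y)" "Op x - Op y = Op (x - y)" "Op x * Op y = Op (y * x)"
  "- Op x = Op (- x)" "c *\<^sub>C Op x = Op (c *\<^sub>C x)"
  by (simp_all add: op_defs)

lemma qbr_Op: "qbr q (Op x) (Op y) = Op (qbr q y x)"
  by (simp add: qbr_def Op_simps)

lemma qserre_Op: "y * k = k * y \<Longrightarrow> qserre q (Op k) (Op x) (Op y) \<longleftrightarrow> qserre q k x y"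
  by (simp add: qserre_def Op_simps algebra_simps)

section \<open>Brackets of two and three elements\<close>

context qparam
begin

text \<open>
  The three rules for \<open>y x\<close>, \<open>X x\<close> and \<open>X y\<close> with \<open>X = [y, x]\<^sub>q\<close> bring every word into the order
  \<open>x, y, X\<close>, like the multiplication of root vectors in rank two; the four relations are then seen by
  comparing normal forms.
\<close>

lemma qserre_bracket:
  fixes x y k m :: "'a :: complex_algebra"
  assumes S: "qserre q k x y" "qserre q m y x"
    and k: "x * k = k * x" "y * k = k * y" and m: "x * m = m * x" "y * m = m * y"
    and km: "m * k = k * m"
  shows "qserre q (k * m) (qbr q y x) x" "qserre q (k * m) (qbr q y x) y"
    "qserre q k x (qbr q y x)" "qserre q m y (qbr q y x)"
proof -
  define X where "X = qbr q y x"
  have yx: "y * x = q *\<^sub>C (x * y) + X" by (simp add: X_def qbr_def)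
  have Xx: "X * x = p *\<^sub>C (x * X) - p *\<^sub>C (k * y)"
    using qserre_right(1)[OF S(1)] by (simp add: X_def)
  have Xy: "X * y = q *\<^sub>C (y * X) + m * x"
    using qserre_left(2)[OF S(2)] by (simp add: X_def)
  note rules = yx Xx Xy yx[THEN assoc_rewrite] Xx[THEN assoc_rewrite] Xy[THEN assoc_rewrite]
    k m km k[THEN assoc_rewrite] m[THEN assoc_rewrite] km[THEN assoc_rewrite]
  have kX: "X * k = k * X" "X * m = m * X"
    by (simp_all add: X_def qbr_def algebra_simps k m k[THEN assoc_rewrite] m[THEN assoc_rewrite])
  note rules = rules kX kX[THEN assoc_rewrite] qserre_def qnum2 p_def[symmetric]
  show "qserre q (k * m) (qbr q y x) x" "qserre q (k * m) (qbr q y x) y"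
    "qserre q k x (qbr q y x)" "qserre q m y (qbr q y x)"
    unfolding X_def[symmetric]
    by (simp_all add: rules algebra_simps scaleC_distribs)
qed

text \<open>
  Both \<open>X = [y, x]\<^sub>q\<close> and \<open>W = [y, z]\<^sub>q\<close> are brackets with the common neighbour \<open>y\<close>, and
  \<open>Z = [X, z]\<^sub>q = [W, x]\<^sub>q\<close> because \<open>x\<close> and \<open>z\<close> commute. Evaluating the commutator of \<open>y\<close> and \<open>Z\<close> from the
  two expressions gives results that are interchanged by swapping \<open>X\<close> and \<open>W\<close>; their difference is
  \<open>[2] (X W - W X)\<close>.
\<close>

lemma qbr_commute_left:
  fixes x y z k :: "'a :: complex_algebra"
  assumes S: "qserre q k y x" "qserre q k y z" and xz: "x * z = z * x"
    and k: "x * k = k * x" "y * k = k * y" "z * k = k * z"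
  shows "qbr q y x * qbr q y z = qbr q y z * qbr q y x"
proof -
  define X W where "X = qbr q y x" and "W = qbr q y z"
  have X: "y * X = p *\<^sub>C (X * y) - p *\<^sub>C (k * x)"
    using qserre_left(1)[OF S(1)] by (simp add: X_def)
  have W: "y * W = p *\<^sub>C (W * y) - p *\<^sub>C (k * z)"
    using qserre_left(1)[OF S(2)] by (simp add: W_def)
  have yx: "y * x = q *\<^sub>C (x * y) + X" and yz: "y * z = q *\<^sub>C (z * y) + W"
    by (simp_all add: X_def W_def qbr_def)
  have Z: "X * z - q *\<^sub>C (z * X) = W * x - q *\<^sub>C (x * W)"
    by (simp add: X_def W_def qbr_def algebra_simps scaleC_distribs xz xz[THEN assoc_rewrite])
  note rules = X W yx yz X[THEN assoc_rewrite] W[THEN assoc_rewrite] yx[THEN assoc_rewrite]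
    yz[THEN assoc_rewrite] k k[THEN assoc_rewrite]
  have "y * (X * z - q *\<^sub>C (z * X)) - (X * z - q *\<^sub>C (z * X)) * y
      = p *\<^sub>C (X * W) - q *\<^sub>C (W * X) + q *\<^sub>C (k * (z * x)) - p *\<^sub>C (k * (x * z))"
    by (simp add: algebra_simps scaleC_distribs rules)
  moreover have "y * (W * x - q *\<^sub>C (x * W)) - (W * x - q *\<^sub>C (x * W)) * y
      = p *\<^sub>C (W * X) - q *\<^sub>C (X * W) + q *\<^sub>C (k * (x * z)) - p *\<^sub>C (k * (z * x))"
    by (simp add: algebra_simps scaleC_distribs rules)
  ultimately have "p *\<^sub>C (X * W) - q *\<^sub>C (W * X) = p *\<^sub>C (W * X) - q *\<^sub>C (X * W)"
    by (simp add: Z xz)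
  then have "(q + p) *\<^sub>C (X * W) = (q + p) *\<^sub>C (W * X)"
    by (simp add: scaleC_distribs algebra_simps)
  then show ?thesis
    using qp_nonzero(1) by (simp add: scaleC_cancel X_def W_def)
qed

lemma qbr_commute_right:
  fixes x y z k :: "'a :: complex_algebra"
  assumes S: "qserre q k y x" "qserre q k y z" and xz: "x * z = z * x"
    and k: "x * k = k * x" "y * k = k * y" "z * k = k * z"
  shows "qbr q x y * qbr q z y = qbr q z y * qbr q x y"
  using qbr_commute_left[of "Op k" "Op y" "Op x" "Op z"] assms
  by (simp add: qserre_Op qbr_Op Op_simps)

text \<open>
  Here \<open>x - y - z\<close> is a chain. As \<open>[X, z]\<^sub>q = [W, x]\<^sub>q\<close> for \<open>W = [y, z]\<^sub>q\<close>, the element \<open>X\<close> can be moved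
  through \<open>[W, x]\<^sub>q\<close> by means of \<open>X W = W X\<close> and the rule for \<open>X x\<close>; what remains is \<open>k\<close> times the Serre
  relation for \<open>y\<close> and \<open>z\<close>.
\<close>

lemma qserre_bracket_left:
  fixes x y z k m :: "'a :: complex_algebra"
  assumes S: "qserre q k x y" "qserre q m y x" "qserre q m y z" and xz: "x * z = z * x"
    and k: "x * k = k * x" "y * k = k * y" "z * k = k * z"
    and m: "x * m = m * x" "y * m = m * y" "z * m = m * z"
  shows "qserre q (k * m) (qbr q y x) z"
proof -
  define X W where "X = qbr q y x" and "W = qbr q y z"
  have XW: "X * W = W * X"
    using qbr_commute_left[OF S(2,3) xz m] by (simp add: X_def W_def)
  have Xx: "X * x = p *\<^sub>C (x * X) - p *\<^sub>C (k * y)"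
    using qserre_right(1)[OF S(1)] by (simp add: X_def)
  have Wy: "y * W = p *\<^sub>C (W * y) - p *\<^sub>C (m * z)"
    using qserre_left(1)[OF S(3)] by (simp add: W_def)
  have Z: "qbr q X z = qbr q W x"
    by (simp add: X_def W_def qbr_def algebra_simps scaleC_distribs xz xz[THEN assoc_rewrite])
  note rules = XW Xx Wy XW[THEN assoc_rewrite] Xx[THEN assoc_rewrite] Wy[THEN assoc_rewrite]
  have kW: "W * k = k * W" "X * k = k * X"
    by (simp_all add: W_def X_def qbr_def algebra_simps k k[THEN assoc_rewrite])
  have "X * qbr q W x = p *\<^sub>C (qbr q W x * X) - p *\<^sub>C (k * m * z)"
    by (simp add: qbr_def algebra_simps scaleC_distribs rules kW kW[THEN assoc_rewrite]
        k k[THEN assoc_rewrite])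
  then show ?thesis
    by (simp add: qserre_left_iff Z flip: X_def)
qed

lemma qserre_bracket_right:
  fixes x y z k m :: "'a :: complex_algebra"
  assumes S: "qserre q k x y" "qserre q m y x" "qserre q m y z" and xz: "x * z = z * x"
    and k: "x * k = k * x" "y * k = k * y" "z * k = k * z"
    and m: "x * m = m * x" "y * m = m * y" "z * m = m * z" and km: "k * m = m * k"
  shows "qserre q (k * m) (qbr q x y) z"
proof -
  have "z * (k * m) = k * m * z"
    by (simp add: mult.assoc m(3) k(3)[THEN assoc_rewrite])
  then show ?thesis
    using qserre_bracket_left[of "Op k" "Op x" "Op y" "Op m" "Op z"] assms
    by (simp add: qserre_Op qbr_Op Op_simps)
qed

text \<open>
  The left-hand side of the Serre relation is linear in \<open>y\<close>, and \<open>z\<close> commutes with everything else in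
  it.
\<close>

lemma qserre_right_bracket:
  assumes "qserre q k x y" and "x * z = z * x" "x * k = k * x" "y * k = k * y" "z * k = k * z"
  shows "qserre q k x (qbr q y z)" "qserre q k x (qbr q z y)"
proof -
  have S: "x * (x * y) = qnum q 2 *\<^sub>C (x * (y * x)) - y * (x * x) - inverse q *\<^sub>C (k * y)"
    using assms(1) by (simp add: qserre_def algebra_simps)
  note comm = assms(2-) assms(2-)[THEN assoc_rewrite]
  show "qserre q k x (qbr q y z)" "qserre q k x (qbr q z y)"
    unfolding qserre_def qbr_def
    by (simp_all add: algebra_simps scaleC_distribs comm S S[simplified mult.assoc[symmetric], THEN assoc_rewrite, simplified mult.assoc])
qed

text \<open>
  The middle generator of a chain \<open>x - y - z\<close> commutes with the root vector of the whole chain. Moving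
  \<open>y\<close> through \<open>r = [x, [y, z]\<^sub>q]\<^sub>q = [[x, y]\<^sub>q, z]\<^sub>q\<close> in these two forms gives \<open>y r = q\<^sup>-\<^sup>2 r y + \<dots>\<close> and
  \<open>y r = q\<^sup>2 r y + \<dots>\<close>; the combination with coefficients \<open>q\<close> and \<open>q\<^sup>-\<^sup>1\<close> cancels the remaining terms.
\<close>

lemma qbr_middle_commute:
  fixes x y z k :: "'a :: complex_algebra"
  assumes S: "qserre q k y x" "qserre q k y z" and xz: "x * z = z * x"
    and k: "x * k = k * x" "y * k = k * y" "z * k = k * z"
  shows "qbr q x (qbr q y z) * y = y * qbr q x (qbr q y z)"
proof -
  define v u r where "v = qbr q y z" and "u = qbr q x y" and "r = qbr q x v"
  have v: "y * v = p *\<^sub>C (v * y) - p *\<^sub>C (k * z)"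
    using qserre_left(1)[OF S(2)] by (simp add: v_def)
  have u: "y * u = q *\<^sub>C (u * y) + k * x"
    using qserre_right(2)[OF S(1)] by (simp add: u_def)
  have yx: "y * x = p *\<^sub>C (x * y) - p *\<^sub>C u" and yz: "y * z = q *\<^sub>C (z * y) + v"
    by (simp_all add: u_def v_def qbr_def scaleC_distribs)
  have r: "r = u * z - q *\<^sub>C (z * u)"
    by (simp add: r_def v_def u_def qbr_def algebra_simps scaleC_distribs xz xz[THEN assoc_rewrite])
  note rules = v u yx yz v[THEN assoc_rewrite] u[THEN assoc_rewrite] yx[THEN assoc_rewrite]
    yz[THEN assoc_rewrite] k k[THEN assoc_rewrite] xz xz[THEN assoc_rewrite]
  have 1: "y * r = (p * p) *\<^sub>C (r * y) - p *\<^sub>C (u * v - v * u) + (1 - p * p) *\<^sub>C (k * (x * z))"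
    by (simp add: r_def qbr_def algebra_simps scaleC_distribs rules)
  have 2: "y * r = (q * q) *\<^sub>C (r * y) + q *\<^sub>C (u * v - v * u) + (1 - q * q) *\<^sub>C (k * (x * z))"
    unfolding r by (simp add: algebra_simps scaleC_distribs rules)
  have "q *\<^sub>C (y * r) + p *\<^sub>C (y * r) = q *\<^sub>C (r * y) + p *\<^sub>C (r * y)"
    by (subst 1, subst 2) (simp add: scaleC_distribs algebra_simps)
  then have "(q + p) *\<^sub>C (y * r) = (q + p) *\<^sub>C (r * y)"
    by (simp add: scaleC_distribs)
  then show ?thesis
    using qp_nonzero(1) by (simp add: scaleC_cancel r_def v_def)
qed

text \<open>
  A triangle: \<open>x\<close> is adjacent to \<open>y\<close> and \<open>z\<close>, and these are adjacent to each other. Moving \<open>x\<close> from the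
  right end of a word in \<open>y\<close>, \<open>z\<close> to its left end replaces letters by their brackets with \<open>x\<close>. In terms
  of the quantum group of rank one, \<open>y, Y\<close> and \<open>z, Z\<close> are bases of two-dimensional modules, the Serre
  expression in \<open>y, y, z\<close> is a highest weight vector of weight three, and the expression in
  \<open>Y, Y, Z\<close> is the lowest weight vector of the same four-dimensional module. Three lowering steps
  therefore turn the relation for \<open>y, z\<close> into the one for \<open>Y, Z\<close>, up to the factors \<open>[2]\<close> and \<open>[3]\<close>.
\<close>

lemma qserre_bracket_both:
  fixes x y z k m :: "'a :: complex_algebra"
  assumes x: "qserre q k x y" and y: "qserre q k x z" and S: "qserre q m y z"
    and k: "x * k = k * x" "y * k = k * y" "z * k = k * z"
    and m: "x * m = m * x" "y * m = m * y" "z * m = m * z" and km: "k * m = m * k"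
  shows "qserre q (k * m) (qbr q y x) (qbr q z x)"
proof -
  define Y Z where "Y = qbr q y x" and "Z = qbr q z x"
  have yx: "y * x = q *\<^sub>C (x * y) + Y" and zx: "z * x = q *\<^sub>C (x * z) + Z"
    by (simp_all add: Y_def Z_def qbr_def)
  have Yx: "Y * x = p *\<^sub>C (x * Y) - p *\<^sub>C (k * y)" and Zx: "Z * x = p *\<^sub>C (x * Z) - p *\<^sub>C (k * z)"
    using qserre_right(1)[OF x] qserre_right(1)[OF y] by (simp_all add: Y_def Z_def)
  have kY: "Y * k = k * Y" "Z * k = k * Z" "Y * m = m * Y" "Z * m = m * Z"
    by (simp_all add: Y_def Z_def qbr_def algebra_simps k m k[THEN assoc_rewrite] m[THEN assoc_rewrite])
  note r = yx zx Yx Zx k m km kY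
  note rules = r r[THEN assoc_rewrite]
  define S0 where "S0 = y*y*z - (q+p) *\<^sub>C (y*z*y) + z*y*y + p *\<^sub>C (m*z)"
  have S0: "S0 = 0"
    using S by (simp add: qserre_def S0_def qnum2 p_def)
  define S1 where "S1 =
      (q*q) *\<^sub>C (Y*y*z - (q+p) *\<^sub>C (Y*z*y) + Z*y*y)
    + q *\<^sub>C (y*Y*z - (q+p) *\<^sub>C (y*Z*y) + z*Y*y)
    + (y*y*Z - (q+p) *\<^sub>C (y*z*Y) + z*y*Y)
    + p *\<^sub>C (m * (Z + (q - q*q*q) *\<^sub>C (x*z)))"
  \<comment> \<open>Each lowering step takes the twisted commutator of the previous relation with \<open>x\<close>; the terms
    with \<open>k\<close> remove the raising part that the Serre relation of \<open>x\<close> adds.\<close>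
  have "S1 = S0 * x - (q*q*q) *\<^sub>C (x * S0)"
    unfolding S1_def S0_def by (simp add: algebra_simps scaleC_distribs rules)
  then have S1: "S1 = 0" by (simp add: S0)
  define S2 where "S2 =
      (q*q) *\<^sub>C (Y*Y*z - (q+p) *\<^sub>C (Y*Z*y) + Z*Y*y)
    + q *\<^sub>C (Y*y*Z - (q+p) *\<^sub>C (Y*z*Y) + Z*y*Y)
    + (y*Y*Z - (q+p) *\<^sub>C (y*Z*Y) + z*Y*Y)
    + p *\<^sub>C (m * ((1 - q*q) *\<^sub>C (x*Z) + (q*q) *\<^sub>C (k * z)))"
  have "(q + p) *\<^sub>C S2 = S1 * x - q *\<^sub>C (x * S1) + (p * (1 + q*q + q*q*q*q)) *\<^sub>C (k * S0)"
    unfolding S2_def S1_def S0_def by (simp add: algebra_simps scaleC_distribs rules)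
  then have S2: "S2 = 0" using qp_nonzero(1) by (simp add: S0 S1 scaleC_eq_zero)
  define S3 where "S3 = Y*Y*Z - (q+p) *\<^sub>C (Y*Z*Y) + Z*Y*Y + p *\<^sub>C (k*m*Z)"
  have "(q*q + 1 + p*p) *\<^sub>C S3 = S2 * x - p *\<^sub>C (x * S2) + (p * (q + p)) *\<^sub>C (k * S1)"
    unfolding S3_def S2_def S1_def by (simp add: algebra_simps scaleC_distribs rules)
  then have "S3 = 0" using qp_nonzero(2) by (simp add: S1 S2 scaleC_eq_zero)
  then show ?thesis
    by (simp add: qserre_def S3_def qnum2 p_def Y_def Z_def eq_neg_iff_add_eq_0)
qed

end

section \<open>Families satisfying the defining relations\<close>

lemma cartan_diag [simp]: "cartan n i i = 2"
  by (simp add: cartan_def)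

lemma cartan_sym: "cartan n i j = cartan n j i"
  by (simp add: cartan_def disj_commute)

lemma cartan_cases: "i = j \<or> cartan n i j = 0 \<or> cartan n i j = -1"
  by (simp add: cartan_def)

text \<open>
  The families \<open>b\<close>, \<open>k\<close>, \<open>ki\<close> are the images of the generators \<open>B\<^sub>i\<close>, \<open>K\<^sub>i\<close>, \<open>K\<^sub>i\<^sup>-\<^sup>1\<close> under a homomorphism to an
  arbitrary complex algebra.
\<close>

definition iquantum_rels ::
    "nat \<Rightarrow> complex \<Rightarrow> (nat \<Rightarrow> 'a :: complex_algebra) \<Rightarrow> (nat \<Rightarrow> 'a) \<Rightarrow> (nat \<Rightarrow> 'a) \<Rightarrow> bool" where
  "iquantum_rels n q b k ki \<longleftrightarrow>
     (\<forall>i \<le> n. k i * ki i = 1 \<and> ki i * k i = 1) \<and>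
     (\<forall>i \<le> n. \<forall>j \<le> n. b j * k i = k i * b j \<and> k j * k i = k i * k j \<and>
        (cartan n i j = 0 \<longrightarrow> b i * b j = b j * b i) \<and>
        (cartan n i j = -1 \<longrightarrow> qserre q (k i) (b i) (b j)))"

lemma inverse_commute:
  fixes k ki x :: "'a :: monoid_mult"
  assumes "k * ki = 1" "ki * k = 1" "x * k = k * x"
  shows "x * ki = ki * x"
proof -
  have "x * ki = ki * (k * x) * ki" using assms(1,2) by (simp flip: mult.assoc)
  also have "\<dots> = ki * x * (k * ki)" by (simp only: assms(3)[symmetric] mult.assoc)
  finally show ?thesis using assms(1) by simp
qed

lemma iquantum_relsD:
  assumes "iquantum_rels n q b k ki" "i \<le> n"
  shows "k i * ki i = 1" "ki i * k i = 1"
    and "j \<le> n \<Longrightarrow> b j * k i = k i * b j" "j \<le> n \<Longrightarrow> k j * k i = k i * k j"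
    and "j \<le> n \<Longrightarrow> b j * ki i = ki i * b j" "j \<le> n \<Longrightarrow> k j * ki i = ki i * k j"
    and "j \<le> n \<Longrightarrow> ki j * k i = k i * ki j" "j \<le> n \<Longrightarrow> ki j * ki i = ki i * ki j"
    and "j \<le> n \<Longrightarrow> cartan n i j = 0 \<Longrightarrow> b i * b j = b j * b i"
    and "j \<le> n \<Longrightarrow> cartan n i j = -1 \<Longrightarrow> qserre q (k i) (b i) (b j)"
proof -
  note R = assms(1)[unfolded iquantum_rels_def]
  show 1: "k i * ki i = 1" "ki i * k i = 1" using R assms by auto
  show "j \<le> n \<Longrightarrow> b j * k i = k i * b j" "j \<le> n \<Longrightarrow> k j * k i = k i * k j" using R assms by auto
  show "j \<le> n \<Longrightarrow> b j * ki i = ki i * b j" "j \<le> n \<Longrightarrow> k j * ki i = ki i * k j"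
    using R assms by (auto intro!: inverse_commute[OF 1])
  show 2: "ki j * k i = k i * ki j" if "j \<le> n" for j
    using inverse_commute[of "k j" "ki j" "k i"] R assms that by auto
  show "j \<le> n \<Longrightarrow> ki j * ki i = ki i * ki j"
    using 2 by (auto intro!: inverse_commute[OF 1])
  show "j \<le> n \<Longrightarrow> cartan n i j = 0 \<Longrightarrow> b i * b j = b j * b i"
    "j \<le> n \<Longrightarrow> cartan n i j = -1 \<Longrightarrow> qserre q (k i) (b i) (b j)"
    using R assms by auto
qed

text \<open>
  The values that \<open>T\<^sub>i\<close> (and below its inverse) prescribes on generators, written for an arbitrary
  family, so that the composite of a homomorphism with \<open>T\<^sub>i\<close> is described by the transformed family.
\<close>

definition braidB ::
    "nat \<Rightarrow> complex \<Rightarrow> nat \<Rightarrow> (nat \<Rightarrow> 'a :: complex_algebra) \<Rightarrow> (nat \<Rightarrow> 'a) \<Rightarrow> nat \<Rightarrow> 'a" where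
  "braidB n q i b ki j =
     (if j = i then ki i * b i else if cartan n i j = 0 then b j else qbr q (b j) (b i))"

definition braidB_inv ::
    "nat \<Rightarrow> complex \<Rightarrow> nat \<Rightarrow> (nat \<Rightarrow> 'a :: complex_algebra) \<Rightarrow> (nat \<Rightarrow> 'a) \<Rightarrow> nat \<Rightarrow> 'a" where
  "braidB_inv n q i b ki j =
     (if j = i then ki i * b i else if cartan n i j = 0 then b j else qbr q (b i) (b j))"

text \<open>
  On the central elements \<open>T\<^sub>i\<close> is an involution, so this is also the formula for its inverse; with the
  arguments \<open>k\<close> and \<open>ki\<close> exchanged it gives the images of the \<open>K\<^sub>j\<^sup>-\<^sup>1\<close>.
\<close>

definition braidK ::
    "nat \<Rightarrow> nat \<Rightarrow> (nat \<Rightarrow> 'a :: complex_algebra) \<Rightarrow> (nat \<Rightarrow> 'a) \<Rightarrow> nat \<Rightarrow> 'a" where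
  "braidK n i k ki j =
     (if j = i then ki i else if cartan n i j = 0 then k j else k j * k i)"

text \<open>
  Every term of the Serre expression is quadratic in \<open>x\<close> and linear in \<open>y\<close>.
\<close>

lemma qserre_scaled:
  fixes x y k u v :: "'a :: complex_algebra"
  assumes S: "qserre q k x y"
    and u: "x * u = u * x" "y * u = u * y"
    and v: "x * v = v * x" "k * v = v * k" and uv: "v * u = u * v" "k * u = u * k"
  shows "qserre q (u * u * k) (u * x) (v * y)"
proof -
  have vu: "u * (v * z) = v * (u * z)" for z
    by (metis mult.assoc uv(1))
  note rules = u v uv(2) u[THEN comm_rewrite] v[THEN comm_rewrite] uv(2)[THEN comm_rewrite] vu
  have "u * x * (u * x) * (v * y) - qnum q 2 *\<^sub>C (u * x * (v * y) * (u * x)) + v * y * (u * x) * (u * x)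
      = v * (u * (u * (x * x * y - qnum q 2 *\<^sub>C (x * y * x) + y * x * x)))"
    by (simp add: algebra_simps scaleC_distribs rules)
  also have "\<dots> = v * (u * (u * ((- inverse q) *\<^sub>C (k * y))))"
    using S unfolding qserre_def by simp
  also have "\<dots> = (- inverse q) *\<^sub>C (u * u * k * (v * y))"
    by (simp add: algebra_simps rules)
  finally show ?thesis
    by (simp add: qserre_def)
qed

lemma iquantum_rels_cong:
  assumes "iquantum_rels n q b k ki"
    and "\<And>j. j \<le> n \<Longrightarrow> b j = b' j" "\<And>j. j \<le> n \<Longrightarrow> k j = k' j" "\<And>j. j \<le> n \<Longrightarrow> ki j = ki' j"
  shows "iquantum_rels n q b' k' ki'"
  using assms(1) unfolding iquantum_rels_def by (simp add: assms(2-4)[symmetric]) blast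

context qparam
begin

text \<open>
  The operator \<open>T\<^sub>i\<close> is well defined. The relation for a pair \<open>(j, l)\<close> is treated according to whether
  \<open>i\<close> is one of \<open>j, l\<close> and otherwise according to which of \<open>j, l\<close> are adjacent to \<open>i\<close>; each case is one
  of the identities between brackets.
\<close>

lemma iquantum_rels_braid:
  fixes b k ki :: "nat \<Rightarrow> 'a :: complex_algebra"
  assumes R: "iquantum_rels n q b k ki" and i: "i \<le> n"
  shows "iquantum_rels n q (braidB n q i b ki) (braidK n i k ki) (braidK n i ki k)"
proof -
  note D = iquantum_relsD[OF R]
  define B K KI where "B = braidB n q i b ki" and "K = braidK n i k ki" and "KI = braidK n i ki k"
  note defs = B_def K_def KI_def braidB_def braidK_def
  have centr: "b j * k l = k l * b j" "k j * k l = k l * k j" "b j * ki l = ki l * b j"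
      "k j * ki l = ki l * k j" "ki j * ki l = ki l * ki j"
    if "j \<le> n" "l \<le> n" for j l
    by (rule D(3) D(4) D(5) D(6) D(8); fact)+
  note cr = centr centr[THEN comm_rewrite]
  have inv1: "k l * ki l = 1" "ki l * k l = 1" if "l \<le> n" for l using D(1,2) that by auto
  note inv = inv1 inv1[THEN assoc_rewrite]
  have com: "b j * b l = b l * b j" if "cartan n j l = 0" "j \<le> n" "l \<le> n" for j l
    using D(9) that by blast
  have ser: "qserre q (k j) (b j) (b l)" if "cartan n j l = -1" "j \<le> n" "l \<le> n" for j l
    using D(10) that by blast
  have units: "K j * KI j = 1" "KI j * K j = 1" if j: "j \<le> n" for j
  proof -
    have e: "k i * (ki j * w) = ki j * (k i * w)" "ki i * (k j * w) = k j * (ki i * w)" for w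
      using cr(9) cr(9)[symmetric] i j by auto
    show "K j * KI j = 1" "KI j * K j = 1"
      using i j by (auto simp: defs mult.assoc inv e)
  qed
  have KK: "K j * K l = K l * K j" if "j \<le> n" "l \<le> n" for j l
    using that i by (auto simp: defs mult.assoc cr)
  have bK: "b j * K l = K l * b j" "ki j * K l = K l * ki j" if "j \<le> n" "l \<le> n" for j l
    using that i by (auto simp: defs mult.assoc cr)
  have BK: "B j * K l = K l * B j" if "j \<le> n" "l \<le> n" for j l
    using that i by (auto simp: B_def braidB_def qbr_def algebra_simps bK bK[THEN comm_rewrite])
  have BB: "B j * B l = B l * B j" if c: "cartan n j l = 0" and jl: "j \<le> n" "l \<le> n" for j l
  proof -
    consider "j = i" | "l = i" | "j \<noteq> i" "l \<noteq> i" by blast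
    then show ?thesis
    proof cases
      case 1
      with c com[OF c jl] show ?thesis
        using jl i by (auto simp: defs algebra_simps cr)
    next
      case 2
      with c com[OF c jl] show ?thesis
        using jl i by (auto simp: defs algebra_simps cr cartan_sym[of n i j])
    next
      case 3
      consider "cartan n i j = 0" "cartan n i l = 0" | "cartan n i j = 0" "cartan n i l = -1"
        | "cartan n i j = -1" "cartan n i l = 0" | "cartan n i j = -1" "cartan n i l = -1"
        using cartan_cases[of i j n] cartan_cases[of i l n] 3 by auto
      then show ?thesis
      proof cases
        case 1
        then show ?thesis using 3 com[OF c jl] by (simp add: defs)
      next
        case 2
        note e = com[OF 2(1) i jl(1)] com[OF c jl, symmetric]
        show ?thesis using 3 2 by (simp add: defs qbr_def algebra_simps e e[THEN assoc_rewrite])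
      next
        case c3: 3
        have "cartan n l i = 0" using c3 by (simp add: cartan_sym)
        note e = com[OF this jl(2) i] com[OF c[unfolded cartan_sym[of n j]] jl(2) jl(1)]
        show ?thesis using 3 c3 by (simp add: defs qbr_def algebra_simps e e[THEN assoc_rewrite])
      next
        case 4
        then have "qserre q (k i) (b i) (b j)" "qserre q (k i) (b i) (b l)"
          using ser i jl by auto
        then have "qbr q (b j) (b i) * qbr q (b l) (b i) = qbr q (b l) (b i) * qbr q (b j) (b i)"
          using centr(1) i jl by (intro qbr_commute_right[where k = "k i"] com[OF c]) auto
        then show ?thesis using 3 4 by (simp add: defs)
      qed
    qed
  qed
  have SS: "qserre q (K j) (B j) (B l)" if c: "cartan n j l = -1" and jl: "j \<le> n" "l \<le> n" for j l
  proof -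
    note S = ser[OF c jl] ser[OF c[unfolded cartan_sym[of n j]] jl(2,1)]
    consider "j = i" | "l = i" | "j \<noteq> i" "l \<noteq> i" by blast
    then show ?thesis
    proof cases
      case 1
      then have S': "qserre q (k i) (b i) (qbr q (b l) (b i))"
        using qserre_bracket(3)[OF S] centr jl by simp
      \<comment> \<open>The factors \<open>1\<close> here and below match the two scaling factors of \<open>qserre_scaled\<close>.\<close>
      have "qserre q (ki i * ki i * k i) (ki i * b i) (1 * qbr q (b l) (b i))"
        using i jl cr by (intro qserre_scaled[OF S']) (auto simp: qbr_def algebra_simps)
      then show ?thesis using 1 c i by (auto simp: defs mult.assoc inv)
    next
      case 2
      then have S': "qserre q (k j * k i) (qbr q (b j) (b i)) (b i)"
        using qserre_bracket(1)[OF S(2) S(1)] centr jl by simp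
      have "qserre q (1 * 1 * (k j * k i)) (1 * qbr q (b j) (b i)) (ki i * b i)"
        using i jl by (intro qserre_scaled[OF S']) (auto simp: qbr_def algebra_simps cr)
      then show ?thesis using 2 c i by (auto simp: defs cartan_sym[of n j])
    next
      case 3
      consider "cartan n i j = 0" "cartan n i l = 0" | "cartan n i j = 0" "cartan n i l = -1"
        | "cartan n i j = -1" "cartan n i l = 0" | "cartan n i j = -1" "cartan n i l = -1"
        using cartan_cases[of i j n] cartan_cases[of i l n] 3 by auto
      then show ?thesis
      proof cases
        case 1
        then show ?thesis using 3 S by (simp add: defs)
      next
        case 2
        have "qserre q (k j) (b j) (qbr q (b l) (b i))"
          using com[OF 2(1) i jl(1)] centr(1) i jl by (intro qserre_right_bracket S) auto
        then show ?thesis using 3 2 by (simp add: defs)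
      next
        case c3: 3
        have ij: "cartan n j i = -1" using c3 by (simp add: cartan_sym)
        have "qserre q (k i * k j) (qbr q (b j) (b i)) (b l)"
          using centr(1) i jl
          by (intro qserre_bracket_left ser[OF c3(1) i jl(1)] ser[OF ij jl(1) i] S com[OF c3(2)]) auto
        then show ?thesis using 3 c3 centr(2) i jl by (simp add: defs)
      next
        case 4
        have "qserre q (k i * k j) (qbr q (b j) (b i)) (qbr q (b l) (b i))"
          using centr(1,2) i jl
          by (intro qserre_bracket_both ser[OF 4(1) i jl(1)] ser[OF 4(2) i jl(2)] S) auto
        then show ?thesis using 3 4 centr(2) i jl by (simp add: defs)
      qed
    qed
  qed
  show ?thesis
    unfolding iquantum_rels_def B_def[symmetric] K_def[symmetric] KI_def[symmetric]
    using units KK BK BB SS by auto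
qed

lemma iquantum_rels_Op:
  assumes "iquantum_rels n q b k ki"
  shows "iquantum_rels n q (\<lambda>j. Op (b j)) (\<lambda>j. Op (k j)) (\<lambda>j. Op (ki j))"
proof -
  have "qserre q (Op (k i)) (Op (b i)) (Op (b j))" if "cartan n i j = -1" "i \<le> n" "j \<le> n" for i j
    using iquantum_relsD(3,10)[OF assms that(2)] that by (simp add: qserre_Op)
  then show ?thesis
    using assms unfolding iquantum_rels_def by (simp add: Op_simps one_op_def) metis
qed

lemma iquantum_rels_unOp:
  assumes "iquantum_rels n q (\<lambda>j. Op (b j)) (\<lambda>j. Op (k j)) (\<lambda>j. Op (ki j))"
  shows "iquantum_rels n q b k ki"
proof -
  have e: "unop (Op x * Op y) = y * x" "unop 1 = 1" for x y :: 'a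
    by (simp_all add: op_defs)
  note D = iquantum_relsD[OF assms]
  have c: "b j * k i = k i * b j" "k j * k i = k i * k j" if "i \<le> n" "j \<le> n" for i j
    using D(3,4)[OF that] by (metis e(1))+
  have u: "k i * ki i = 1" "ki i * k i = 1" if "i \<le> n" for i
    using D(1,2)[OF that] by (metis e)+
  have "b i * b j = b j * b i" if "cartan n i j = 0" "i \<le> n" "j \<le> n" for i j
    using D(9)[OF that(2,3,1)] by (metis e(1))
  moreover have "qserre q (k i) (b i) (b j)" if "cartan n i j = -1" "i \<le> n" "j \<le> n" for i j
    using D(10)[OF that(2,3,1)] c that by (simp add: qserre_Op)
  ultimately show ?thesis
    using c u unfolding iquantum_rels_def by blast
qed

text \<open>
  In the opposite algebra \<open>braidB_inv\<close> turns into \<open>braidB\<close>.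
\<close>

lemma iquantum_rels_braid_inv:
  assumes R: "iquantum_rels n q b k ki" and i: "i \<le> n"
  shows "iquantum_rels n q (braidB_inv n q i b ki) (braidK n i k ki) (braidK n i ki k)"
proof (rule iquantum_rels_unOp)
  note D = iquantum_relsD[OF R i]
  have "iquantum_rels n q (braidB n q i (\<lambda>j. Op (b j)) (\<lambda>j. Op (ki j)))
     (braidK n i (\<lambda>j. Op (k j)) (\<lambda>j. Op (ki j))) (braidK n i (\<lambda>j. Op (ki j)) (\<lambda>j. Op (k j)))"
    by (intro iquantum_rels_braid iquantum_rels_Op R i)
  then show "iquantum_rels n q (\<lambda>j. Op (braidB_inv n q i b ki j))
     (\<lambda>j. Op (braidK n i k ki j)) (\<lambda>j. Op (braidK n i ki k j))"
  proof (rule iquantum_rels_cong)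
    fix j assume j: "j \<le> n"
    show "braidB n q i (\<lambda>j. Op (b j)) (\<lambda>j. Op (ki j)) j = Op (braidB_inv n q i b ki j)"
      using D(5)[OF i] by (simp add: braidB_def braidB_inv_def Op_simps qbr_Op)
    show "braidK n i (\<lambda>j. Op (k j)) (\<lambda>j. Op (ki j)) j = Op (braidK n i k ki j)"
      "braidK n i (\<lambda>j. Op (ki j)) (\<lambda>j. Op (k j)) j = Op (braidK n i ki k j)"
      using D(4)[OF j] D(8)[OF j] by (simp_all add: braidK_def Op_simps)
  qed
qed

end

section \<open>Nested brackets along the finite diagram\<close>

text \<open>
  The nested bracket \<open>[b\<^sub>l, [b\<^bsub>l+1\<^esub>, \<dots> b\<^bsub>l+m\<^esub>]\<^sub>q \<dots>]\<^sub>q\<close> of \<open>m + 1\<close> elements, and the matching product of central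
  elements. The argument \<open>m\<close> counts the bonds of the segment, so that no value for an empty segment is
  involved.
\<close>

fun chain :: "complex \<Rightarrow> (nat \<Rightarrow> 'a :: complex_algebra) \<Rightarrow> nat \<Rightarrow> nat \<Rightarrow> 'a" where
  "chain q b l 0 = b l"
| "chain q b l (Suc m) = qbr q (b l) (chain q b (Suc l) m)"

fun kchain :: "(nat \<Rightarrow> 'a :: complex_algebra) \<Rightarrow> nat \<Rightarrow> nat \<Rightarrow> 'a" where
  "kchain k l 0 = k l"
| "kchain k l (Suc m) = k l * kchain k (Suc l) m"

lemma chain_cong:
  "(\<And>j. l \<le> j \<Longrightarrow> j \<le> l + m \<Longrightarrow> b j = b' j) \<Longrightarrow> chain q b l m = chain q b' l m"
  by (induction m arbitrary: l) simp_all

lemma kchain_cong: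
  "(\<And>j. l \<le> j \<Longrightarrow> j \<le> l + m \<Longrightarrow> k j = k' j) \<Longrightarrow> kchain k l m = kchain k' l m"
  by (induction m arbitrary: l) simp_all

lemma kchain_commute:
  "(\<And>j. l \<le> j \<Longrightarrow> j \<le> l + m \<Longrightarrow> x * k j = k j * x) \<Longrightarrow> x * kchain k l m = kchain k l m * x"
proof (induction m arbitrary: l)
  case (Suc m)
  have "x * kchain k (Suc l) m = kchain k (Suc l) m * x"
    using Suc.prems by (intro Suc.IH) auto
  then show ?case
    using Suc.prems[of l] by (simp add: mult.assoc) (metis mult.assoc)
qed simp

lemma kchain_split: "kchain k l (m + Suc r) = kchain k l m * kchain k (Suc (l + m)) r"
  by (induction m arbitrary: l) (simp_all add: mult.assoc)

lemma kchain_snoc: "kchain k l (Suc m) = kchain k l m * k (Suc (l + m))"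
  using kchain_split[of k l m 0] by simp

lemma kchain_inverse:
  assumes "\<And>i. l \<le> i \<Longrightarrow> i \<le> l + m \<Longrightarrow> k i * ki i = 1"
    and "\<And>i j. l \<le> i \<Longrightarrow> i \<le> l + m \<Longrightarrow> l \<le> j \<Longrightarrow> j \<le> l + m \<Longrightarrow> k i * ki j = ki j * k i"
  shows "kchain k l m * kchain ki l m = 1"
  using assms
proof (induction m arbitrary: l)
  case (Suc m)
  have "ki l * kchain k (Suc l) m = kchain k (Suc l) m * ki l"
    using Suc.prems(2) by (intro kchain_commute) auto
  moreover have "kchain k (Suc l) m * kchain ki (Suc l) m = 1"
    using Suc.prems by (intro Suc.IH) auto
  moreover have "k l * ki l = 1" using Suc.prems(1) by auto
  ultimately show ?case
    by (simp add: mult.assoc) (metis mult.assoc mult_1_left)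
qed simp

lemma qbr_commute:
  assumes "x * y = y * x" "x * z = z * (x :: 'a :: complex_algebra)"
  shows "x * qbr q y z = qbr q y z * x"
  by (simp add: qbr_def algebra_simps assms assms[THEN comm_rewrite])

text \<open>
  Brackets are associative when the outer arguments commute. This makes the nested bracket over a
  segment of the diagram independent of the bracketing.
\<close>

lemma qbr_assoc:
  assumes "x * y = y * (x :: 'a :: complex_algebra)"
  shows "qbr q x (qbr q z y) = qbr q (qbr q x z) y"
  by (simp add: qbr_def algebra_simps scaleC_distribs assms assms[THEN comm_rewrite])

lemma qbr_swap:
  assumes "x * y = y * (x :: 'a :: complex_algebra)"
  shows "qbr q (qbr q z x) y = qbr q (qbr q z y) x"
  by (simp add: qbr_def algebra_simps scaleC_distribs assms assms[THEN comm_rewrite])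

lemma cartan_finite:
  assumes "i \<in> {1..n}" "j \<in> {1..n}"
  shows "cartan n i j = (if i = j then 2 else if i = Suc j \<or> j = Suc i then -1 else 0)"
proof -
  have "(i + 1) mod (n + 1) = (if i = n then 0 else i + 1)" "(j + 1) mod (n + 1) = (if j = n then 0 else j + 1)"
    using assms by auto
  then show ?thesis using assms by (auto simp: cartan_def)
qed

lemma cartan_zero:
  assumes "j \<in> {1..n}" "n \<ge> 2"
  shows "cartan n 0 j = (if j = 1 \<or> j = n then -1 else 0)"
proof -
  have "(j + 1) mod (n + 1) = (if j = n then 0 else j + 1)"
    using assms by auto
  then show ?thesis using assms by (auto simp: cartan_def)
qed

text \<open>
  The images of the generators under the evaluation map. The inverse of \<open>evalK n a k ki\<close> is
  \<open>evalK n (inverse a) ki k\<close>.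
\<close>

definition evalB ::
    "nat \<Rightarrow> complex \<Rightarrow> complex \<Rightarrow> (nat \<Rightarrow> 'a :: complex_algebra) \<Rightarrow> (nat \<Rightarrow> 'a) \<Rightarrow> nat \<Rightarrow> 'a" where
  "evalB n q a b ki j = (if j = 0 then a *\<^sub>C (kchain ki 1 (n - 1) * chain q b 1 (n - 1)) else b j)"

definition evalK ::
    "nat \<Rightarrow> complex \<Rightarrow> (nat \<Rightarrow> 'a :: complex_algebra) \<Rightarrow> (nat \<Rightarrow> 'a) \<Rightarrow> nat \<Rightarrow> 'a" where
  "evalK n a k ki j = (if j = 0 then a\<^sup>2 *\<^sub>C kchain ki 1 (n - 1) else k j)"

locale iquantum_family = qparam +
  fixes n :: nat and b k ki :: "nat \<Rightarrow> 'a :: complex_algebra"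
  assumes n: "n \<ge> 2" and rels: "iquantum_rels n q b k ki"
begin

lemma units: "i \<le> n \<Longrightarrow> k i * ki i = 1" "i \<le> n \<Longrightarrow> ki i * k i = 1"
  using iquantum_relsD(1,2)[OF rels] by auto

lemma central:
  assumes "i \<le> n" "j \<le> n"
  shows "b i * k j = k j * b i" "k i * k j = k j * k i" "b i * ki j = ki j * b i"
    "k i * ki j = ki j * k i" "ki i * k j = k j * ki i" "ki i * ki j = ki j * ki i"
  using iquantum_relsD(3-8)[OF rels assms(2) assms(1)] by auto

lemma b_commute: "i \<in> {1..n} \<Longrightarrow> j \<in> {1..n} \<Longrightarrow> Suc i < j \<or> Suc j < i \<Longrightarrow> b i * b j = b j * b i"
  using iquantum_relsD(9)[OF rels, of i j] by (auto simp: cartan_finite)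

lemma b_serre: "i \<in> {1..n} \<Longrightarrow> j \<in> {1..n} \<Longrightarrow> i = Suc j \<or> j = Suc i \<Longrightarrow> qserre q (k i) (b i) (b j)"
  using iquantum_relsD(10)[OF rels, of i j] by (auto simp add: cartan_finite)

lemma chain_commute:
  assumes "\<And>j. l \<le> j \<Longrightarrow> j \<le> l + m \<Longrightarrow> x * b j = b j * x"
  shows "x * chain q b l m = chain q b l m * x"
  using assms by (induction m arbitrary: l) (auto intro!: qbr_commute)

lemma b_chain_commute:
  "i \<in> {1..n} \<Longrightarrow> 1 \<le> l \<Longrightarrow> l + m \<le> n \<Longrightarrow> Suc i < l \<or> Suc (l + m) < i
    \<Longrightarrow> b i * chain q b l m = chain q b l m * b i"
  by (intro chain_commute b_commute) auto

lemma chain_chain_commute: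
  assumes "1 \<le> l" "Suc (l + m) < l'" "l' + m' \<le> n"
  shows "chain q b l m * chain q b l' m' = chain q b l' m' * chain q b l m"
  using assms by (intro chain_commute sym[OF b_chain_commute]) auto

lemma chain_k_commute:
  assumes "l + m \<le> n" "j \<le> n"
  shows "chain q b l m * k j = k j * chain q b l m" "chain q b l m * ki j = ki j * chain q b l m"
  using assms central by (auto intro!: chain_commute sym[OF chain_commute])

text \<open>
  The left end of a chain commutes with all of its right part, so \<open>qbr_assoc\<close> applies at each step.
\<close>

lemma chain_split:
  "1 \<le> l \<Longrightarrow> Suc (l + m + r) \<le> n \<Longrightarrow>
     chain q b l (m + Suc r) = qbr q (chain q b l m) (chain q b (Suc (l + m)) r)"
proof (induction m arbitrary: l)
  case (Suc m)
  have "b l * chain q b (Suc (Suc (l + m))) r = chain q b (Suc (Suc (l + m))) r * b l"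
    using Suc.prems by (intro b_chain_commute) auto
  then show ?case using Suc by (simp add: qbr_assoc)
qed simp

lemma chain_snoc:
  "1 \<le> l \<Longrightarrow> Suc (l + m) \<le> n \<Longrightarrow> chain q b l (Suc m) = qbr q (chain q b l m) (b (Suc (l + m)))"
  using chain_split[of l m 0] by simp

lemma kchain_central:
  assumes "l + m \<le> n" "j \<le> n"
  shows "b j * kchain k l m = kchain k l m * b j" "b j * kchain ki l m = kchain ki l m * b j"
    "k j * kchain k l m = kchain k l m * k j" "ki j * kchain k l m = kchain k l m * ki j"
    "k j * kchain ki l m = kchain ki l m * k j" "ki j * kchain ki l m = kchain ki l m * ki j"
  using assms central by (auto intro!: kchain_commute)

lemma chain_kchain_commute:
  assumes "l + m \<le> n" "l' + m' \<le> n"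
  shows "chain q b l m * kchain k l' m' = kchain k l' m' * chain q b l m"
    "chain q b l m * kchain ki l' m' = kchain ki l' m' * chain q b l m"
  using assms by (auto intro!: kchain_commute chain_k_commute)

lemma kchain_units:
  assumes "l + m \<le> n"
  shows "kchain k l m * kchain ki l m = 1" "kchain ki l m * kchain k l m = 1"
  using assms by (auto intro!: kchain_inverse units central)

text \<open>
  A chain can be extended at its left end by a Serre bond: the bracket \<open>[b\<^bsub>l+1\<^esub>, c]\<^sub>q\<close> with the remaining
  chain \<open>c\<close> is adjacent to \<open>b\<^sub>l\<close> only through \<open>b\<^bsub>l+1\<^esub>\<close>.
\<close>

lemma serre_b_chain:
  "1 \<le> l \<Longrightarrow> Suc (l + m) \<le> n \<Longrightarrow> qserre q (k l) (b l) (chain q b (Suc l) m)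
     \<and> qserre q (kchain k (Suc l) m) (chain q b (Suc l) m) (b l)"
proof (induction m arbitrary: l)
  case 0
  then show ?case by (auto intro!: b_serre)
next
  case (Suc m)
  let ?c = "chain q b (Suc (Suc l)) m"
  have IH: "qserre q (k (Suc l)) (b (Suc l)) ?c"
    "qserre q (kchain k (Suc (Suc l)) m) ?c (b (Suc l))"
    using Suc.IH[of "Suc l"] Suc.prems by auto
  have c: "b l * ?c = ?c * b l"
    using Suc.prems by (intro b_chain_commute) auto
  have "qserre q (k l) (b l) (qbr q (b (Suc l)) ?c)"
    using Suc.prems c by (intro qserre_right_bracket b_serre) (auto intro!: central chain_k_commute)
  moreover have "qserre q (kchain k (Suc (Suc l)) m * k (Suc l)) (qbr q (b (Suc l)) ?c) (b l)"
    using Suc.prems c[symmetric]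
    by (intro qserre_bracket_left IH b_serre)
      (auto intro!: central chain_k_commute kchain_central chain_kchain_commute)
  moreover have "kchain k (Suc (Suc l)) m * k (Suc l) = k (Suc l) * kchain k (Suc (Suc l)) m"
    using Suc.prems by (intro kchain_central(3)[symmetric]) auto
  ultimately show ?case by simp
qed

text \<open>
  The mirror image at the right end, where the chain is bracketed from the left.
\<close>

lemma serre_chain_b:
  "1 \<le> l \<Longrightarrow> Suc (l + m) \<le> n \<Longrightarrow> qserre q (k (Suc (l + m))) (b (Suc (l + m))) (chain q b l m)
     \<and> qserre q (kchain k l m) (chain q b l m) (b (Suc (l + m)))"
proof (induction m)
  case 0
  then show ?case by (auto intro!: b_serre)
next
  case (Suc m)
  let ?c = "chain q b l m" and ?i = "Suc (l + m)"
  have IH: "qserre q (k ?i) (b ?i) ?c" "qserre q (kchain k l m) ?c (b ?i)"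
    using Suc by auto
  have c: "b (Suc ?i) * ?c = ?c * b (Suc ?i)"
    using Suc.prems by (intro b_chain_commute) auto
  have "qserre q (k (Suc ?i)) (b (Suc ?i)) (qbr q ?c (b ?i))"
    using Suc.prems c by (intro qserre_right_bracket b_serre) (auto intro!: central chain_k_commute)
  moreover have "qserre q (kchain k l m * k ?i) (qbr q ?c (b ?i)) (b (Suc ?i))"
    using Suc.prems c[symmetric]
    by (intro qserre_bracket_right IH b_serre)
      (auto intro!: central chain_k_commute kchain_central chain_kchain_commute
        kchain_central(3)[symmetric])
  ultimately show ?case
    using Suc.prems by (simp add: chain_snoc kchain_snoc del: chain.simps kchain.simps)
qed

section \<open>The root vector of the highest root\<close>

text \<open>
  The bracket over the whole diagram is taken apart at the left end, at the right end and around an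
  inner node. It has \<open>n - 1\<close> bonds.
\<close>

lemma top_chain_left:
  "chain q b 1 (n - 1) = qbr q (b 1) (chain q b 2 (n - 2))"
  "kchain f 1 (n - 1) = f 1 * kchain f 2 (n - 2)"
  using n by (auto simp: numeral_2_eq_2 Suc_diff_Suc simp flip: chain.simps(2) kchain.simps(2))

lemma top_chain_right:
  "chain q b 1 (n - 1) = qbr q (chain q b 1 (n - 2)) (b n)"
  "kchain f 1 (n - 1) = kchain f 1 (n - 2) * f n"
proof -
  have e: "n - 1 = Suc (n - 2)" "Suc (1 + (n - 2)) = n" using n by auto
  show "chain q b 1 (n - 1) = qbr q (chain q b 1 (n - 2)) (b n)"
    "kchain f 1 (n - 1) = kchain f 1 (n - 2) * f n"
    unfolding e(1) using chain_snoc[of 1 "n - 2"] kchain_snoc[of f 1 "n - 2"] unfolding e(2) by simp_all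
qed

lemma top_chain_middle:
  assumes "1 < i" "i < n"
  shows "chain q b 1 (n - 1)
      = qbr q (chain q b 1 (i - 2)) (qbr q (b i) (chain q b (Suc i) (n - Suc i)))"
    "kchain f 1 (n - 1) = kchain f 1 (i - 2) * (f i * kchain f (Suc i) (n - Suc i))"
proof -
  have e: "n - 1 = (i - 2) + Suc (n - i)" "Suc (1 + (i - 2)) = i" "n - i = Suc (n - Suc i)"
    using assms by auto
  have "chain q b 1 (n - 1) = qbr q (chain q b 1 (i - 2)) (chain q b i (n - i))"
    unfolding e(1) using chain_split[of 1 "i - 2" "n - i"] assms unfolding e(2) by simp
  then show "chain q b 1 (n - 1)
      = qbr q (chain q b 1 (i - 2)) (qbr q (b i) (chain q b (Suc i) (n - Suc i)))"
    using e(3) by (metis chain.simps(2))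
  have "kchain f 1 (n - 1) = kchain f 1 (i - 2) * kchain f i (n - i)"
    unfolding e(1) using kchain_split[of f 1 "i - 2" "n - i"] unfolding e(2) by simp
  then show "kchain f 1 (n - 1) = kchain f 1 (i - 2) * (f i * kchain f (Suc i) (n - Suc i))"
    using e(3) by (metis kchain.simps(2))
qed

text \<open>
  The bracket over the whole diagram is \<open>[y, x]\<^sub>q\<close> for a Serre pair consisting of the end generator and
  the rest of the chain, and \<open>qserre_bracket\<close> gives the relations of such a bracket with its two
  entries.
\<close>

lemma top_chain_serre:
  assumes i: "i = 1 \<or> i = n"
  shows "qserre q (k i) (b i) (chain q b 1 (n - 1))"
    "qserre q (kchain k 1 (n - 1)) (chain q b 1 (n - 1)) (b i)"
proof -
  let ?c = "chain q b 2 (n - 2)" and ?d = "chain q b 1 (n - 2)"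
  have c: "qserre q (k 1) (b 1) ?c" "qserre q (kchain k 2 (n - 2)) ?c (b 1)"
    using serre_b_chain[of 1 "n - 2"] n by (auto simp: numeral_2_eq_2)
  have d: "qserre q (k n) (b n) ?d" "qserre q (kchain k 1 (n - 2)) ?d (b n)"
    using serre_chain_b[of 1 "n - 2"] n by (auto simp: Suc_diff_Suc numeral_2_eq_2)
  have comm: "?c * k 1 = k 1 * ?c" "?c * kchain k 2 (n - 2) = kchain k 2 (n - 2) * ?c"
    "?d * k n = k n * ?d" "?d * kchain k 1 (n - 2) = kchain k 1 (n - 2) * ?d"
    using n by (auto intro!: chain_k_commute chain_kchain_commute)
  have comm': "b 1 * kchain k 2 (n - 2) = kchain k 2 (n - 2) * b 1"
    "k 1 * kchain k 2 (n - 2) = kchain k 2 (n - 2) * k 1"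
    "b n * kchain k 1 (n - 2) = kchain k 1 (n - 2) * b n"
    "k n * kchain k 1 (n - 2) = kchain k 1 (n - 2) * k n"
    using n by (auto intro!: kchain_central)
  have "qserre q (k 1) (b 1) (qbr q (b 1) ?c)"
    "qserre q (kchain k 2 (n - 2) * k 1) (qbr q (b 1) ?c) (b 1)"
    by (rule qserre_bracket(2,4)[OF c(2,1)]; rule comm comm' central; use n in simp)+
  moreover have "qserre q (k n) (b n) (qbr q ?d (b n))"
    "qserre q (k n * kchain k 1 (n - 2)) (qbr q ?d (b n)) (b n)"
    by (rule qserre_bracket(1,3)[OF d(1,2)]; rule comm comm' comm'(4)[symmetric] central; use n in simp)+
  moreover have kk: "kchain k 1 (n - 1) = kchain k 2 (n - 2) * k 1"
    "kchain k 1 (n - 1) = k n * kchain k 1 (n - 2)"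
    by (simp only: top_chain_left(2) comm'(2)) (simp only: top_chain_right(2) comm'(4))
  ultimately show "qserre q (k i) (b i) (chain q b 1 (n - 1))"
    "qserre q (kchain k 1 (n - 1)) (chain q b 1 (n - 1)) (b i)"
    using i by (metis top_chain_left(1) top_chain_right(1) kk)+
qed

lemma top_chain_commute:
  assumes i: "1 < i" "i < n"
  shows "b i * chain q b 1 (n - 1) = chain q b 1 (n - 1) * b i"
proof -
  let ?x = "chain q b 1 (i - 2)" and ?z = "chain q b (Suc i) (n - Suc i)"
  have x: "qserre q (k i) (b i) ?x"
    using serre_chain_b[of 1 "i - 2"] i by (auto simp: Suc_diff_Suc numeral_2_eq_2)
  have z: "qserre q (k i) (b i) ?z"
    using serre_b_chain[of i "n - Suc i"] i by auto
  have "qbr q ?x (qbr q (b i) ?z) * b i = b i * qbr q ?x (qbr q (b i) ?z)"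
    using i by (intro qbr_middle_commute[OF x z])
      (auto intro!: chain_chain_commute chain_k_commute central)
  then show ?thesis
    by (simp only: top_chain_middle[OF i])
qed

text \<open>
  In the cyclic diagram the node \<open>0\<close> is adjacent to \<open>1\<close> and \<open>n\<close> only. The factor \<open>a M\<^sup>-\<^sup>1\<close> in front of the
  root vector is what changes its central element \<open>M\<close> into \<open>a\<^sup>2 M\<^sup>-\<^sup>1\<close>.
\<close>

lemma iquantum_rels_ev:
  assumes a: "a \<noteq> 0"
  shows "iquantum_rels n q (evalB n q a b ki) (evalK n a k ki) (evalK n (inverse a) ki k)"
proof -
  define C M MI where "C = chain q b 1 (n - 1)" and "M = kchain k 1 (n - 1)" and "MI = kchain ki 1 (n - 1)"
  have le: "1 + (n - 1) \<le> n" "1 + (n - 2) \<le> n" using n by auto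
  have M: "M * MI = 1" "MI * M = 1" 
    unfolding M_def MI_def using kchain_units[OF le(1)] by auto
  have c: "b j * MI = MI * b j" "k j * MI = MI * k j" "ki j * MI = MI * ki j"
      "b j * M = M * b j" "k j * M = M * k j" "ki j * M = M * ki j"
      "C * k j = k j * C" "C * ki j = ki j * C" if "j \<le> n" for j
    unfolding M_def MI_def C_def using that le(1)
    by (auto intro!: kchain_central chain_k_commute)
  have CM: "C * M = M * C" "C * MI = MI * C"
    unfolding M_def MI_def C_def using le(1) by (auto intro!: chain_kchain_commute)
  note comm = c CM M c[THEN comm_rewrite] CM[THEN comm_rewrite] M[THEN assoc_rewrite]
  have ev: "evalB n q a b ki j = (if j = 0 then a *\<^sub>C (MI * C) else b j)"
    "evalK n a k ki j = (if j = 0 then a\<^sup>2 *\<^sub>C MI else k j)"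
    "evalK n (inverse a) ki k j = (if j = 0 then (inverse a)\<^sup>2 *\<^sub>C M else ki j)" for j
    by (simp_all add: evalB_def evalK_def  C_def M_def MI_def)
  have aa: "(inverse a)\<^sup>2 * a\<^sup>2 = 1" "a\<^sup>2 * (inverse a)\<^sup>2 = 1"
    using a by (simp_all add: power_mult_distrib[symmetric])
  have 1: "evalK n a k ki i * evalK n (inverse a) ki k i = 1" "evalK n (inverse a) ki k i * evalK n a k ki i = 1" if "i \<le> n" for i
    using a that by (auto simp: ev M units aa)
  have 2: "evalB n q a b ki j * evalK n a k ki i = evalK n a k ki i * evalB n q a b ki j" "evalK n a k ki j * evalK n a k ki i = evalK n a k ki i * evalK n a k ki j"
    if "i \<le> n" "j \<le> n" for i j
    using that central(1,2)[of j i] by (auto simp: ev comm mult.assoc)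
  have 3: "evalB n q a b ki 0 * b j = b j * evalB n q a b ki 0" if "cartan n 0 j = 0" "j \<le> n" for j
  proof -
    have j: "1 < j" "j < n" using that n by (cases "j = 0"; auto simp: cartan_zero split: if_splits)+
    have "b j * C = C * b j" using top_chain_commute[OF j] by (simp add: C_def)
    then show ?thesis using j by (simp add: ev comm mult.assoc)
  qed
  have 4: "qserre q (evalK n a k ki 0) (evalB n q a b ki 0) (b j)" "qserre q (k j) (b j) (evalB n q a b ki 0)"
    if "cartan n 0 j = -1" "j \<le> n" for j
  proof -
    have j: "j = 1 \<or> j = n" "j \<noteq> 0" using that n by (cases "j = 0"; auto simp: cartan_zero split: if_splits)+
    have S: "qserre q (k j) (b j) C" "qserre q M C (b j)"
      unfolding C_def M_def using top_chain_serre[OF j(1)] by auto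
    have "qserre q ((a *\<^sub>C MI) * (a *\<^sub>C MI) * M) ((a *\<^sub>C MI) * C) (1 * b j)"
      using that by (intro qserre_scaled[OF S(2)]) (auto simp: comm)
    then show "qserre q (evalK n a k ki 0) (evalB n q a b ki 0) (b j)"
      by (simp add: ev mult.assoc M power2_eq_square)
    have "qserre q (1 * 1 * k j) (1 * b j) ((a *\<^sub>C MI) * C)"
      using that by (intro qserre_scaled[OF S(1)]) (auto simp: comm)
    then show "qserre q (k j) (b j) (evalB n q a b ki 0)"
      by (simp add: ev mult.assoc M power2_eq_square)
  qed
  have 5: "evalB n q a b ki j = b j" "evalK n a k ki j = k j" if "j \<noteq> 0" for j using that by (simp_all add: ev)
  have "evalB n q a b ki i * evalB n q a b ki j = evalB n q a b ki j * evalB n q a b ki i" if "cartan n i j = 0" "i \<le> n" "j \<le> n" for i j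
    using that 3[of i] 3[of j] iquantum_relsD(9)[OF rels that(2,3,1)]
    by (cases "i = 0"; cases "j = 0") (auto simp: 5 cartan_sym[of n _ 0])
  moreover have "qserre q (evalK n a k ki i) (evalB n q a b ki i) (evalB n q a b ki j)" if "cartan n i j = -1" "i \<le> n" "j \<le> n" for i j
    using that 4[of i] 4[of j] iquantum_relsD(10)[OF rels that(2,3,1)]
    by (cases "i = 0"; cases "j = 0") (auto simp: 5 cartan_sym[of n _ 0])
  ultimately show ?thesis
    unfolding iquantum_rels_def using 1 2 by blast
qed

end

section \<open>The braid operators on nested brackets\<close>

lemma kchain_braid_right:
  "1 \<le> l \<Longrightarrow> Suc (l + m) \<le> n \<Longrightarrow>
     kchain (braidK n (Suc (l + m)) k ki) l m = kchain k l m * k (Suc (l + m))"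
proof (induction m arbitrary: l)
  case 0
  then show ?case by (simp add: braidK_def cartan_finite)
next
  case (Suc m)
  have "braidK n (Suc (l + Suc m)) k ki l = k l"
    using Suc.prems by (simp add: braidK_def cartan_finite)
  then show ?case using Suc.IH[of "Suc l"] Suc.prems by (simp add: mult.assoc)
qed

lemma kchain_braid_outside:
  assumes "1 \<le> i" "i \<le> n" "1 \<le> l" "l + m \<le> n" "Suc i < l \<or> Suc (l + m) < i"
  shows "kchain (braidK n i k ki) l m = kchain k l m"
  using assms by (intro kchain_cong) (auto simp: braidK_def cartan_finite)

lemma chain_braid_outside:
  assumes "1 \<le> i" "i \<le> n" "1 \<le> l" "l + m \<le> n" "Suc i < l \<or> Suc (l + m) < i"
  shows "chain q (braidB n q i b ki) l m = chain q b l m"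
  using assms by (intro chain_cong) (auto simp: braidB_def cartan_finite)

context iquantum_family
begin

text \<open>
  The operator at the node following a segment acts on the last factor, and by associativity on the
  whole bracket. In particular it extends the segment by one node, which is why \<open>T\<^sub>n \<cdots> T\<^sub>1\<close> produces the
  bracket over all of \<open>1, \<dots>, n\<close>.
\<close>

lemma chain_braid_right:
  "1 \<le> l \<Longrightarrow> Suc (l + m) \<le> n \<Longrightarrow>
     chain q (braidB n q (Suc (l + m)) b ki) l m = qbr q (chain q b l m) (b (Suc (l + m)))"
proof (induction m arbitrary: l)
  case 0
  then show ?case by (simp add: braidB_def cartan_finite)
next
  case (Suc m)
  have "braidB n q (Suc (l + Suc m)) b ki l = b l"
    using Suc.prems by (simp add: braidB_def cartan_finite)
  moreover have "b l * b (Suc (l + Suc m)) = b (Suc (l + Suc m)) * b l"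
    using Suc.prems by (intro b_commute) auto
  ultimately show ?case using Suc.IH[of "Suc l"] Suc.prems by (simp add: qbr_assoc)
qed

lemma chain_braid_left:
  assumes "1 \<le> i" "Suc (i + m) \<le> n"
  shows "chain q (braidB n q i b ki) (Suc i) m = qbr q (chain q b (Suc i) m) (b i)"
proof (cases m)
  case 0
  then show ?thesis using assms by (simp add: braidB_def cartan_finite)
next
  case (Suc r)
  have "braidB n q i b ki (Suc i) = qbr q (b (Suc i)) (b i)"
    using assms by (simp add: braidB_def cartan_finite)
  moreover have "chain q (braidB n q i b ki) (Suc (Suc i)) r = chain q b (Suc (Suc i)) r"
    using assms Suc by (intro chain_braid_outside) auto
  moreover have "b i * chain q b (Suc (Suc i)) r = chain q b (Suc (Suc i)) r * b i"
    using assms Suc by (intro b_chain_commute) auto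
  ultimately show ?thesis using Suc by (simp add: qbr_swap)
qed

lemma kchain_braid_left:
  assumes "1 \<le> i" "Suc (i + m) \<le> n"
  shows "kchain (braidK n i ki k) (Suc i) m = kchain ki (Suc i) m * ki i"
proof (cases m)
  case 0
  then show ?thesis using assms by (simp add: braidK_def cartan_finite)
next
  case (Suc r)
  have "braidK n i ki k (Suc i) = ki (Suc i) * ki i"
    using assms by (simp add: braidK_def cartan_finite)
  moreover have "kchain (braidK n i ki k) (Suc (Suc i)) r = kchain ki (Suc (Suc i)) r"
    using assms Suc by (intro kchain_braid_outside) auto
  moreover have "ki i * kchain ki (Suc (Suc i)) r = kchain ki (Suc (Suc i)) r * ki i"
    using assms Suc by (intro kchain_central) auto
  ultimately show ?thesis using Suc by (simp add: mult.assoc)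
qed

lemma braided_family:
  assumes "i \<le> n"
  shows "iquantum_family q p n (braidB n q i b ki) (braidK n i k ki) (braidK n i ki k)"
  using iquantum_rels_braid[OF rels assms] n by unfold_locales

lemma qbr_scaled:
  fixes x y u v :: 'a
  assumes "x * v = v * x" "y * u = u * y" "v * u = u * v"
  shows "qbr q (u * x) (v * y) = u * (v * qbr q x y)"
  by (simp add: qbr_def algebra_simps assms assms[THEN comm_rewrite])

text \<open>
  For an inner node \<open>i\<close> write the root vector as \<open>[[x, b\<^sub>i]\<^sub>q, z]\<^sub>q\<close>. The operator sends \<open>x\<close> to
  \<open>[x, b\<^sub>i]\<^sub>q\<close>, and \<open>[b\<^sub>i, z]\<^sub>q\<close> to \<open>k\<^sub>i\<^sup>-\<^sup>1 [b\<^sub>i, [z, b\<^sub>i]\<^sub>q]\<^sub>q = z\<close>, so the root vector is reproduced.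
\<close>

lemma top_chain_braid_middle:
  assumes i: "1 < i" "i < n"
  shows "chain q (braidB n q i b ki) 1 (n - 1) = chain q b 1 (n - 1)"
    "kchain (braidK n i ki k) 1 (n - 1) = kchain ki 1 (n - 1)"
proof -
  interpret T: iquantum_family q p n "braidB n q i b ki" "braidK n i k ki" "braidK n i ki k"
    using i by (intro braided_family) simp
  define x z where "x = chain q b 1 (i - 2)" and "z = chain q b (Suc i) (n - Suc i)"
  define u w where "u = kchain ki 1 (i - 2)" and "w = kchain ki (Suc i) (n - Suc i)"
  have e: "Suc (1 + (i - 2)) = i" using i by simp
  have x: "chain q (braidB n q i b ki) 1 (i - 2) = qbr q x (b i)"
    using chain_braid_right[of 1 "i - 2"] i unfolding e x_def by simp
  have z: "chain q (braidB n q i b ki) (Suc i) (n - Suc i) = qbr q z (b i)"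
    using chain_braid_left[of i "n - Suc i"] i by (simp add: z_def)
  have u: "kchain (braidK n i ki k) 1 (i - 2) = u * ki i"
    using kchain_braid_right[of 1 "i - 2" n] i unfolding e u_def by simp
  have w: "kchain (braidK n i ki k) (Suc i) (n - Suc i) = w * ki i"
    using kchain_braid_left[of i "n - Suc i"] i by (simp add: w_def)
  have S: "qserre q (k i) (b i) z"
    using serre_b_chain[of i "n - Suc i"] i by (auto simp: z_def)
  have ki: "z * ki i = ki i * z" "b i * ki i = ki i * b i" "ki i * w = w * ki i"
    unfolding z_def w_def using i by (auto intro!: chain_k_commute central kchain_central)
  have "qbr q (b i) (qbr q z (b i)) = k i * z"
    using qserre_right(2)[OF S] by (simp add: qbr_def[of q "b i" "qbr q z (b i)"])
  moreover have "qbr q (ki i * b i) (1 * qbr q z (b i)) = ki i * (1 * qbr q (b i) (qbr q z (b i)))"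
    by (rule qbr_scaled) (auto simp: qbr_def algebra_simps ki ki[THEN comm_rewrite])
  ultimately have "qbr q (ki i * b i) (qbr q z (b i)) = z"
    using units(2)[of i] i by (simp add: mult.assoc[symmetric])
  moreover have "x * z = z * x"
    using i by (auto simp: x_def z_def intro!: chain_chain_commute)
  ultimately show "chain q (braidB n q i b ki) 1 (n - 1) = chain q b 1 (n - 1)"
    unfolding T.top_chain_middle(1)[OF i] top_chain_middle(1)[OF i] x z
    by (simp add: braidB_def qbr_assoc del: One_nat_def flip: x_def z_def)
  have "ki i * (k i * (w * ki i)) = ki i * w"
    using units[of i] i by (simp add: ki(3) mult.assoc[symmetric])
  then show "kchain (braidK n i ki k) 1 (n - 1) = kchain ki 1 (n - 1)"
    unfolding top_chain_middle(2)[OF i] u w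
    by (simp add: braidK_def mult.assoc del: One_nat_def flip: u_def w_def)
qed

text \<open>
  At the left end the bracket \<open>[b\<^sub>1, c]\<^sub>q\<close> collapses to \<open>c\<close>, and the Serre relation identifies
  \<open>[[b\<^sub>1, c]\<^sub>q, b\<^sub>1]\<^sub>q\<close> with \<open>k\<^sub>1 c\<close>. At the right end \<open>[c, b\<^sub>n]\<^sub>q\<close> becomes \<open>k\<^sub>n\<^sup>-\<^sup>1 [[c, b\<^sub>n]\<^sub>q, b\<^sub>n]\<^sub>q\<close>
  outright. In both cases the factor \<open>k\<^sub>i\<close> gained by the central product accounts for the
  difference.
\<close>

lemma top_chain_braid_end:
  assumes i: "i = 1 \<or> i = n"
  shows "kchain (braidK n i ki k) 1 (n - 1) * chain q (braidB n q i b ki) 1 (n - 1)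
      = qbr q (kchain ki 1 (n - 1) * chain q b 1 (n - 1)) (b i)"
    "kchain (braidK n i ki k) 1 (n - 1) = kchain ki 1 (n - 1) * k i"
proof -
  have le: "i \<le> n" using i n by auto
  interpret T: iquantum_family q p n "braidB n q i b ki" "braidK n i k ki" "braidK n i ki k"
    by (rule braided_family[OF le])
  define M where "M = kchain ki 1 (n - 1)"
  have M: "b i * M = M * b i" "k i * M = M * k i"
    using le n by (auto simp: M_def intro!: kchain_central)
  have scale: "qbr q (M * x) (b i) = M * qbr q x (b i)" for x
    using qbr_scaled[of x 1 "b i" M] M by simp
  have *: "kchain (braidK n i ki k) 1 (n - 1) = M * k i \<and>
      k i * chain q (braidB n q i b ki) 1 (n - 1) = qbr q (chain q b 1 (n - 1)) (b i)"
  proof (cases "i = 1")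
    case True
    define c w where "c = chain q b 2 (n - 2)" and "w = kchain ki 2 (n - 2)"
    have c: "chain q (braidB n q i b ki) 2 (n - 2) = qbr q c (b i)"
      using chain_braid_left[of 1 "n - 2"] True n by (auto simp: c_def numeral_2_eq_2)
    have w: "kchain (braidK n i ki k) 2 (n - 2) = w * ki i"
      using kchain_braid_left[of 1 "n - 2"] True n by (auto simp: w_def numeral_2_eq_2)
    have S: "qserre q (k i) (b i) c"
      using serre_b_chain[of 1 "n - 2"] True n by (auto simp: c_def numeral_2_eq_2)
    have ki: "c * ki i = ki i * c" "b i * ki i = ki i * b i" "ki i * w = w * ki i"
      unfolding c_def w_def using True n by (auto intro!: chain_k_commute central kchain_central)
    have kiw: "k i * w = w * k i"
      unfolding w_def using True n by (auto intro!: kchain_central)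
    have "k i * w * ki i = w" using units(1)[OF le] by (simp add: kiw mult.assoc)
    moreover have kikw: "ki i * w * k i = w"
      using units(2)[OF le] by (metis kiw mult.assoc mult_1_left)
    ultimately have kwk: "k i * (w * ki i) = w" by (simp add: mult.assoc)
    have "qbr q (ki i * b i) (1 * qbr q c (b i)) = ki i * (1 * qbr q (b i) (qbr q c (b i)))"
      by (rule qbr_scaled) (auto simp: qbr_def algebra_simps ki ki[THEN comm_rewrite])
    moreover have "qbr q (b i) (qbr q c (b i)) = k i * c"
      using qserre_right(2)[OF S] by (simp add: qbr_def[of q "b i" "qbr q c (b i)"])
    ultimately have "chain q (braidB n q i b ki) 1 (n - 1) = c"
      unfolding T.top_chain_left(1) c using True units(2)[OF le]
      by (simp add: braidB_def mult.assoc[symmetric])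
    moreover have "qbr q (qbr q (b i) c) (b i) = k i * c"
      using qserre_left(2)[OF S] by (simp add: qbr_def[of q "qbr q (b i) c" "b i"])
    then have "qbr q (chain q b 1 (n - 1)) (b i) = k i * c"
      using True by (simp only: top_chain_left(1) c_def)
    moreover have "kchain (braidK n i ki k) 1 (n - 1) = w"
      unfolding top_chain_left(2) w using True kwk by (simp add: braidK_def)
    moreover have "M * k i = w"
      unfolding M_def top_chain_left(2) using True kikw by (simp add: w_def)
    ultimately show ?thesis by simp
  next
    case False
    then have i: "i = n" using i by simp
    have e: "Suc (1 + (n - 2)) = n" using n by simp
    define c w where "c = chain q b 1 (n - 2)" and "w = kchain ki 1 (n - 2)"
    have c: "chain q (braidB n q i b ki) 1 (n - 2) = qbr q c (b i)"
      using chain_braid_right[of 1 "n - 2"] n unfolding e i c_def by simp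
    have w: "kchain (braidK n i ki k) 1 (n - 2) = w * ki i"
      using kchain_braid_right[of 1 "n - 2" n ki] n unfolding e i w_def by simp
    have ki: "c * ki i = ki i * c" "b i * ki i = ki i * b i"
      unfolding c_def using i n by (auto intro!: chain_k_commute central)
    have "qbr q (1 * qbr q c (b i)) (ki i * b i) = 1 * (ki i * qbr q (qbr q c (b i)) (b i))"
      by (rule qbr_scaled) (auto simp: qbr_def algebra_simps ki ki[THEN comm_rewrite])
    then have "chain q (braidB n q i b ki) 1 (n - 1) = ki i * qbr q (chain q b 1 (n - 1)) (b i)"
      unfolding T.top_chain_right(1) top_chain_right(1) c by (simp add: braidB_def i c_def)
    then have "k i * chain q (braidB n q i b ki) 1 (n - 1) = qbr q (chain q b 1 (n - 1)) (b i)"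
      using units(1)[OF le] by (simp add: mult.assoc[symmetric])
    moreover have "kchain (braidK n i ki k) 1 (n - 1) = w * ki i * k i"
      unfolding top_chain_right(2) w by (simp add: braidK_def i)
    moreover have "M = w * ki i"
      unfolding M_def top_chain_right(2) by (simp add: w_def i)
    ultimately show ?thesis by simp
  qed
  then show "kchain (braidK n i ki k) 1 (n - 1) = kchain ki 1 (n - 1) * k i"
    by (simp add: M_def)
  have "kchain (braidK n i ki k) 1 (n - 1) * chain q (braidB n q i b ki) 1 (n - 1)
      = M * qbr q (chain q b 1 (n - 1)) (b i)"
    using * by (simp add: mult.assoc)
  then show "kchain (braidK n i ki k) 1 (n - 1) * chain q (braidB n q i b ki) 1 (n - 1)
      = qbr q (kchain ki 1 (n - 1) * chain q b 1 (n - 1)) (b i)"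
    by (simp only: scale flip: M_def)
qed

lemma qbr_scaleC: "qbr q (a *\<^sub>C x) y = a *\<^sub>C qbr q x (y :: 'a)"
  by (simp add: qbr_def scaleC_distribs mult.commute)

text \<open>
  Equivariance: transforming the finite generators by \<open>T\<^sub>i\<close> and then forming the images of all affine
  generators is the same as forming these images first and then applying the formula for \<open>T\<^sub>i\<close> to
  them. The free parameter \<open>a'\<close> is possible since \<open>T\<^sub>i\<close> uses \<open>k\<^sub>i\<^sup>-\<^sup>1\<close> for \<open>i \<noteq> 0\<close> only.
\<close>

lemma eval_braid:
  assumes i: "i \<in> {1..n}"
  shows "evalB n q a (braidB n q i b ki) (braidK n i ki k) j
      = braidB n q i (evalB n q a b ki) (evalK n a' ki k) j"
    "evalK n a (braidK n i k ki) (braidK n i ki k) j = braidK n i (evalK n a k ki) (evalK n a' ki k) j"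
proof -
  have "evalB n q a (braidB n q i b ki) (braidK n i ki k) j
      = braidB n q i (evalB n q a b ki) (evalK n a' ki k) j \<and>
    evalK n a (braidK n i k ki) (braidK n i ki k) j = braidK n i (evalK n a k ki) (evalK n a' ki k) j"
  proof (cases "j = 0")
    case False
    then show ?thesis using i by (auto simp: evalB_def evalK_def braidB_def braidK_def)
  next
    case j: True
    consider "i = 1 \<or> i = n" | "1 < i" "i < n" using i by force
    then show ?thesis
    proof cases
      case 1
      then have "cartan n i 0 = -1" using i n by (auto simp: cartan_sym[of n _ 0] cartan_zero)
      then show ?thesis using i j top_chain_braid_end[OF 1]
        by (simp add: evalB_def evalK_def braidB_def braidK_def qbr_scaleC del: One_nat_def)
    next
      case 2
      then have "cartan n i 0 = 0" using i n by (auto simp: cartan_sym[of n _ 0] cartan_zero)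
      then show ?thesis using i j top_chain_braid_middle[OF 2]
        by (simp add: evalB_def evalK_def braidB_def braidK_def del: One_nat_def)
    qed
  qed
  then show "evalB n q a (braidB n q i b ki) (braidK n i ki k) j
      = braidB n q i (evalB n q a b ki) (evalK n a' ki k) j"
    "evalK n a (braidK n i k ki) (braidK n i ki k) j = braidK n i (evalK n a k ki) (evalK n a' ki k) j"
    by auto
qed

end

section \<open>The free algebra and its quotient\<close>

lemma keys_update_fresh:
  "a \<notin> Poly_Mapping.keys f \<Longrightarrow> Poly_Mapping.update a b f = f + Poly_Mapping.single a b"
  by (rule poly_mapping_eqI) (auto simp: lookup_update lookup_add lookup_single when_def in_keys_iff)

lemma poly_mapping_single_induct [case_names zero single_add]:
  assumes "P 0"
    and "\<And>a b f. P f \<Longrightarrow> a \<notin> Poly_Mapping.keys f \<Longrightarrow> b \<noteq> 0 \<Longrightarrow> P (Poly_Mapping.single a b + f)"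
  shows "P (f :: 'a \<Rightarrow>\<^sub>0 'b :: comm_monoid_add)"
proof (induction f rule: update_induct)
  case (update f a b)
  then show ?case using assms(2)[of f a b] by (simp add: keys_update_fresh add.commute)
qed (rule assms(1))

lemma single_Word_Cons:
  "Poly_Mapping.single (Word (g # w)) c = fgen g * Poly_Mapping.single (Word w) c"
  by (simp add: fgen_def mult_single plus_free_monoid_def)

lemma free_algebra_simps [simp]:
  "mult (free_algebra G) = (*)" "one (free_algebra G) = 1" "zero (free_algebra G) = 0"
  "add (free_algebra G) = (+)"
  by (simp_all add: free_algebra_def)

lemma free_algebra_carrier:
  "f \<in> carrier (free_algebra G) \<longleftrightarrow> (\<forall>w \<in> Poly_Mapping.keys f. set (letters w) \<subseteq> G)"
  by (simp add: free_algebra_def)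

lemma free_algebra_closed:
  "0 \<in> carrier (free_algebra G)" "1 \<in> carrier (free_algebra G)" "fconst c \<in> carrier (free_algebra G)"
  "g \<in> G \<Longrightarrow> fgen g \<in> carrier (free_algebra G)"
  "f \<in> carrier (free_algebra G) \<Longrightarrow> f' \<in> carrier (free_algebra G) \<Longrightarrow> f + f' \<in> carrier (free_algebra G)"
  "f \<in> carrier (free_algebra G) \<Longrightarrow> f' \<in> carrier (free_algebra G) \<Longrightarrow> f * f' \<in> carrier (free_algebra G)"
  "f \<in> carrier (free_algebra G) \<Longrightarrow> - f \<in> carrier (free_algebra G)"
  "f \<in> carrier (free_algebra G) \<Longrightarrow> f' \<in> carrier (free_algebra G) \<Longrightarrow> f - f' \<in> carrier (free_algebra G)"
proof -
  show "0 \<in> carrier (free_algebra G)" "1 \<in> carrier (free_algebra G)" "fconst c \<in> carrier (free_algebra G)"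
    "g \<in> G \<Longrightarrow> fgen g \<in> carrier (free_algebra G)"
    by (auto simp: free_algebra_carrier fconst_def fgen_def zero_free_monoid_def)
  show add: "f + f' \<in> carrier (free_algebra G)"
    if "f \<in> carrier (free_algebra G)" "f' \<in> carrier (free_algebra G)" for f f'
    using that keys_add[of f f'] by (auto simp: free_algebra_carrier)
  show "f * f' \<in> carrier (free_algebra G)"
    if "f \<in> carrier (free_algebra G)" "f' \<in> carrier (free_algebra G)" for f f'
    using that keys_mult[of f f'] by (fastforce simp: free_algebra_carrier plus_free_monoid_def)
  show uminus: "- f \<in> carrier (free_algebra G)" if "f \<in> carrier (free_algebra G)" for f
    using that by (auto simp: free_algebra_carrier in_keys_iff)
  show "f - f' \<in> carrier (free_algebra G)"
    if "f \<in> carrier (free_algebra G)" "f' \<in> carrier (free_algebra G)" for f f'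
    using add[OF that(1) uminus[OF that(2)]] by simp
qed

lemma free_algebra_ring: "ring (free_algebra G)"
proof (rule ringI)
  show "abelian_group (free_algebra G)"
  proof (rule abelian_groupI)
    fix x assume "x \<in> carrier (free_algebra G)"
    then show "\<exists>y\<in>carrier (free_algebra G). y \<oplus>\<^bsub>free_algebra G\<^esub> x = \<zero>\<^bsub>free_algebra G\<^esub>"
      by (intro bexI[of _ "- x"]) (auto intro: free_algebra_closed)
  qed (auto simp: algebra_simps intro: free_algebra_closed)
  show "Group.monoid (free_algebra G)"
    by (rule monoidI) (auto simp: algebra_simps intro: free_algebra_closed)
qed (auto simp: algebra_simps)

lemma free_algebra_induct [consumes 1, case_names const gen add mult]:
  assumes "f \<in> carrier (free_algebra G)"
    and c: "\<And>c. P (fconst c)" and g: "\<And>g. g \<in> G \<Longrightarrow> P (fgen g)"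
    and add: "\<And>f f'. f \<in> carrier (free_algebra G) \<Longrightarrow> f' \<in> carrier (free_algebra G)
      \<Longrightarrow> P f \<Longrightarrow> P f' \<Longrightarrow> P (f + f')"
    and mult: "\<And>f f'. f \<in> carrier (free_algebra G) \<Longrightarrow> f' \<in> carrier (free_algebra G)
      \<Longrightarrow> P f \<Longrightarrow> P f' \<Longrightarrow> P (f * f')"
  shows "P f"
  using assms(1)
proof (induction f rule: poly_mapping_single_induct)
  case zero
  then show ?case using c[of 0] by (simp add: fconst_def)
next
  case (single_add w b f)
  have keys: "Poly_Mapping.keys (Poly_Mapping.single w b + f) = insert w (Poly_Mapping.keys f)"
    using single_add.hyps by (auto simp: in_keys_iff lookup_add lookup_single when_def split: if_splits)
  then have f: "f \<in> carrier (free_algebra G)" and w: "set (letters w) \<subseteq> G"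
    using single_add.prems by (auto simp: free_algebra_carrier)
  have "Poly_Mapping.single (Word xs) b \<in> carrier (free_algebra G) \<and> P (Poly_Mapping.single (Word xs) b)"
    if "set xs \<subseteq> G" for xs
    using that
  proof (induction xs)
    case Nil
    then show ?case using c[of b] by (simp add: fconst_def zero_free_monoid_def free_algebra_carrier)
  next
    case (Cons g xs)
    then show ?case
      unfolding single_Word_Cons by (auto intro: mult g free_algebra_closed)
  qed
  from this[OF w] show ?case
    using f single_add.IH by (auto intro: add)
qed

text \<open>
  The universal property of the free algebra.
\<close>

definition feval :: "('g \<Rightarrow> 'a :: complex_algebra) \<Rightarrow> 'g free_alg \<Rightarrow> 'a" where
  "feval \<phi> f = (\<Sum>w\<in>Poly_Mapping.keys f. Poly_Mapping.lookup f w *\<^sub>C prod_list (map \<phi> (letters w)))"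

lemma feval_add: "feval \<phi> (f + g) = feval \<phi> f + feval \<phi> g"
proof -
  let ?K = "Poly_Mapping.keys f \<union> Poly_Mapping.keys g"
  have e: "feval \<phi> h = (\<Sum>w\<in>?K. Poly_Mapping.lookup h w *\<^sub>C prod_list (map \<phi> (letters w)))"
    if "Poly_Mapping.keys h \<subseteq> ?K" for h
    unfolding feval_def using that by (intro sum.mono_neutral_left) (auto simp: in_keys_iff)
  show ?thesis
    using keys_add[of f g] by (simp add: e lookup_add scaleC_add_left sum.distrib)
qed

lemma feval_single: "feval \<phi> (Poly_Mapping.single w c) = c *\<^sub>C prod_list (map \<phi> (letters w))"
  by (simp add: feval_def)

lemma feval_zero: "feval \<phi> 0 = 0"
  by (simp add: feval_def)

lemma feval_mult: "feval \<phi> (f * g) = feval \<phi> f * feval \<phi> g"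
proof (induction f rule: poly_mapping_single_induct)
  case (single_add a b f)
  have "feval \<phi> (Poly_Mapping.single a b * g) = feval \<phi> (Poly_Mapping.single a b) * feval \<phi> g"
  proof (induction g rule: poly_mapping_single_induct)
    case (single_add a' b' g)
    then show ?case
      by (simp add: distrib_left feval_add mult_single feval_single plus_free_monoid_def mult.assoc
          mult.commute[of b])
  qed (simp add: feval_zero)
  with single_add.IH show ?case by (simp add: distrib_right feval_add)
qed (simp add: feval_zero)

lemma feval_fconst: "feval \<phi> (fconst c) = c *\<^sub>C 1"
  by (simp add: fconst_def feval_single zero_free_monoid_def)

lemma feval_fgen: "feval \<phi> (fgen g) = \<phi> g"
  by (simp add: fgen_def feval_single)

lemma feval_one: "feval \<phi> 1 = 1"
  using feval_fconst[of \<phi> 1] by (simp add: fconst_def)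

lemma feval_minus: "feval \<phi> (f - g) = feval \<phi> f - feval \<phi> g"
  using feval_add[of \<phi> "f - g" g] by simp

lemmas feval_simps = feval_add feval_mult feval_minus feval_fconst feval_fgen feval_one feval_zero

lemma gens_iff: "GB i \<in> gens n \<longleftrightarrow> i \<le> n" "GK i \<in> gens n \<longleftrightarrow> i \<le> n" "GKinv i \<in> gens n \<longleftrightarrow> i \<le> n"
  by (auto simp: gens_def)

lemma gens_cases:
  assumes "g \<in> gens n"
  obtains i where "i \<le> n" "g = GB i" | i where "i \<le> n" "g = GK i" | i where "i \<le> n" "g = GKinv i"
  using assms by (auto simp: gens_def)

lemma relators_carrier: "relators n q \<subseteq> carrier (free_algebra (gens n))"
  unfolding relators_def by (auto simp: power2_eq_square gens_iff intro!: free_algebra_closed)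

lemma rel_ideal_ideal: "ideal (rel_ideal n q) (free_algebra (gens n))"
  unfolding rel_ideal_def by (intro ring.genideal_ideal free_algebra_ring relators_carrier)

lemma relators_in_rel_ideal: "relators n q \<subseteq> rel_ideal n q"
  unfolding rel_ideal_def by (intro ring.genideal_self free_algebra_ring relators_carrier)

lemma Uaff_ring: "ring (Uaff n q)"
  unfolding Uaff_def by (rule ideal.quotient_is_ring[OF rel_ideal_ideal])

lemma quot_class_hom: "quot_class n q \<in> ring_hom (free_algebra (gens n)) (Uaff n q)"
proof -
  have "quot_class n q = (+>\<^bsub>free_algebra (gens n)\<^esub>) (rel_ideal n q)"
    by (simp add: quot_class_def fun_eq_iff)
  then show ?thesis
    unfolding Uaff_def using ideal.rcos_ring_hom[OF rel_ideal_ideal] by simp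
qed

lemma quot_class_simps:
  assumes "f \<in> carrier (free_algebra (gens n))" "g \<in> carrier (free_algebra (gens n))"
  shows "quot_class n q (f + g) = quot_class n q f \<oplus>\<^bsub>Uaff n q\<^esub> quot_class n q g"
    "quot_class n q (f * g) = quot_class n q f \<otimes>\<^bsub>Uaff n q\<^esub> quot_class n q g"
  using ring_hom_add[OF quot_class_hom assms] ring_hom_mult[OF quot_class_hom assms] by simp_all

lemma quot_class_closed:
  "f \<in> carrier (free_algebra (gens n)) \<Longrightarrow> quot_class n q f \<in> carrier (Uaff n q)"
  using ring_hom_closed[OF quot_class_hom] by auto

lemma quot_class_one: "quot_class n q 1 = \<one>\<^bsub>Uaff n q\<^esub>"
  using ring_hom_one[OF quot_class_hom] by simp

lemma quot_class_surj:
  assumes "x \<in> carrier (Uaff n q)"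
  obtains f where "f \<in> carrier (free_algebra (gens n))" "x = quot_class n q f"
  using assms by (auto simp: Uaff_def FactRing_def A_RCOSETS_def' quot_class_def)

lemma quot_class_eqD:
  assumes "f \<in> carrier (free_algebra (gens n))" "g \<in> carrier (free_algebra (gens n))"
    and "quot_class n q f = quot_class n q g"
  shows "f - g \<in> rel_ideal n q"
proof -
  interpret ideal "rel_ideal n q" "free_algebra (gens n)" by (rule rel_ideal_ideal)
  have "f \<in> quot_class n q g"
    using a_rcos_self[OF assms(1)] assms(3) by (simp add: quot_class_def)
  then obtain h where "h \<in> rel_ideal n q" "f = h + g"
    by (auto simp: quot_class_def a_r_coset_def r_coset_def)
  then show ?thesis by simp
qed

lemma quot_class_rel:
  assumes "f \<in> rel_ideal n q"
  shows "quot_class n q f = \<zero>\<^bsub>Uaff n q\<^esub>"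
proof -
  interpret ideal "rel_ideal n q" "free_algebra (gens n)" by (rule rel_ideal_ideal)
  show ?thesis
    using a_rcos_const[OF assms] by (simp add: quot_class_def Uaff_def FactRing_def)
qed

lemma Uaff_closed:
  "scal n q c \<in> carrier (Uaff n q)" "i \<le> n \<Longrightarrow> Bg n q i \<in> carrier (Uaff n q)"
  "i \<le> n \<Longrightarrow> Kg n q i \<in> carrier (Uaff n q)"
  by (simp_all add: scal_def Bg_def Kg_def quot_class_closed free_algebra_closed gens_iff)

lemma Kg_inverse:
  assumes "i \<le> n"
  shows "Kg n q i \<otimes>\<^bsub>Uaff n q\<^esub> quot_class n q (fgen (GKinv i)) = \<one>\<^bsub>Uaff n q\<^esub>"
    "quot_class n q (fgen (GKinv i)) \<otimes>\<^bsub>Uaff n q\<^esub> Kg n q i = \<one>\<^bsub>Uaff n q\<^esub>"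
    "inv\<^bsub>Uaff n q\<^esub> Kg n q i = quot_class n q (fgen (GKinv i))"
    "Kg n q i \<in> Units (Uaff n q)"
proof -
  interpret U: ring "Uaff n q" by (rule Uaff_ring)
  have c: "fgen (GK i) \<in> carrier (free_algebra (gens n))" "fgen (GKinv i) \<in> carrier (free_algebra (gens n))"
    using assms by (auto simp: gens_iff intro: free_algebra_closed)
  have *: "quot_class n q f = \<one>\<^bsub>Uaff n q\<^esub>"
    if "f - 1 \<in> relators n q" "f \<in> carrier (free_algebra (gens n))" for f
  proof -
    have "quot_class n q (f - 1 + 1) = \<zero>\<^bsub>Uaff n q\<^esub> \<oplus>\<^bsub>Uaff n q\<^esub> \<one>\<^bsub>Uaff n q\<^esub>"
      using that relators_in_rel_ideal[of n q] relators_carrier[of n q]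
      by (subst quot_class_simps) (auto simp: quot_class_one quot_class_rel free_algebra_closed)
    then show ?thesis by simp
  qed
  show 1: "Kg n q i \<otimes>\<^bsub>Uaff n q\<^esub> quot_class n q (fgen (GKinv i)) = \<one>\<^bsub>Uaff n q\<^esub>"
    "quot_class n q (fgen (GKinv i)) \<otimes>\<^bsub>Uaff n q\<^esub> Kg n q i = \<one>\<^bsub>Uaff n q\<^esub>"
    unfolding Kg_def quot_class_simps(2)[OF c, symmetric] quot_class_simps(2)[OF c(2,1), symmetric]
    using assms c by (auto intro!: * free_algebra_closed simp: relators_def)
  have "quot_class n q (fgen (GKinv i)) \<in> carrier (Uaff n q)"
    using c by (simp add: quot_class_closed)
  with 1 show "inv\<^bsub>Uaff n q\<^esub> Kg n q i = quot_class n q (fgen (GKinv i))"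
    using assms by (intro U.inv_char Uaff_closed) auto
  show "Kg n q i \<in> Units (Uaff n q)"
    using 1 assms \<open>quot_class n q (fgen (GKinv i)) \<in> carrier (Uaff n q)\<close>
    by (auto simp: Units_def intro: Uaff_closed)
qed

lemma Uaff_induct [consumes 1, case_names scal B K Kinv add mult]:
  assumes x: "x \<in> carrier (Uaff n q)"
    and "\<And>c. P (scal n q c)" and "\<And>i. i \<le> n \<Longrightarrow> P (Bg n q i)" and "\<And>i. i \<le> n \<Longrightarrow> P (Kg n q i)"
    and "\<And>i. i \<le> n \<Longrightarrow> P (inv\<^bsub>Uaff n q\<^esub> Kg n q i)"
    and "\<And>x y. x \<in> carrier (Uaff n q) \<Longrightarrow> y \<in> carrier (Uaff n q) \<Longrightarrow> P x \<Longrightarrow> P y \<Longrightarrow> P (x \<oplus>\<^bsub>Uaff n q\<^esub> y)"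
    and "\<And>x y. x \<in> carrier (Uaff n q) \<Longrightarrow> y \<in> carrier (Uaff n q) \<Longrightarrow> P x \<Longrightarrow> P y \<Longrightarrow> P (x \<otimes>\<^bsub>Uaff n q\<^esub> y)"
  shows "P x"
proof -
  obtain f where f: "f \<in> carrier (free_algebra (gens n))" "x = quot_class n q f"
    using quot_class_surj[OF x] .
  have "P (quot_class n q f)"
    using f(1)
  proof (induction f rule: free_algebra_induct)
    case (gen g)
    then show ?case
      using assms(3-5) by (auto simp: Bg_def Kg_def Kg_inverse(3)[unfolded Kg_def] elim!: gens_cases)
  qed (use assms in \<open>simp_all add: quot_class_simps quot_class_closed flip: scal_def\<close>)
  then show ?thesis by (simp add: f)
qed

section \<open>All affine algebras as one complex algebra\<close>

lemma fconst_add: "fconst (c + d) = fconst c + fconst d"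
  by (simp add: fconst_def single_add)

lemma fconst_mult: "fconst (c * d) = fconst c * fconst d"
  by (simp add: fconst_def mult_single)

lemma fconst_one: "fconst 1 = 1"
  by (simp add: fconst_def)

lemma fconst_commute: "f * fconst c = fconst c * f"
proof (induction f rule: poly_mapping_single_induct)
  case (single_add a b f)
  have "Poly_Mapping.single a b * fconst c = fconst c * Poly_Mapping.single a b"
    by (simp add: fconst_def mult_single mult.commute)
  with single_add.IH show ?case by (simp add: algebra_simps)
qed simp

lemma smul_quot_class:
  "f \<in> carrier (free_algebra (gens n)) \<Longrightarrow> smul n q c (quot_class n q f) = quot_class n q (fconst c * f)"
  by (simp add: smul_def scal_def quot_class_simps free_algebra_closed)

lemma smul_closed: "x \<in> carrier (Uaff n q) \<Longrightarrow> smul n q c x \<in> carrier (Uaff n q)"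
  unfolding smul_def using Uaff_ring[of n q] by (intro monoid.m_closed ring.is_monoid Uaff_closed)

lemma smul_module:
  assumes "x \<in> carrier (Uaff n q)"
  shows "smul n q (c + d) x = smul n q c x \<oplus>\<^bsub>Uaff n q\<^esub> smul n q d x"
    "smul n q c (smul n q d x) = smul n q (c * d) x" "smul n q 1 x = x"
proof -
  obtain f where f: "f \<in> carrier (free_algebra (gens n))" "x = quot_class n q f"
    using quot_class_surj[OF assms(1)] .
  show "smul n q (c + d) x = smul n q c x \<oplus>\<^bsub>Uaff n q\<^esub> smul n q d x"
    "smul n q c (smul n q d x) = smul n q (c * d) x" "smul n q 1 x = x"
    by (simp_all add: f smul_quot_class quot_class_simps[symmetric] free_algebra_closed
        fconst_add fconst_mult fconst_one distrib_right mult.assoc)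
qed

lemma smul_bilinear:
  assumes "x \<in> carrier (Uaff n q)" "y \<in> carrier (Uaff n q)"
  shows "smul n q c (x \<oplus>\<^bsub>Uaff n q\<^esub> y) = smul n q c x \<oplus>\<^bsub>Uaff n q\<^esub> smul n q c y"
    "smul n q c x \<otimes>\<^bsub>Uaff n q\<^esub> y = smul n q c (x \<otimes>\<^bsub>Uaff n q\<^esub> y)"
    "x \<otimes>\<^bsub>Uaff n q\<^esub> smul n q c y = smul n q c (x \<otimes>\<^bsub>Uaff n q\<^esub> y)"
proof -
  obtain f where f: "f \<in> carrier (free_algebra (gens n))" "x = quot_class n q f"
    using quot_class_surj[OF assms(1)] .
  obtain g where g: "g \<in> carrier (free_algebra (gens n))" "y = quot_class n q g"
    using quot_class_surj[OF assms(2)] .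
  have "f * (fconst c * g) = fconst c * (f * g)"
    by (simp add: fconst_commute flip: mult.assoc)
  then show "smul n q c (x \<oplus>\<^bsub>Uaff n q\<^esub> y) = smul n q c x \<oplus>\<^bsub>Uaff n q\<^esub> smul n q c y"
    "smul n q c x \<otimes>\<^bsub>Uaff n q\<^esub> y = smul n q c (x \<otimes>\<^bsub>Uaff n q\<^esub> y)"
    "x \<otimes>\<^bsub>Uaff n q\<^esub> smul n q c y = smul n q c (x \<otimes>\<^bsub>Uaff n q\<^esub> y)"
    by (simp_all add: f g smul_quot_class quot_class_simps[symmetric] free_algebra_closed
        distrib_left mult.assoc)
qed

lemmas smul_simps = smul_module smul_bilinear

lemma scal_eq_smul: "scal n q c = smul n q c \<one>\<^bsub>Uaff n q\<^esub>"
  by (simp add: smul_quot_class scal_def free_algebra_closed flip: quot_class_one)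

text \<open>
  A type cannot depend on \<open>n\<close> and \<open>q\<close>, but the product of the algebras over all parameters is a single
  type, and each \<open>Uaff n q\<close> is the image of a projection.
\<close>

typedef Uprod = "{f :: nat \<Rightarrow> complex \<Rightarrow> gen free_alg set. \<forall>n q. f n q \<in> carrier (Uaff n q)}"
  morphisms component Uprod
  by (rule exI[of _ "\<lambda>n q. \<one>\<^bsub>Uaff n q\<^esub>"]) (simp add: ring.ring_simprules(6)[OF Uaff_ring])

lemma component_closed [simp]: "component x n q \<in> carrier (Uaff n q)"
  using component[of x] by simp

lemma component_Uprod: "(\<And>n q. f n q \<in> carrier (Uaff n q)) \<Longrightarrow> component (Uprod f) n q = f n q"
  by (simp add: Uprod_inverse)

lemma Uprod_eqI: "(\<And>n q. component x n q = component y n q) \<Longrightarrow> x = y"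
  by (simp add: component_inject[symmetric] fun_eq_iff)

lemmas Uaff_simprules = ring.ring_simprules[OF Uaff_ring] monoid.r_one[OF ring.is_monoid[OF Uaff_ring]]

instantiation Uprod :: complex_algebra
begin

definition "0 = Uprod (\<lambda>n q. \<zero>\<^bsub>Uaff n q\<^esub>)"
definition "1 = Uprod (\<lambda>n q. \<one>\<^bsub>Uaff n q\<^esub>)"
definition "x + y = Uprod (\<lambda>n q. component x n q \<oplus>\<^bsub>Uaff n q\<^esub> component y n q)"
definition "x * y = Uprod (\<lambda>n q. component x n q \<otimes>\<^bsub>Uaff n q\<^esub> component y n q)"
definition "- x = Uprod (\<lambda>n q. \<ominus>\<^bsub>Uaff n q\<^esub> component x n q)"
definition "x - y = Uprod (\<lambda>n q. component x n q \<ominus>\<^bsub>Uaff n q\<^esub> component y n q)"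
definition "c *\<^sub>C x = Uprod (\<lambda>n q. smul n q c (component x n q))"

lemma component_simps:
  "component 0 n q = \<zero>\<^bsub>Uaff n q\<^esub>" "component 1 n q = \<one>\<^bsub>Uaff n q\<^esub>"
  "component (x + y) n q = component x n q \<oplus>\<^bsub>Uaff n q\<^esub> component y n q"
  "component (x * y) n q = component x n q \<otimes>\<^bsub>Uaff n q\<^esub> component y n q"
  "component (- x) n q = \<ominus>\<^bsub>Uaff n q\<^esub> component x n q"
  "component (x - y) n q = component x n q \<ominus>\<^bsub>Uaff n q\<^esub> component y n q"
  "component (c *\<^sub>C x) n q = smul n q c (component x n q)"
  unfolding zero_Uprod_def one_Uprod_def plus_Uprod_def times_Uprod_def uminus_Uprod_def
    minus_Uprod_def scaleC_Uprod_def
  by (subst component_Uprod; simp add: Uaff_simprules smul_closed)+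

instance
  by standard
    (rule Uprod_eqI; simp add: component_simps Uaff_simprules smul_simps)+

end

lemma component_scal: "component (c *\<^sub>C 1) n q = scal n q c"
  by (simp add: component_simps scal_eq_smul)

lemma component_qbr:
  "component (qbr v x y) n q = vbracket n q v (component x n q) (component y n q)"
  by (simp add: qbr_def component_simps vbracket_def)

section \<open>Homomorphisms from families of generators\<close>

definition gen_value :: "(nat \<Rightarrow> 'a) \<Rightarrow> (nat \<Rightarrow> 'a) \<Rightarrow> (nat \<Rightarrow> 'a) \<Rightarrow> gen \<Rightarrow> 'a" where
  "gen_value b k ki g = (case g of GB i \<Rightarrow> b i | GK i \<Rightarrow> k i | GKinv i \<Rightarrow> ki i)"

lemma gen_value_simps [simp]:
  "gen_value b k ki (GB i) = b i" "gen_value b k ki (GK i) = k i" "gen_value b k ki (GKinv i) = ki i"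
  by (simp_all add: gen_value_def)

lemma free_algebra_uminus: "f \<in> carrier (free_algebra G) \<Longrightarrow> \<ominus>\<^bsub>free_algebra G\<^esub> f = - f"
  by (rule abelian_group.minus_equality[OF ring.is_abelian_group[OF free_algebra_ring]])
    (simp_all add: free_algebra_closed)

lemma feval_kernel_ideal: "ideal {f \<in> carrier (free_algebra G). feval \<phi> f = 0} (free_algebra G)"
proof (rule idealI[OF free_algebra_ring])
  show "subgroup {f \<in> carrier (free_algebra G). feval \<phi> f = 0} (add_monoid (free_algebra G))"
  proof
    fix f assume f: "f \<in> {f \<in> carrier (free_algebra G). feval \<phi> f = 0}"
    then have "inv\<^bsub>add_monoid (free_algebra G)\<^esub> f = - f"
      using free_algebra_uminus[of f G] by (simp add: a_inv_def)
    then show "inv\<^bsub>add_monoid (free_algebra G)\<^esub> f \<in> {f \<in> carrier (free_algebra G). feval \<phi> f = 0}"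
      using f feval_minus[of \<phi> 0 f] by (simp add: free_algebra_closed feval_zero)
  qed (auto simp: feval_simps intro: free_algebra_closed)
qed (auto simp: feval_simps intro: free_algebra_closed)

text \<open>
  The kernel of the evaluation is an ideal of the free algebra that contains the relators.
\<close>

lemma feval_rel_ideal:
  fixes b k ki :: "nat \<Rightarrow> 'a :: complex_algebra"
  assumes R: "iquantum_rels n q b k ki" and f: "f \<in> rel_ideal n q"
  shows "feval (gen_value b k ki) f = 0"
proof -
  let ?\<phi> = "gen_value b k ki"
  note D = iquantum_relsD[OF R]
  have "feval ?\<phi> r = 0" if "r \<in> relators n q" for r
    using that unfolding relators_def
  proof (elim UnE CollectE exE conjE)
    fix i g assume r: "r = fgen (GK i) * fgen g - fgen g * fgen (GK i)" "i \<le> n" "g \<in> gens n"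
    show ?thesis
      using r(3) by (rule gens_cases) (simp_all add: r(1) feval_simps D(3,4,7)[OF r(2)])
  next
    fix i j assume r: "r = (fgen (GB i))\<^sup>2 * fgen (GB j)
        - fconst (qnum q 2) * fgen (GB i) * fgen (GB j) * fgen (GB i)
        + fgen (GB j) * (fgen (GB i))\<^sup>2
        - fconst (- inverse q) * fgen (GK i) * fgen (GB j)"
      and ij: "i \<le> n" "j \<le> n" "cartan n i j = -1"
    show ?thesis
      using D(10)[OF ij] by (simp add: r feval_simps qserre_def power2_eq_square mult.assoc)
  next
    fix i j assume r: "r = fgen (GB i) * fgen (GB j) - fgen (GB j) * fgen (GB i)"
      and ij: "i \<le> n" "j \<le> n" "cartan n i j = 0"
    show ?thesis
      using D(9)[OF ij] by (simp add: r feval_simps)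
  qed (simp_all add: feval_simps D)
  then have "relators n q \<subseteq> {f \<in> carrier (free_algebra (gens n)). feval ?\<phi> f = 0}"
    using relators_carrier by auto
  then have "rel_ideal n q \<subseteq> {f \<in> carrier (free_algebra (gens n)). feval ?\<phi> f = 0}"
    unfolding rel_ideal_def by (intro ring.genideal_minimal free_algebra_ring feval_kernel_ideal)
  then show ?thesis using f by auto
qed

definition Uaff_eval ::
    "nat \<Rightarrow> complex \<Rightarrow> (nat \<Rightarrow> 'a :: complex_algebra) \<Rightarrow> (nat \<Rightarrow> 'a) \<Rightarrow> (nat \<Rightarrow> 'a) \<Rightarrow> gen free_alg set \<Rightarrow> 'a" where
  "Uaff_eval n q b k ki x =
     feval (gen_value b k ki) (SOME f. f \<in> carrier (free_algebra (gens n)) \<and> x = quot_class n q f)"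

lemma Uaff_eval_quot_class:
  assumes R: "iquantum_rels n q b k ki" and f: "f \<in> carrier (free_algebra (gens n))"
  shows "Uaff_eval n q b k ki (quot_class n q f) = feval (gen_value b k ki) f"
proof -
  define g where "g = (SOME g. g \<in> carrier (free_algebra (gens n)) \<and> quot_class n q f = quot_class n q g)"
  have "g \<in> carrier (free_algebra (gens n)) \<and> quot_class n q f = quot_class n q g"
    unfolding g_def by (rule someI[of _ f]) (use f in simp)
  then have "g - f \<in> rel_ideal n q"
    using f by (intro quot_class_eqD) auto
  then have "feval (gen_value b k ki) (g - f) = 0" by (rule feval_rel_ideal[OF R])
  then show ?thesis by (simp add: Uaff_eval_def feval_minus flip: g_def)
qed

lemma Uaff_eval_simps:
  assumes R: "iquantum_rels n q b k ki"
  shows "x \<in> carrier (Uaff n q) \<Longrightarrow> y \<in> carrier (Uaff n q) \<Longrightarrow>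
      Uaff_eval n q b k ki (x \<oplus>\<^bsub>Uaff n q\<^esub> y) = Uaff_eval n q b k ki x + Uaff_eval n q b k ki y"
    "x \<in> carrier (Uaff n q) \<Longrightarrow> y \<in> carrier (Uaff n q) \<Longrightarrow>
      Uaff_eval n q b k ki (x \<otimes>\<^bsub>Uaff n q\<^esub> y) = Uaff_eval n q b k ki x * Uaff_eval n q b k ki y"
    "Uaff_eval n q b k ki \<one>\<^bsub>Uaff n q\<^esub> = 1" "Uaff_eval n q b k ki (scal n q c) = c *\<^sub>C 1"
    "x \<in> carrier (Uaff n q) \<Longrightarrow> Uaff_eval n q b k ki (smul n q c x) = c *\<^sub>C Uaff_eval n q b k ki x"
    "i \<le> n \<Longrightarrow> Uaff_eval n q b k ki (Bg n q i) = b i" "i \<le> n \<Longrightarrow> Uaff_eval n q b k ki (Kg n q i) = k i"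
    "i \<le> n \<Longrightarrow> Uaff_eval n q b k ki (inv\<^bsub>Uaff n q\<^esub> Kg n q i) = ki i"
proof -
  note simps = Uaff_eval_quot_class[OF R] free_algebra_closed feval_simps gens_iff
  show add: "Uaff_eval n q b k ki (x \<oplus>\<^bsub>Uaff n q\<^esub> y) = Uaff_eval n q b k ki x + Uaff_eval n q b k ki y"
    and mult: "Uaff_eval n q b k ki (x \<otimes>\<^bsub>Uaff n q\<^esub> y) = Uaff_eval n q b k ki x * Uaff_eval n q b k ki y"
    if "x \<in> carrier (Uaff n q)" "y \<in> carrier (Uaff n q)" for x y
    using that by (auto elim!: quot_class_surj simp: simps quot_class_simps[symmetric])
  show "Uaff_eval n q b k ki \<one>\<^bsub>Uaff n q\<^esub> = 1" and scal: "Uaff_eval n q b k ki (scal n q c) = c *\<^sub>C 1"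
    "i \<le> n \<Longrightarrow> Uaff_eval n q b k ki (Bg n q i) = b i" "i \<le> n \<Longrightarrow> Uaff_eval n q b k ki (Kg n q i) = k i"
    "i \<le> n \<Longrightarrow> Uaff_eval n q b k ki (inv\<^bsub>Uaff n q\<^esub> Kg n q i) = ki i"
    by (simp_all add: simps scal_def Bg_def Kg_inverse(3) flip: quot_class_one)
      (simp_all add: simps Kg_def)
  show "x \<in> carrier (Uaff n q) \<Longrightarrow> Uaff_eval n q b k ki (smul n q c x) = c *\<^sub>C Uaff_eval n q b k ki x"
    by (simp add: smul_def mult scal Uaff_closed)
qed

lemma quot_class_minus:
  assumes "f \<in> carrier (free_algebra (gens n))" "g \<in> carrier (free_algebra (gens n))"
  shows "quot_class n q (f - g) = quot_class n q f \<ominus>\<^bsub>Uaff n q\<^esub> quot_class n q g"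
proof -
  interpret ring "Uaff n q" by (rule Uaff_ring)
  have "quot_class n q (f - g) \<oplus>\<^bsub>Uaff n q\<^esub> quot_class n q g = quot_class n q f"
    using quot_class_simps(1)[of "f - g" n g q] assms by (simp add: free_algebra_closed)
  then show ?thesis
    using assms by (metis add.inv_solve_right' free_algebra_closed(8) minus_eq quot_class_closed)
qed

lemma quot_class_eqI:
  assumes "f - g \<in> relators n q" "f \<in> carrier (free_algebra (gens n))" "g \<in> carrier (free_algebra (gens n))"
  shows "quot_class n q f = quot_class n q g"
proof -
  have r: "f - g \<in> carrier (free_algebra (gens n))" "f - g \<in> rel_ideal n q"
    using assms(1) relators_in_rel_ideal[of n q] relators_carrier[of n q] by blast+
  have "quot_class n q f = quot_class n q (f - g) \<oplus>\<^bsub>Uaff n q\<^esub> quot_class n q g"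
    using quot_class_simps(1)[OF r(1) assms(3)] by simp
  also have "\<dots> = quot_class n q g"
    using assms(3) by (simp add: quot_class_rel[OF r(2)] quot_class_closed Uaff_simprules)
  finally show ?thesis .
qed

lemma Uaff_relations:
  assumes "i \<le> n" "j \<le> n"
  shows "Bg n q j \<otimes>\<^bsub>Uaff n q\<^esub> Kg n q i = Kg n q i \<otimes>\<^bsub>Uaff n q\<^esub> Bg n q j"
    "Kg n q j \<otimes>\<^bsub>Uaff n q\<^esub> Kg n q i = Kg n q i \<otimes>\<^bsub>Uaff n q\<^esub> Kg n q j"
    "cartan n i j = 0 \<Longrightarrow> Bg n q i \<otimes>\<^bsub>Uaff n q\<^esub> Bg n q j = Bg n q j \<otimes>\<^bsub>Uaff n q\<^esub> Bg n q i"
    "cartan n i j = -1 \<Longrightarrow>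
       (Bg n q i \<otimes>\<^bsub>Uaff n q\<^esub> Bg n q i \<otimes>\<^bsub>Uaff n q\<^esub> Bg n q j
        \<ominus>\<^bsub>Uaff n q\<^esub> smul n q (qnum q 2) (Bg n q i \<otimes>\<^bsub>Uaff n q\<^esub> Bg n q j \<otimes>\<^bsub>Uaff n q\<^esub> Bg n q i))
       \<oplus>\<^bsub>Uaff n q\<^esub> Bg n q j \<otimes>\<^bsub>Uaff n q\<^esub> Bg n q i \<otimes>\<^bsub>Uaff n q\<^esub> Bg n q i
       = smul n q (- inverse q) (Kg n q i \<otimes>\<^bsub>Uaff n q\<^esub> Bg n q j)"
proof -
  note simps = Bg_def Kg_def quot_class_simps[symmetric] quot_class_minus[symmetric]
    smul_quot_class free_algebra_closed gens_iff
  have K: "quot_class n q (fgen (GK i) * fgen g) = quot_class n q (fgen g * fgen (GK i))"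
    if "g \<in> gens n" for g
    using assms that by (intro quot_class_eqI) (auto simp: relators_def gens_iff free_algebra_closed)
  show "Bg n q j \<otimes>\<^bsub>Uaff n q\<^esub> Kg n q i = Kg n q i \<otimes>\<^bsub>Uaff n q\<^esub> Bg n q j"
    "Kg n q j \<otimes>\<^bsub>Uaff n q\<^esub> Kg n q i = Kg n q i \<otimes>\<^bsub>Uaff n q\<^esub> Kg n q j"
    using assms by (simp_all add: simps K[of "GB j", symmetric] K[of "GK j", symmetric])
  show "cartan n i j = 0 \<Longrightarrow> Bg n q i \<otimes>\<^bsub>Uaff n q\<^esub> Bg n q j = Bg n q j \<otimes>\<^bsub>Uaff n q\<^esub> Bg n q i"
    using assms by (simp add: simps) (intro quot_class_eqI, auto simp: relators_def gens_iff free_algebra_closed)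
  assume "cartan n i j = -1"
  then have r: "fgen (GB i) ^ 2 * fgen (GB j)
        - fconst (qnum q 2) * fgen (GB i) * fgen (GB j) * fgen (GB i)
        + fgen (GB j) * fgen (GB i) ^ 2
        - fconst (- inverse q) * fgen (GK i) * fgen (GB j) \<in> relators n q"
    using assms unfolding relators_def by blast
  have "quot_class n q (fgen (GB i) * fgen (GB i) * fgen (GB j)
        - fconst (qnum q 2) * (fgen (GB i) * fgen (GB j) * fgen (GB i))
        + fgen (GB j) * fgen (GB i) * fgen (GB i))
      = quot_class n q (fconst (- inverse q) * (fgen (GK i) * fgen (GB j)))"
    using r assms
    by (intro quot_class_eqI) (auto simp: mult.assoc power2_eq_square gens_iff free_algebra_closed)
  then show "(Bg n q i \<otimes>\<^bsub>Uaff n q\<^esub> Bg n q i \<otimes>\<^bsub>Uaff n q\<^esub> Bg n q j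
        \<ominus>\<^bsub>Uaff n q\<^esub> smul n q (qnum q 2) (Bg n q i \<otimes>\<^bsub>Uaff n q\<^esub> Bg n q j \<otimes>\<^bsub>Uaff n q\<^esub> Bg n q i))
       \<oplus>\<^bsub>Uaff n q\<^esub> Bg n q j \<otimes>\<^bsub>Uaff n q\<^esub> Bg n q i \<otimes>\<^bsub>Uaff n q\<^esub> Bg n q i
       = smul n q (- inverse q) (Kg n q i \<otimes>\<^bsub>Uaff n q\<^esub> Bg n q j)"
    using assms by (simp add: simps)
qed

text \<open>
  The generators of \<open>Uaff n q\<close>, extended to all other parameters by the trivial family \<open>b = 0\<close>,
  \<open>k = 1\<close>. That family satisfies the relations as well, so they hold in the product (see
  \<open>iquantum_rels_generators\<close>).
\<close>

definition uB :: "nat \<Rightarrow> complex \<Rightarrow> nat \<Rightarrow> Uprod" where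
  "uB n q j = Uprod (\<lambda>n' q'. if n' = n \<and> q' = q \<and> j \<le> n then Bg n q j else \<zero>\<^bsub>Uaff n' q'\<^esub>)"

definition uK :: "nat \<Rightarrow> complex \<Rightarrow> nat \<Rightarrow> Uprod" where
  "uK n q j = Uprod (\<lambda>n' q'. if n' = n \<and> q' = q \<and> j \<le> n then Kg n q j else \<one>\<^bsub>Uaff n' q'\<^esub>)"

definition uKi :: "nat \<Rightarrow> complex \<Rightarrow> nat \<Rightarrow> Uprod" where
  "uKi n q j = Uprod (\<lambda>n' q'. if n' = n \<and> q' = q \<and> j \<le> n then inv\<^bsub>Uaff n q\<^esub> Kg n q j else \<one>\<^bsub>Uaff n' q'\<^esub>)"

lemma inv_Kg_closed: "i \<le> n \<Longrightarrow> inv\<^bsub>Uaff n q\<^esub> Kg n q i \<in> carrier (Uaff n q)"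
  by (simp add: Kg_inverse(3) quot_class_closed free_algebra_closed gens_iff)

lemma component_generators:
  "component (uB n q j) n' q' = (if n' = n \<and> q' = q \<and> j \<le> n then Bg n q j else \<zero>\<^bsub>Uaff n' q'\<^esub>)"
  "component (uK n q j) n' q' = (if n' = n \<and> q' = q \<and> j \<le> n then Kg n q j else \<one>\<^bsub>Uaff n' q'\<^esub>)"
  "component (uKi n q j) n' q' = (if n' = n \<and> q' = q \<and> j \<le> n then inv\<^bsub>Uaff n q\<^esub> Kg n q j else \<one>\<^bsub>Uaff n' q'\<^esub>)"
  unfolding uB_def uK_def uKi_def
  by (subst component_Uprod; simp add: Uaff_closed inv_Kg_closed Uaff_simprules)+

lemma smul_zero: "smul n q c \<zero>\<^bsub>Uaff n q\<^esub> = \<zero>\<^bsub>Uaff n q\<^esub>"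
  by (simp add: smul_def Uaff_closed Uaff_simprules)

lemma iquantum_rels_generators: "iquantum_rels n q (uB n q) (uK n q) (uKi n q)"
proof -
  have eqI: "x = y" if "component x n q = component y n q"
    "\<And>n' q'. n' \<noteq> n \<or> q' \<noteq> q \<Longrightarrow> component x n' q' = component y n' q'" for x y
    using that by (metis Uprod_eqI)
  have off: "component (uB n q j) n' q' = \<zero>\<^bsub>Uaff n' q'\<^esub>" "component (uK n q j) n' q' = \<one>\<^bsub>Uaff n' q'\<^esub>"
    "component (uKi n q j) n' q' = \<one>\<^bsub>Uaff n' q'\<^esub>" if "n' \<noteq> n \<or> q' \<noteq> q" for j n' q'
    using that by (auto simp: component_generators)
  note off = component_simps Uaff_closed Uaff_simprules smul_zero off
  have on: "component (uB n q j) n q = Bg n q j" "component (uK n q j) n q = Kg n q j"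
    "component (uKi n q j) n q = inv\<^bsub>Uaff n q\<^esub> Kg n q j" if "j \<le> n" for j
    using that by (auto simp: component_generators)
  have 1: "uK n q i * uKi n q i = 1" "uKi n q i * uK n q i = 1" if "i \<le> n" for i
    by (rule eqI; simp add: component_simps on Kg_inverse that off)+
  have 2: "uB n q j * uK n q i = uK n q i * uB n q j" "uK n q j * uK n q i = uK n q i * uK n q j"
    if "i \<le> n" "j \<le> n" for i j
    using Uaff_relations(1,2)[OF that, of q] that by - (rule eqI; simp add: component_simps on; simp add: off)+
  have 3: "uB n q i * uB n q j = uB n q j * uB n q i" if "i \<le> n" "j \<le> n" "cartan n i j = 0" for i j
    using Uaff_relations(3)[OF that, of q] that by - (rule eqI; simp add: component_simps on; simp add: off)
  have 4: "qserre q (uK n q i) (uB n q i) (uB n q j)" if ij: "i \<le> n" "j \<le> n" "cartan n i j = -1" for i j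
    unfolding qserre_def
  proof (rule eqI)
    show "component (uB n q i * uB n q i * uB n q j - qnum q 2 *\<^sub>C (uB n q i * uB n q j * uB n q i)
        + uB n q j * uB n q i * uB n q i) n q = component ((- inverse q) *\<^sub>C (uK n q i * uB n q j)) n q"
      using Uaff_relations(4)[OF ij, of q] by (simp only: component_simps on ij)
  qed (simp add: off)
  show ?thesis
    unfolding iquantum_rels_def by (intro conjI allI impI 1 2 3 4)
qed

text \<open>
  Evaluation on the product algebra through the component \<open>(n, q)\<close>. It is a total function on a type
  and commutes with all formulas built from the algebra operations, such as \<open>qbr\<close>, \<open>chain\<close>, \<open>braidB\<close>
  and \<open>evalB\<close>; a composite of two homomorphisms is computed by substituting one family into the
  formulas of the other.
\<close>

definition Uprod_eval :: "nat \<Rightarrow> complex \<Rightarrow> (nat \<Rightarrow> 'a :: complex_algebra) \<Rightarrow> (nat \<Rightarrow> 'a) \<Rightarrow> (nat \<Rightarrow> 'a) \<Rightarrow> Uprod \<Rightarrow> 'a" where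
  "Uprod_eval n q b k ki u = Uaff_eval n q b k ki (component u n q)"

lemma Uprod_eval_simps:
  assumes R: "iquantum_rels n q b k ki"
  shows "Uprod_eval n q b k ki (u + v) = Uprod_eval n q b k ki u + Uprod_eval n q b k ki v"
    "Uprod_eval n q b k ki (u * v) = Uprod_eval n q b k ki u * Uprod_eval n q b k ki v"
    "Uprod_eval n q b k ki 1 = 1" "Uprod_eval n q b k ki (c *\<^sub>C u) = c *\<^sub>C Uprod_eval n q b k ki u"
    "i \<le> n \<Longrightarrow> Uprod_eval n q b k ki (uB n q i) = b i" "i \<le> n \<Longrightarrow> Uprod_eval n q b k ki (uK n q i) = k i"
    "i \<le> n \<Longrightarrow> Uprod_eval n q b k ki (uKi n q i) = ki i"
  by (simp_all add: Uprod_eval_def component_simps component_generators Uaff_eval_simps[OF R])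

lemma Uprod_eval_minus:
  assumes R: "iquantum_rels n q b k ki"
  shows "Uprod_eval n q b k ki (u - v) = Uprod_eval n q b k ki u - Uprod_eval n q b k ki v"
  using Uprod_eval_simps(1)[OF R, of "u - v" v] by simp

lemma Uprod_eval_qbr:
  assumes R: "iquantum_rels n q b k ki"
  shows "Uprod_eval n q b k ki (qbr c u v) = qbr c (Uprod_eval n q b k ki u) (Uprod_eval n q b k ki v)"
  by (simp add: qbr_def Uprod_eval_minus[OF R] Uprod_eval_simps[OF R])

lemma Uprod_eval_chain:
  assumes R: "iquantum_rels n q b k ki" and "l + m \<le> n"
  shows "Uprod_eval n q b k ki (chain c (uB n q) l m) = chain c b l m"
  using assms(2) by (induction m arbitrary: l) (simp_all add: Uprod_eval_simps[OF R] Uprod_eval_qbr[OF R])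

lemma Uprod_eval_kchain:
  assumes R: "iquantum_rels n q b k ki" and "l + m \<le> n"
  shows "Uprod_eval n q b k ki (kchain (uK n q) l m) = kchain k l m"
    "Uprod_eval n q b k ki (kchain (uKi n q) l m) = kchain ki l m"
  using assms(2) by (induction m arbitrary: l) (simp_all add: Uprod_eval_simps[OF R])

definition endo :: "nat \<Rightarrow> complex \<Rightarrow> (nat \<Rightarrow> Uprod) \<Rightarrow> (nat \<Rightarrow> Uprod) \<Rightarrow> (nat \<Rightarrow> Uprod)
    \<Rightarrow> gen free_alg set \<Rightarrow> gen free_alg set" where
  "endo n q b k ki = (\<lambda>x\<in>carrier (Uaff n q). component (Uaff_eval n q b k ki x) n q)"

lemma endo_component: "endo n q b k ki (component u n q) = component (Uprod_eval n q b k ki u) n q"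
  by (simp add: endo_def Uprod_eval_def)

lemma endo_generators:
  assumes R: "iquantum_rels n q b k ki" and i: "i \<le> n"
  shows "endo n q b k ki (Bg n q i) = component (b i) n q"
    "endo n q b k ki (Kg n q i) = component (k i) n q"
    "endo n q b k ki (inv\<^bsub>Uaff n q\<^esub> Kg n q i) = component (ki i) n q"
  using i by (simp_all add: endo_def Uaff_closed inv_Kg_closed Uaff_eval_simps[OF R])

lemma endo_hom:
  assumes R: "iquantum_rels n q b k ki"
  shows "endo n q b k ki \<in> alg_hom (scal n q) (Uaff n q) (Uaff n q)"
  unfolding alg_hom_def
  by (auto intro!: ring_hom_memI
      simp: endo_def Uaff_eval_simps[OF R] component_simps Uaff_simprules Uaff_closed simp flip: scal_eq_smul)

section \<open>Automorphisms and central monomials\<close>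

lemma alg_homD:
  assumes "f \<in> alg_hom (scal n q) (Uaff n q) (Uaff n q)"
  shows "x \<in> carrier (Uaff n q) \<Longrightarrow> f x \<in> carrier (Uaff n q)"
    "x \<in> carrier (Uaff n q) \<Longrightarrow> y \<in> carrier (Uaff n q) \<Longrightarrow>
      f (x \<oplus>\<^bsub>Uaff n q\<^esub> y) = f x \<oplus>\<^bsub>Uaff n q\<^esub> f y"
    "x \<in> carrier (Uaff n q) \<Longrightarrow> y \<in> carrier (Uaff n q) \<Longrightarrow>
      f (x \<otimes>\<^bsub>Uaff n q\<^esub> y) = f x \<otimes>\<^bsub>Uaff n q\<^esub> f y"
    "f \<one>\<^bsub>Uaff n q\<^esub> = \<one>\<^bsub>Uaff n q\<^esub>" "f (scal n q c) = scal n q c"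
  using assms by (auto simp: alg_hom_def ring_hom_def)

lemma alg_hom_compose:
  assumes "f \<in> alg_hom (scal n q) (Uaff n q) (Uaff n q)" "g \<in> alg_hom (scal n q) (Uaff n q) (Uaff n q)"
  shows "f \<circ> g \<in> alg_hom (scal n q) (Uaff n q) (Uaff n q)"
  using assms by (auto simp: alg_hom_def intro: ring_hom_trans)

lemma alg_hom_id: "id \<in> alg_hom (scal n q) (Uaff n q) (Uaff n q)"
  by (auto simp: alg_hom_def ring_hom_def)

lemma alg_hom_inv_Kg:
  assumes f: "f \<in> alg_hom (scal n q) (Uaff n q) (Uaff n q)" and i: "i \<le> n"
  shows "f (inv\<^bsub>Uaff n q\<^esub> Kg n q i) = inv\<^bsub>Uaff n q\<^esub> (f (Kg n q i))"
proof -
  interpret ring "Uaff n q" by (rule Uaff_ring)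
  note c = alg_homD[OF f]
  have "f (Kg n q i) \<otimes>\<^bsub>Uaff n q\<^esub> f (inv\<^bsub>Uaff n q\<^esub> Kg n q i) = \<one>\<^bsub>Uaff n q\<^esub>"
    "f (inv\<^bsub>Uaff n q\<^esub> Kg n q i) \<otimes>\<^bsub>Uaff n q\<^esub> f (Kg n q i) = \<one>\<^bsub>Uaff n q\<^esub>"
    using c(3)[OF Uaff_closed(3)[OF i] inv_Kg_closed[OF i]] c(3)[OF inv_Kg_closed[OF i] Uaff_closed(3)[OF i]]
      Kg_inverse(1,2)[OF i, folded Kg_inverse(3)[OF i]] c(4) by metis+
  then show ?thesis
    using i by (intro inv_char[symmetric] c Uaff_closed inv_Kg_closed) auto
qed

lemma alg_hom_eqI:
  assumes f: "f \<in> alg_hom (scal n q) (Uaff n q) (Uaff n q)" and g: "g \<in> alg_hom (scal n q) (Uaff n q) (Uaff n q)"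
    and B: "\<And>i. i \<le> n \<Longrightarrow> f (Bg n q i) = g (Bg n q i)"
    and K: "\<And>i. i \<le> n \<Longrightarrow> f (Kg n q i) = g (Kg n q i)"
    and x: "x \<in> carrier (Uaff n q)"
  shows "f x = g x"
  using x by (induction rule: Uaff_induct)
    (simp_all add: alg_homD[OF f] alg_homD[OF g] B K alg_hom_inv_Kg[OF f] alg_hom_inv_Kg[OF g])

lemma endo_aut:
  assumes R: "iquantum_rels n q b k ki" and R': "iquantum_rels n q b' k' ki'"
    and "\<And>i. i \<le> n \<Longrightarrow> Uprod_eval n q b k ki (b' i) = uB n q i" "\<And>i. i \<le> n \<Longrightarrow> Uprod_eval n q b k ki (k' i) = uK n q i"
    and "\<And>i. i \<le> n \<Longrightarrow> Uprod_eval n q b' k' ki' (b i) = uB n q i" "\<And>i. i \<le> n \<Longrightarrow> Uprod_eval n q b' k' ki' (k i) = uK n q i"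
  shows "endo n q b k ki \<in> alg_aut (scal n q) (Uaff n q)"
proof -
  let ?f = "endo n q b k ki" and ?g = "endo n q b' k' ki'"
  note f = endo_hom[OF R] and g = endo_hom[OF R']
  have 1: "(?f \<circ> ?g) x = id x" if "x \<in> carrier (Uaff n q)" for x
    by (rule alg_hom_eqI[OF alg_hom_compose[OF f g] alg_hom_id _ _ that])
      (simp_all add: endo_generators[OF R'] endo_component assms(3,4) component_generators)
  have 2: "(?g \<circ> ?f) x = id x" if "x \<in> carrier (Uaff n q)" for x
    by (rule alg_hom_eqI[OF alg_hom_compose[OF g f] alg_hom_id _ _ that])
      (simp_all add: endo_generators[OF R] endo_component assms(5,6) component_generators)
  have "bij_betw ?f (carrier (Uaff n q)) (carrier (Uaff n q))"
    using 1 2 alg_homD(1)[OF f] alg_homD(1)[OF g]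
    by (intro bij_betw_byWitness[where f' = ?g]) auto
  then show ?thesis
    using f by (simp add: alg_aut_def alg_hom_def ring_iso_def)
qed

text \<open>
  Integer powers of a unit \<open>x\<close> with given inverse \<open>y\<close>.
\<close>

definition zpow :: "'a :: monoid_mult \<Rightarrow> 'a \<Rightarrow> int \<Rightarrow> 'a" where
  "zpow x y d = (if d < 0 then y ^ nat (- d) else x ^ nat d)"

lemma zpow_simps [simp]: "zpow x y 0 = 1" "zpow x y 1 = x" "zpow x y (int m) = x ^ m"
  by (simp_all add: zpow_def)

lemma zpow_minus: "zpow y x d = zpow x y (- d)"
  by (simp add: zpow_def)

lemma power_inverse:
  assumes "x * y = (1 :: 'a :: monoid_mult)"
  shows "x ^ m * y ^ m = 1"
proof (induction m)
  case (Suc m)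
  have "x ^ Suc m * y ^ Suc m = x ^ m * (x * y) * y ^ m"
    by (simp only: power_Suc2 power_Suc[of y] mult.assoc power_Suc power_commutes)
      (simp add: power_commutes flip: mult.assoc)
  then show ?case using Suc assms by simp
qed simp

lemma zpow_add_one:
  assumes "y * x = (1 :: 'a :: monoid_mult)"
  shows "zpow x y (d + 1) = zpow x y d * x"
proof (cases "d < 0")
  case True
  then obtain m where d: "d = - int (Suc m)" by (metis negD)
  have "zpow x y d = y ^ Suc m" by (simp only: zpow_def d minus_minus nat_int) simp
  then have "zpow x y d * x = y ^ m * (y * x)" by (simp only: power_Suc2 mult.assoc)
  then show ?thesis using assms by (simp add: zpow_def d)
next
  case False
  then show ?thesis by (simp add: zpow_def nat_add_distrib power_commutes)
qed

lemma zpow_add: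
  assumes "y * x = (1 :: 'a :: monoid_mult)" "x * y = 1"
  shows "zpow x y (c + d) = zpow x y c * zpow x y d"
proof (induction d rule: int_induct[where k = 0])
  case (step1 d)
  have "zpow x y (c + (d + 1)) = zpow x y (c + d) * x"
    using zpow_add_one[OF assms(1), of "c + d"] by (simp add: add.assoc)
  then show ?case
    using step1 by (simp add: zpow_add_one[OF assms(1), of d] mult.assoc)
next
  case (step2 d)
  have *: "zpow x y (e - 1) = zpow x y e * y" for e
    using zpow_add_one[OF assms(1), of "e - 1"] assms(2) by (simp add: mult.assoc)
  show ?case
    using step2 *[of "c + d"] *[of d] by (simp add: mult.assoc add_diff_eq)
qed simp

lemma zpow_commute:
  assumes "z * x = x * z" "z * y = y * (z :: 'a :: monoid_mult)"
  shows "z * zpow x y d = zpow x y d * z"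
proof -
  have "z * w ^ m = w ^ m * z" if "z * w = w * z" for w m
    using that by (induction m) (simp_all add: mult.assoc, metis mult.assoc)
  then show ?thesis using assms by (simp add: zpow_def)
qed

lemma zpow_mult:
  assumes "y * x = 1" "x * y = 1" "y' * x' = 1" "x' * y' = 1"
    and "x * x' = x' * x" "x * y' = y' * x" "y * x' = x' * y" "y * y' = y' * (y :: 'a :: monoid_mult)"
  shows "zpow (x * x') (y * y') d = zpow x y d * zpow x' y' d"
proof -
  have "(a * b) ^ m = a ^ m * b ^ m" if "a * b = b * a" for a b :: 'a and m
  proof (induction m)
    case (Suc m)
    have "b * a ^ m = a ^ m * b"
      using power_commuting_commutes[OF that] by simp
    then have "b * (a ^ m * w) = a ^ m * (b * w)" for w
      by (rule comm_rewrite)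
    then show ?case using Suc by (simp add: mult.assoc)
  qed simp
  then show ?thesis using assms by (simp add: zpow_def)
qed

definition kmon :: "nat \<Rightarrow> (nat \<Rightarrow> 'a :: monoid_mult) \<Rightarrow> (nat \<Rightarrow> 'a) \<Rightarrow> (nat \<Rightarrow> int) \<Rightarrow> 'a" where
  "kmon n k ki d = prod_list (map (\<lambda>j. zpow (k j) (ki j) (d j)) [0..<n + 1])"

lemma component_prod_list:
  "component (prod_list us) n q = prod_of (Uaff n q) (map (\<lambda>u. component u n q) us)"
  by (induction us) (simp_all add: prod_of_def component_simps)

lemma component_power: "component (u ^ m) n q = component u n q [^]\<^bsub>Uaff n q\<^esub> m"
proof -
  interpret ring "Uaff n q" by (rule Uaff_ring)
  show ?thesis by (induction m) (simp_all add: component_simps power_Suc2 del: power_Suc)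
qed

lemma component_zpow:
  assumes i: "i \<le> n"
  shows "component (zpow (uK n q i) (uKi n q i) d) n q = Kg n q i [^]\<^bsub>Uaff n q\<^esub> d"
proof -
  interpret ring "Uaff n q" by (rule Uaff_ring)
  note D = iquantum_relsD(1,2)[OF iquantum_rels_generators i]
  have "inv\<^bsub>Uaff n q\<^esub> (component (uK n q i ^ m) n q) = component (uKi n q i ^ m) n q" for m
    by (rule inv_char) (simp_all add: power_inverse[OF D(1)] power_inverse[OF D(2)] flip: component_simps(2,4))
  moreover have "Kg n q i [^]\<^bsub>Uaff n q\<^esub> m = component (uK n q i ^ m) n q" for m :: nat
    using i by (simp add: component_power component_generators)
  ultimately show ?thesis
    using i by (simp add: zpow_def int_pow_def2)
qed

lemma Kmon_eq: "Kmon n q d = component (kmon n (uK n q) (uKi n q) d) n q"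
  unfolding Kmon_def kmon_def component_prod_list
  by (auto simp: component_zpow simp del: upt_Suc intro!: arg_cong[of _ _ "prod_of (Uaff n q)"])

lemma Uprod_eval_kmon:
  assumes R: "iquantum_rels n q b k ki"
  shows "Uprod_eval n q b k ki (kmon n (uK n q) (uKi n q) d) = kmon n k ki d"
proof -
  have pow: "Uprod_eval n q b k ki (u ^ m) = Uprod_eval n q b k ki u ^ m" for u m
    by (induction m) (simp_all add: Uprod_eval_simps[OF R])
  have prod: "Uprod_eval n q b k ki (prod_list us) = prod_list (map (Uprod_eval n q b k ki) us)" for us
    by (induction us) (simp_all add: Uprod_eval_simps[OF R])
  show ?thesis
    unfolding kmon_def prod
    by (auto simp: zpow_def pow Uprod_eval_simps[OF R] simp del: upt_Suc intro!: arg_cong[of _ _ prod_list])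
qed

text \<open>
  On monomials in the central elements \<open>T\<^sub>i\<close> acts by the simple reflection. Every factor splits into the
  factor with the exponent at \<open>i\<close> removed and a power of \<open>k\<^sub>i\<close>; the powers of \<open>k\<^sub>i\<close> collected over all
  nodes make up the new exponent \<open>d\<^sub>i - \<Sum> a\<^sub>i\<^sub>j d\<^sub>j\<close>.
\<close>

lemma kmon_braid:
  fixes k ki :: "nat \<Rightarrow> 'a :: complex_algebra"
  assumes R: "iquantum_rels n q b k ki" and i: "i \<le> n"
  shows "kmon n (braidK n i k ki) (braidK n i ki k) d = kmon n k ki (root_refl n i d)"
proof -
  define z where "z j e = zpow (k j) (ki j) e" for j e
  define P where "P d m = prod_list (map (\<lambda>j. z j (d j)) [0..<m])" for d :: "nat \<Rightarrow> int" and m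
  define c where "c j = (if j = i then - d i else if cartan n i j = 0 then 0 else d j)" for j
  note D = iquantum_relsD[OF R]
  have z_add: "z j (e + e') = z j e * z j e'" if "j \<le> n" for j e e'
    unfolding z_def using that by (intro zpow_add D)
  have z_comm: "z j e * z l e' = z l e' * z j e" if "j \<le> n" "l \<le> n" for j l e e'
    unfolding z_def using that by (intro zpow_commute sym[OF zpow_commute] D sym[OF D(7)])
  have zP: "z l e * P d m = P d m * z l e" if "l \<le> n" "m \<le> n + 1" for l e d m
    using that(2)
  proof (induction m)
    case (Suc m)
    have P: "P d (Suc m) = P d m * z m (d m)" by (simp add: P_def)
    have "z l e * P d (Suc m) = P d m * (z l e * z m (d m))"
      using Suc by (simp add: P flip: mult.assoc)
    also have "z l e * z m (d m) = z m (d m) * z l e"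
      using Suc.prems that(1) by (intro z_comm) auto
    finally show ?case by (simp add: P mult.assoc)
  qed (simp add: P_def)
  have step: "zpow (braidK n i k ki j) (braidK n i ki k j) (d j) = z j ((d(i := 0)) j) * z i (c j)"
    if "j \<le> n" for j
  proof -
    have "zpow (k j * k i) (ki j * ki i) (d j) = z j (d j) * z i (d j)"
      unfolding z_def using that i by (intro zpow_mult D sym[OF D(7)])
    then show ?thesis
      using zpow_minus[of "ki i" "k i" "d i"] by (simp add: braidK_def z_def c_def)
  qed
  have "prod_list (map (\<lambda>j. zpow (braidK n i k ki j) (braidK n i ki k j) (d j)) [0..<m])
      = P (d(i := 0)) m * z i (\<Sum>j<m. c j)" if "m \<le> n + 1" for m
    using that
  proof (induction m)
    case 0
    then show ?case by (simp add: P_def z_def)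
  next
    case (Suc m)
    have "z i (\<Sum>j<m. c j) * z m ((d(i := 0)) m) = z m ((d(i := 0)) m) * z i (\<Sum>j<m. c j)"
      using Suc.prems i by (intro z_comm) auto
    then have c: "z i (\<Sum>j<m. c j) * (z m ((d(i := 0)) m) * w) = z m ((d(i := 0)) m) * (z i (\<Sum>j<m. c j) * w)" for w
      by (rule comm_rewrite)
    have P: "P (d(i := 0)) (Suc m) = P (d(i := 0)) m * z m ((d(i := 0)) m)" by (simp add: P_def)
    have "prod_list (map (\<lambda>j. zpow (braidK n i k ki j) (braidK n i ki k j) (d j)) [0..<Suc m])
        = P (d(i := 0)) m * z i (\<Sum>j<m. c j) * (z m ((d(i := 0)) m) * z i (c m))"
      using Suc step[of m] by (simp del: fun_upd_apply)
    also have "\<dots> = P (d(i := 0)) (Suc m) * z i (\<Sum>j<Suc m. c j)"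
      by (simp only: P sum.lessThan_Suc z_add[OF i] mult.assoc c)
    finally show ?case .
  qed
  from this[of "n + 1"]
  have 1: "kmon n (braidK n i k ki) (braidK n i ki k) d = P (d(i := 0)) (n + 1) * z i (\<Sum>j<n+1. c j)"
    by (simp add: kmon_def)
  have 2: "P (d(i := e)) m = P (d(i := 0)) m * z i (if i < m then e else 0)" if "m \<le> n + 1" for e m
    using that
  proof (induction m)
    case 0
    then show ?case by (simp add: P_def z_def)
  next
    case (Suc m)
    have "z i e * z m (d m) = z m (d m) * z i e"
      using Suc.prems i by (intro z_comm) auto
    then show ?case
      using Suc by (auto simp: P_def z_def mult.assoc less_Suc_eq)
  qed
  have cx: "c x = (if x = i then d i else 0) - cartan n i x * d x" for x
    using cartan_cases[of i x n] by (auto simp: c_def)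
  have "{..<n+1} = {0..n}" by auto
  moreover have "(\<Sum>j=0..n. c j) = (\<Sum>j=0..n. (if j = i then d i else 0) - cartan n i j * d j)"
    by (intro sum.cong refl cx)
  ultimately have "(\<Sum>j<n+1. c j) = d i - (\<Sum>j=0..n. cartan n i j * d j)"
    using i by (simp add: sum_subtractf)
  then show ?thesis
    unfolding 1 using 2[of "n + 1" "d i - (\<Sum>j=0..n. cartan n i j * d j)"] i
    by (simp add: kmon_def root_refl_def P_def z_def)
qed

section \<open>The braid operators on the affine algebra\<close>

context iquantum_family
begin

text \<open>
  These two identities say that \<open>T\<^sub>i\<close> and its proposed inverse undo each other on a neighbour of \<open>i\<close>.
  Both are the Serre relation, read as \<open>[b\<^sub>i, [b\<^sub>j, b\<^sub>i]\<^sub>q]\<^sub>q = k\<^sub>i b\<^sub>j = [[b\<^sub>i, b\<^sub>j]\<^sub>q, b\<^sub>i]\<^sub>q\<close>.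
\<close>

lemma qbr_cancel_left:
  assumes "i \<le> n" "j \<le> n" "cartan n i j = -1"
  shows "qbr q (ki i * b i) (qbr q (b j) (b i)) = b j"
proof -
  have "qbr q (b i) (qbr q (b j) (b i)) = k i * b j"
    using qserre_right(2)[OF iquantum_relsD(10)[OF rels assms]]
    by (simp add: qbr_def[of q "b i" "qbr q (b j) (b i)"])
  moreover have "qbr q (ki i * b i) (1 * qbr q (b j) (b i)) = ki i * (1 * qbr q (b i) (qbr q (b j) (b i)))"
    using central(3)[of _ i] assms(1,2)
    by (intro qbr_scaled) (auto simp: qbr_def algebra_simps central(3)[THEN comm_rewrite])
  ultimately show ?thesis
    using units(2)[OF assms(1)] by (simp flip: mult.assoc)
qed

lemma qbr_cancel_right:
  assumes "i \<le> n" "j \<le> n" "cartan n i j = -1"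
  shows "qbr q (qbr q (b i) (b j)) (ki i * b i) = b j"
proof -
  have "qbr q (qbr q (b i) (b j)) (b i) = k i * b j"
    using qserre_left(2)[OF iquantum_relsD(10)[OF rels assms]]
    by (simp add: qbr_def[of q "qbr q (b i) (b j)" "b i"])
  moreover have "qbr q (1 * qbr q (b i) (b j)) (ki i * b i) = 1 * (ki i * qbr q (qbr q (b i) (b j)) (b i))"
    using central(3)[of _ i] assms(1,2)
    by (intro qbr_scaled) (auto simp: qbr_def algebra_simps central(3)[THEN comm_rewrite])
  ultimately show ?thesis
    using units(2)[OF assms(1)] by (simp flip: mult.assoc)
qed

lemma braid_inverse:
  assumes "i \<le> n" "j \<le> n"
  shows "braidB_inv n q i (braidB n q i b ki) (braidK n i ki k) j = b j"
    "braidB n q i (braidB_inv n q i b ki) (braidK n i ki k) j = b j"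
    "braidK n i (braidK n i k ki) (braidK n i ki k) j = k j"
  using assms units(1)[OF assms(1)] cartan_cases[of i j n] qbr_cancel_left qbr_cancel_right
  by (auto simp: braidB_def braidB_inv_def braidK_def mult.assoc) (auto simp flip: mult.assoc)

end

definition rot :: "nat \<Rightarrow> nat \<Rightarrow> nat \<Rightarrow> nat" where
  "rot n r j = (j + r) mod (n + 1)"

lemma rot_le: "rot n r j \<le> n"
  by (simp add: rot_def less_Suc_eq_le[symmetric])

lemma rot_rot: "rot n r (rot n s j) = rot n (r + s) j"
  by (simp only: rot_def mod_add_left_eq) (simp only: ac_simps)

lemma rot_multiple:
  assumes "j \<le> n" "(n + 1) dvd r"
  shows "rot n r j = j"
proof -
  obtain c where "r = (n + 1) * c" using assms(2) by (elim dvdE)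
  then have "rot n r j = j mod (n + 1)" by (simp only: rot_def mod_mult_self2)
  then show ?thesis using assms(1) by simp
qed

lemma rot_full: "j \<le> n \<Longrightarrow> rot n (Suc n) j = j" "j \<le> n \<Longrightarrow> rot n 0 j = j"
  by (simp_all add: rot_multiple)

lemma rot_inj:
  assumes "i \<le> n" "j \<le> n" shows "rot n r i = rot n r j \<longleftrightarrow> i = j"
proof -
  \<comment> \<open>Rotation by \<open>n r\<close> undoes rotation by \<open>r\<close>, since \<open>n r + r\<close> is a multiple of \<open>n + 1\<close>.\<close>
  have "rot n (n * r) (rot n r i) = i" if "i \<le> n" for i
    using that by (simp only: rot_rot) (rule rot_multiple, auto simp: algebra_simps intro: dvdI[of _ _ r])
  then show ?thesis using assms by metis
qed

lemma cartan_rot: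
  assumes "i \<le> n" "j \<le> n"
  shows "cartan n (rot n r i) (rot n r j) = cartan n i j"
proof -
  have c: "cartan n i j = (if i = j then 2 else if j = rot n 1 i \<or> i = rot n 1 j then -1 else 0)" for i j
    by (simp add: cartan_def rot_def)
  have s: "rot n 1 (rot n r i) = rot n r (rot n 1 i)" for i
    by (simp add: rot_rot add.commute)
  show ?thesis
    unfolding c[of "rot n r i"] c[of i] s
    using rot_inj[OF assms, of r] rot_inj[OF assms(2) rot_le, of r 1 i] rot_inj[OF assms(1) rot_le, of r 1 j]
    by argo
qed

lemma iquantum_rels_rot:
  assumes "iquantum_rels n q b k ki"
  shows "iquantum_rels n q (b \<circ> rot n r) (k \<circ> rot n r) (ki \<circ> rot n r)"
proof -
  note D = iquantum_relsD[OF assms rot_le]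
  have c: "cartan n (rot n r i) (rot n r j) = e" if "cartan n i j = e" "i \<le> n" "j \<le> n" for i j e
    using that by (simp add: cartan_rot)
  show ?thesis
    unfolding iquantum_rels_def o_apply
    by (intro conjI allI impI D rot_le c)
qed

lemma kmon_unit:
  assumes "j \<le> n"
  shows "kmon n k ki (\<lambda>l. if l = j then 1 else 0) = k j"
proof -
  have "prod_list (map (\<lambda>l. zpow (k l) (ki l) (if l = j then 1 else 0)) [0..<m]) = (if j < m then k j else 1)" for m
    by (induction m) (auto simp: less_Suc_eq)
  from this[of "n + 1"] assms show ?thesis by (simp add: kmon_def)
qed

lemma Kmon_unit: "j \<le> n \<Longrightarrow> Kmon n q (\<lambda>l. if l = j then 1 else 0) = Kg n q j"
  by (simp add: Kmon_eq kmon_unit component_generators)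

lemma alg_aut_hom: "f \<in> alg_aut (scal n q) (Uaff n q) \<Longrightarrow> f \<in> alg_hom (scal n q) (Uaff n q) (Uaff n q)"
  by (auto simp: alg_aut_def alg_hom_def ring_iso_def)

locale iquantum_affine = qparam +
  fixes n :: nat
  assumes n: "n \<ge> 2"
begin

abbreviation "U \<equiv> Uaff n q"
abbreviation "B \<equiv> uB n q"
abbreviation "K \<equiv> uK n q"
abbreviation "KI \<equiv> uKi n q"

sublocale gen: iquantum_family q p n B K KI
  using n iquantum_rels_generators by unfold_locales

abbreviation "T i \<equiv> endo n q (braidB n q i B KI) (braidK n i K KI) (braidK n i KI K)"

lemma T_rels:
  "i \<le> n \<Longrightarrow> iquantum_rels n q (braidB n q i B KI) (braidK n i K KI) (braidK n i KI K)"
  by (rule iquantum_rels_braid[OF gen.rels])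

lemma Uprod_eval_braid:
  assumes R: "iquantum_rels n q b k ki" and "i \<le> n" "j \<le> n"
  shows "Uprod_eval n q b k ki (braidB n q i B KI j) = braidB n q i b ki j"
    "Uprod_eval n q b k ki (braidB_inv n q i B KI j) = braidB_inv n q i b ki j"
    "Uprod_eval n q b k ki (braidK n i K KI j) = braidK n i k ki j"
  using assms(2,3) by (simp_all add: braidB_def braidB_inv_def braidK_def Uprod_eval_simps[OF R] Uprod_eval_qbr[OF R])

lemma T_aut:
  assumes i: "i \<le> n"
  shows "T i \<in> alg_aut (scal n q) U"
proof (rule endo_aut[OF T_rels[OF i] iquantum_rels_braid_inv[OF gen.rels i]])
  fix j assume j: "j \<le> n"
  note S = Uprod_eval_braid[OF T_rels[OF i] i j]
    Uprod_eval_braid[OF iquantum_rels_braid_inv[OF gen.rels i] i j]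
  show "Uprod_eval n q (braidB n q i B KI) (braidK n i K KI) (braidK n i KI K) (braidB_inv n q i B KI j) = B j"
    "Uprod_eval n q (braidB n q i B KI) (braidK n i K KI) (braidK n i KI K) (braidK n i K KI j) = K j"
    "Uprod_eval n q (braidB_inv n q i B KI) (braidK n i K KI) (braidK n i KI K) (braidB n q i B KI j) = B j"
    "Uprod_eval n q (braidB_inv n q i B KI) (braidK n i K KI) (braidK n i KI K) (braidK n i K KI j) = K j"
    by (simp_all add: S gen.braid_inverse[OF i j])
qed

text \<open>
  The prescribed values determine at most one automorphism: they include the images of all \<open>B\<^sub>j\<close>, and
  those of the \<open>K\<^sub>j\<close> are the case of a unit exponent vector.
\<close>

lemma braidT_eq:
  assumes i: "i \<le> n"
  shows "braidT n q i = T i"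
  unfolding braidT_def
proof (rule the_equality, intro conjI allI impI)
  note R = T_rels[OF i]
  show "T i \<in> alg_aut (scal n q) U" by (rule T_aut[OF i])
  show "T i \<in> extensional (carrier U)" by (simp add: endo_def)
  show Kd: "T i (Kmon n q d) = Kmon n q (root_refl n i d)" for d
    by (simp add: Kmon_eq endo_component Uprod_eval_kmon[OF R] kmon_braid[OF gen.rels i])
  show Bi: "T i (Bg n q i) = inv\<^bsub>U\<^esub> Kg n q i \<otimes>\<^bsub>U\<^esub> Bg n q i"
    using i by (simp add: endo_generators[OF R] braidB_def component_simps component_generators)
  show B0: "T i (Bg n q j) = Bg n q j" if "j \<le> n" "cartan n i j = 0" for j
    using i that by (auto simp: endo_generators[OF R] braidB_def component_generators)
  show B1: "T i (Bg n q j) = (Bg n q j \<otimes>\<^bsub>U\<^esub> Bg n q i) \<ominus>\<^bsub>U\<^esub> smul n q q (Bg n q i \<otimes>\<^bsub>U\<^esub> Bg n q j)"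
    if "j \<le> n" "cartan n i j = -1" for j
    using i that
    by (auto simp: endo_generators[OF R] braidB_def component_generators component_qbr vbracket_def)
  fix f
  assume f: "f \<in> alg_aut (scal n q) U \<and> f \<in> extensional (carrier U) \<and>
    (\<forall>d. f (Kmon n q d) = Kmon n q (root_refl n i d)) \<and>
    f (Bg n q i) = inv\<^bsub>U\<^esub> Kg n q i \<otimes>\<^bsub>U\<^esub> Bg n q i \<and>
    (\<forall>j\<le>n. cartan n i j = 0 \<longrightarrow> f (Bg n q j) = Bg n q j) \<and>
    (\<forall>j\<le>n. cartan n i j = -1 \<longrightarrow>
       f (Bg n q j) = (Bg n q j \<otimes>\<^bsub>U\<^esub> Bg n q i) \<ominus>\<^bsub>U\<^esub> smul n q q (Bg n q i \<otimes>\<^bsub>U\<^esub> Bg n q j))"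
  show "f = T i"
  proof (rule extensionalityI[of f "carrier U"])
    show "f \<in> extensional (carrier U)" "T i \<in> extensional (carrier U)"
      using f by (auto simp: endo_def)
    show "f x = T i x" if "x \<in> carrier U" for x
    proof (rule alg_hom_eqI[OF _ endo_hom[OF R] _ _ that])
      show "f \<in> alg_hom (scal n q) U U" using f alg_aut_hom by blast
      show "f (Bg n q j) = T i (Bg n q j)" if "j \<le> n" for j
        using f that Bi B0 B1 cartan_cases[of i j n] by metis
      show "f (Kg n q j) = T i (Kg n q j)" if "j \<le> n" for j
        using f that Kd[of "\<lambda>l. if l = j then 1 else 0"] by (metis Kmon_unit)
    qed
  qed
qed

abbreviation "Tpi \<equiv> endo n q (B \<circ> rot n (Suc 0)) (K \<circ> rot n (Suc 0)) (KI \<circ> rot n (Suc 0))"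

lemma rot_rels: "iquantum_rels n q (B \<circ> rot n r) (K \<circ> rot n r) (KI \<circ> rot n r)"
  by (rule iquantum_rels_rot[OF gen.rels])

lemma Tpi_generators:
  "j \<le> n \<Longrightarrow> Tpi (Bg n q j) = Bg n q (rot n (Suc 0) j)" "j \<le> n \<Longrightarrow> Tpi (Kg n q j) = Kg n q (rot n (Suc 0) j)"
  by (simp_all add: endo_generators[OF rot_rels] component_generators rot_le)

lemma braidTpi_eq: "braidTpi n q = Tpi"
  unfolding braidTpi_def
proof (rule the_equality, intro conjI allI impI)
  show "Tpi \<in> alg_aut (scal n q) U"
    by (rule endo_aut[OF rot_rels rot_rels[of n]])
      (simp_all add: Uprod_eval_simps[OF rot_rels] rot_le rot_rot rot_full)
  show "Tpi \<in> extensional (carrier U)" by (simp add: endo_def)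
  show "Tpi (Bg n q i) = Bg n q ((i + 1) mod (n + 1))" "Tpi (Kg n q i) = Kg n q ((i + 1) mod (n + 1))"
    if "i \<le> n" for i
    using Tpi_generators[OF that] by (simp_all add: rot_def)
  fix f
  assume f: "f \<in> alg_aut (scal n q) U \<and> f \<in> extensional (carrier U) \<and>
    (\<forall>i\<le>n. f (Bg n q i) = Bg n q ((i + 1) mod (n + 1)) \<and> f (Kg n q i) = Kg n q ((i + 1) mod (n + 1)))"
  show "f = Tpi"
  proof (rule extensionalityI[of f "carrier U"])
    show "f \<in> extensional (carrier U)" "Tpi \<in> extensional (carrier U)"
      using f by (auto simp: endo_def)
    show "f x = Tpi x" if "x \<in> carrier U" for x
    proof (rule alg_hom_eqI[OF _ endo_hom[OF rot_rels] _ _ that])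
      show "f \<in> alg_hom (scal n q) U U" using f alg_aut_hom by blast
      show "f (Bg n q j) = Tpi (Bg n q j)" "f (Kg n q j) = Tpi (Kg n q j)" if "j \<le> n" for j
        using f that by (simp_all add: Tpi_generators rot_def)
    qed
  qed
qed

lemma braidTpi_power:
  assumes "x \<in> carrier U" "(n + 1) dvd r"
  shows "(braidTpi n q ^^ r) x = x"
proof -
  have hom: "Tpi ^^ r \<in> alg_hom (scal n q) U U" for r
  proof (induction r)
    case (Suc r)
    then show ?case
      unfolding funpow.simps(2) by (rule alg_hom_compose[OF endo_hom[OF rot_rels]])
  qed (simp add: alg_hom_id flip: id_def)
  have gens: "(Tpi ^^ r) (Bg n q j) = Bg n q (rot n r j)" "(Tpi ^^ r) (Kg n q j) = Kg n q (rot n r j)"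
    if "j \<le> n" for j r
    using that by (induction r) (simp_all add: rot_full Tpi_generators rot_le rot_rot)
  have "rot n r j = j" if "j \<le> n" for j
    using that assms(2) by (rule rot_multiple)
  then have "(Tpi ^^ r) x = id x"
    by (intro alg_hom_eqI[OF hom alg_hom_id _ _ assms(1)]) (simp_all add: gens)
  then show ?thesis by (simp add: braidTpi_eq)
qed

text \<open>
  The operators \<open>T\<^sub>2, \<dots>, T\<^bsub>m+1\<^esub>\<close> successively extend \<open>T\<^sub>1 (B\<^sub>1) = K\<^sub>1\<^sup>-\<^sup>1 B\<^sub>1\<close> by one factor each, in the
  bracket as well as in the central product.
\<close>

lemma descending_word_value:
  "m + 1 \<le> n \<Longrightarrow>
     comp_word (braidT n q) (rev [1..<m + 2]) (Bg n q 1) = component (kchain KI 1 m * chain q B 1 m) n q \<and>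
     comp_word (braidT n q) (rev [1..<m + 2]) (Kg n q 1) = component (kchain KI 1 m) n q"
proof (induction m)
  case 0
  have "rev [1..<0 + 2] = [1 :: nat]" by (simp add: numeral_2_eq_2)
  moreover have "T 1 (Bg n q 1) = component (KI 1 * B 1) n q" "T 1 (Kg n q 1) = component (KI 1) n q"
    using n by (simp_all add: endo_generators[OF T_rels] braidB_def braidK_def)
  ultimately show ?case
    using n by (simp add: comp_word_def braidT_eq)
next
  case (Suc m)
  let ?i = "Suc (1 + m)"
  have i: "?i \<le> n" using Suc.prems by simp
  note R = T_rels[OF i]
  have w: "comp_word (braidT n q) (rev [1..<Suc m + 2]) = T ?i \<circ> comp_word (braidT n q) (rev [1..<m + 2])"
    using i by (simp add: comp_word_def braidT_eq)
  have k: "Uprod_eval n q (braidB n q ?i B KI) (braidK n ?i K KI) (braidK n ?i KI K) (kchain KI 1 m) = kchain KI 1 (Suc m)"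
    using i by (subst Uprod_eval_kchain[OF R]) (simp_all only: kchain_braid_right kchain_snoc)
  have c: "Uprod_eval n q (braidB n q ?i B KI) (braidK n ?i K KI) (braidK n ?i KI K) (chain q B 1 m) = chain q B 1 (Suc m)"
    using i by (subst Uprod_eval_chain[OF R]) (simp_all only: gen.chain_braid_right gen.chain_snoc)
  show ?case
    unfolding w o_apply using Suc i by (simp only: endo_component Uprod_eval_simps(2)[OF R] k c)
qed

lemma component_chain:
  "1 \<le> l \<Longrightarrow> l + m \<le> n \<Longrightarrow>
     component (chain q B l m) n q = nested_vbracket n q q (map (Bg n q) [l..<l + m + 1])"
proof (induction m arbitrary: l)
  case 0
  then show ?case by (simp add: component_generators)
next
  case (Suc m)
  define xs where "xs = [Suc (Suc l)..<Suc l + m + 1]"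
  have l: "[l..<l + Suc m + 1] = l # Suc l # xs" "[Suc l..<Suc l + m + 1] = Suc l # xs"
    unfolding xs_def by (subst upt_rec; simp del: upt_Suc add: upt_conv_Cons)+
  show ?case
    unfolding l using Suc.IH[of "Suc l"] Suc.prems unfolding l
    by (simp add: component_qbr component_generators)
qed

lemma kchain_prod_list: "kchain k l m = prod_list (map k [l..<l + m + 1])"
proof (induction m arbitrary: l)
  case (Suc m)
  have "[l..<l + Suc m + 1] = l # [Suc l..<Suc l + m + 1]" by (simp add: upt_rec)
  then show ?case using Suc[of "Suc l"] by simp
qed simp

lemma component_kchain:
  assumes "l + m \<le> n"
  shows "component (kchain KI l m) n q = prod_of U (map (\<lambda>i. inv\<^bsub>U\<^esub> Kg n q i) [l..<l + m + 1])"
  unfolding kchain_prod_list component_prod_list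
  using assms by (auto simp: component_generators simp del: upt_Suc intro!: arg_cong[of _ _ "prod_of U"])

end

section \<open>Reduced expressions in the extended affine Weyl group\<close>

lemma comp_word_Cons: "comp_word F (i # is) = F i \<circ> comp_word F is"
  by (simp add: comp_word_def)

lemma comp_word_append: "comp_word F (is @ js) = comp_word F is \<circ> comp_word F js"
  by (induction "is") (simp_all add: comp_word_def comp_assoc)

lemma comp_word_rev:
  "(\<And>i. i \<in> set is \<Longrightarrow> F i \<circ> F i = id) \<Longrightarrow> comp_word F is \<circ> comp_word F (rev is) = id"
proof (induction "is")
  case (Cons i "is")
  have c: "comp_word F (rev (i # is)) = comp_word F (rev is) \<circ> F i"
    by (simp add: comp_word_append) (simp add: comp_word_def)
  have "comp_word F (i # is) \<circ> comp_word F (rev (i # is))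
      = F i \<circ> (comp_word F is \<circ> comp_word F (rev is)) \<circ> F i"
    by (simp only: comp_word_Cons c comp_assoc)
  then show ?case using Cons by simp
qed (simp add: comp_word_def)

lemma aff_refl_finite:
  assumes "i \<in> {1..n}"
  shows "aff_refl n i x j = (if j = i then - x i
    else if j \<in> {1..n} \<and> (j = Suc i \<or> i = Suc j) then x j + x i else x j)"
proof (cases "j \<in> {1..n}")
  case True
  then show ?thesis using assms by (auto simp: aff_refl_def simple_root_def cartan_finite)
next
  case False
  then show ?thesis using assms by (auto simp: aff_refl_def simple_root_def)
qed

lemma aff_refl_involution:
  assumes "i \<in> {1..n}"
  shows "aff_refl n i \<circ> aff_refl n i = id"
proof -
  have "aff_refl n i (aff_refl n i x) j = x j" for x j
    using assms by (subst aff_refl_finite[OF assms]) (auto simp: aff_refl_finite[OF assms])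
  then show ?thesis by (simp add: fun_eq_iff)
qed

definition coxeter :: "nat \<Rightarrow> weight \<Rightarrow> weight" where
  "coxeter n = comp_word (aff_refl n) (rev [1..<n + 1])"

definition coxeter_inv :: "nat \<Rightarrow> weight \<Rightarrow> weight" where
  "coxeter_inv n = comp_word (aff_refl n) [1..<n + 1]"

lemma coxeter_inverse: "coxeter_inv n \<circ> coxeter n = id" "coxeter n \<circ> coxeter_inv n = id"
proof -
  have *: "aff_refl n i \<circ> aff_refl n i = id" if "i \<in> set [1..<n+1]" for i
    using that by (intro aff_refl_involution) auto
  show "coxeter_inv n \<circ> coxeter n = id"
    unfolding coxeter_def coxeter_inv_def by (rule comp_word_rev) (rule *)
  have "comp_word (aff_refl n) (rev [1..<n+1]) \<circ> comp_word (aff_refl n) (rev (rev [1..<n+1])) = id"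
    by (rule comp_word_rev) (rule *, simp)
  then show "coxeter n \<circ> coxeter_inv n = id"
    by (simp only: coxeter_def coxeter_inv_def rev_rev_ident)
qed

lemma pi_inv_omega1_eq: "pi_inv_omega1 n = coxeter n"
proof -
  have pi: "weyl_pi n = transl (fund_weight 1) \<circ> coxeter_inv n"
    by (simp add: weyl_pi_def coxeter_inv_def)
  have c: "coxeter_inv n (coxeter n x) = x" "coxeter n (coxeter_inv n x) = x" for x
    using coxeter_inverse by (metis comp_apply id_apply)+
  have "inj (transl y)" for y
    by (rule injI) (simp add: transl_def fun_eq_iff)
  moreover have "inj (coxeter_inv n)"
    by (rule injI) (metis c(2))
  ultimately have "inj (weyl_pi n)"
    unfolding pi by (rule inj_compose)
  moreover have "weyl_pi n (coxeter n x) = transl (fund_weight 1) x" for x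
    by (simp add: pi c)
  ultimately have "pi_inv_omega1 n x = coxeter n x" for x
    unfolding pi_inv_omega1_def by (metis comp_apply inv_f_f)
  then show ?thesis by (rule ext)
qed

text \<open>
  In the induction the coordinate after the last reflection used is carried along, because the next
  reflection reads it.
\<close>

lemma coxeter_last:
  assumes "n \<ge> 1"
  shows "coxeter n x n = - (\<Sum>j=1..n. x j)"
proof -
  have "m \<le> n \<Longrightarrow> m \<ge> 1 \<Longrightarrow> comp_word (aff_refl n) (rev [1..<m + 1]) x m = - (\<Sum>j=1..m. x j) \<and>
    (m < n \<longrightarrow> comp_word (aff_refl n) (rev [1..<m + 1]) x (Suc m) = x (Suc m) + (\<Sum>j=1..m. x j)) \<and>
    (\<forall>j > Suc m. comp_word (aff_refl n) (rev [1..<m + 1]) x j = x j)" for m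
  proof (induction m)
    case (Suc m)
    show ?case
    proof (cases "m = 0")
      case True
      then show ?thesis
        using Suc.prems by (auto simp: comp_word_def aff_refl_finite)
    next
      case False
      have w: "comp_word (aff_refl n) (rev [1..<Suc m + 1]) x
          = aff_refl n (Suc m) (comp_word (aff_refl n) (rev [1..<m + 1]) x)"
        by (simp add: comp_word_def)
      show ?thesis
        unfolding w using Suc False by (auto simp: aff_refl_finite)
    qed
  qed simp
  from this[of n] show ?thesis
    using assms by (simp add: coxeter_def)
qed

text \<open>
  Induction from the right end of the word: \<open>s\<^sub>m \<cdots> s\<^sub>n\<close> shifts the coordinates \<open>m, \<dots>, n\<close> and puts minus
  their sum in position \<open>m\<close>, which also changes the coordinate before it.
\<close>

lemma coxeter_inv_eq:
  assumes "n \<ge> 1"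
  shows "coxeter_inv n x j = (if j = 1 then - (\<Sum>i=1..n. x i) else if j \<in> {2..n} then x (j - 1) else x j)"
proof -
  have "d < n \<Longrightarrow> m = n - d \<Longrightarrow> comp_word (aff_refl n) [m..<n + 1] x j =
     (if j = m then - (\<Sum>i=m..n. x i) else if j \<in> {m<..n} then x (j - 1)
      else if Suc j = m \<and> j \<ge> 1 then x j + (\<Sum>i=m..n. x i) else x j)" for d m j
  proof (induction d arbitrary: m j)
    case 0
    then show ?case by (auto simp: comp_word_def aff_refl_finite)
  next
    case (Suc d)
    then have m: "m \<in> {1..n}" "m < n" "Suc m = n - d" "[m..<n + 1] = m # [Suc m..<n + 1]"
      by (auto simp: upt_rec)
    then have sum: "(\<Sum>i=m..n. x i) = x m + (\<Sum>i=Suc m..n. x i)"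
      by (simp add: sum.atLeast_Suc_atMost)
    define y S where "y = comp_word (aff_refl n) [Suc m..<n + 1] x" and "S = (\<Sum>i=Suc m..n. x i)"
    have y: "y j = (if j = Suc m then - S else if j \<in> {Suc m<..n} then x (j - 1)
      else if j = m then x m + S else x j)" for j
      using Suc.IH[OF _ m(3), of j] Suc.prems(1) m(1) by (auto simp: y_def S_def)
    have "comp_word (aff_refl n) [m..<n + 1] x = aff_refl n m y"
      by (simp only: m(4) comp_word_Cons comp_apply y_def)
    then show ?case
      unfolding sum S_def[symmetric] using m(1,2) by (simp only: aff_refl_finite) (auto simp: y)
  qed
  from this[of "n - 1" 1 j] show ?thesis
    using assms by (auto simp: coxeter_inv_def)
qed

text \<open>
  The value at \<open>x\<close> of the \<open>j\<close>-th affine simple root of the fundamental alcove. In these coordinates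
  \<open>\<pi>\<close> is a cyclic shift, whence \<open>\<pi>\<^bsup>n+1\<^esup> = 1\<close>.
\<close>

definition aff_coord :: "nat \<Rightarrow> weight \<Rightarrow> nat \<Rightarrow> int" where
  "aff_coord n x j = (if j = 0 then 1 - (\<Sum>i=1..n. x i) else x j)"

lemma weyl_pi_eq:
  assumes "n \<ge> 1" "j \<in> {1..n}"
  shows "weyl_pi n x j = aff_coord n x (j - 1)"
proof -
  have "weyl_pi n x j = coxeter_inv n x j + (if j = 1 then 1 else 0)"
    by (simp add: weyl_pi_def transl_def fund_weight_def coxeter_inv_def)
  then show ?thesis using assms by (auto simp: coxeter_inv_eq aff_coord_def)
qed

lemma weyl_pi_outside:
  assumes "n \<ge> 1" "j \<notin> {1..n}"
  shows "weyl_pi n x j = x j"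
proof -
  have "weyl_pi n x j = coxeter_inv n x j + (if j = 1 then 1 else 0)"
    by (simp add: weyl_pi_def transl_def fund_weight_def coxeter_inv_def)
  then show ?thesis using assms by (auto simp: coxeter_inv_eq)
qed

lemma aff_coord_pi:
  assumes "n \<ge> 1" "j \<le> n"
  shows "aff_coord n (weyl_pi n x) (rot n (Suc 0) j) = aff_coord n x j"
proof (cases "j = n")
  case False
  then have "rot n (Suc 0) j = Suc j" using assms by (simp add: rot_def)
  then show ?thesis using assms False by (simp add: aff_coord_def[of n "weyl_pi n x"] weyl_pi_eq)
next
  case True
  have "(\<Sum>i=1..n. weyl_pi n x i) = (\<Sum>i=1..n. aff_coord n x (i - 1))"
    by (intro sum.cong) (simp_all add: weyl_pi_eq)
  also have "\<dots> = (\<Sum>i=0..n-1. aff_coord n x i)"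
    using assms by (intro sum.reindex_bij_witness[of _ Suc "\<lambda>i. i - 1"]) auto
  also have "\<dots> = aff_coord n x 0 + (\<Sum>i=1..n-1. x i)"
    using assms by (simp add: sum.atLeast_Suc_atMost aff_coord_def)
  also have "\<dots> = 1 - x n"
  proof -
    have "{1..n} = insert n {1..n-1}" "n \<notin> {1..n-1}" using assms by auto
    then show ?thesis by (simp add: aff_coord_def)
  qed
  finally show ?thesis
    using True assms by (simp add: aff_coord_def rot_def)
qed

lemma aff_coord_pi_power:
  assumes "n \<ge> 1" "j \<le> n"
  shows "aff_coord n ((weyl_pi n ^^ r) x) (rot n r j) = aff_coord n x j"
proof (induction r)
  case (Suc r)
  have "rot n (Suc r) j = rot n (Suc 0) (rot n r j)" by (simp add: rot_rot)
  then show ?case using Suc assms by (simp add: aff_coord_pi rot_le)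
qed (use assms in \<open>simp add: rot_full\<close>)

lemma weyl_pi_power_id:
  assumes n: "n \<ge> 1" and r: "(n + 1) dvd r"
  shows "weyl_pi n ^^ r = id"
proof (intro ext)
  fix x j
  have out: "(weyl_pi n ^^ r) x j = x j" if "j \<notin> {1..n}" for r
    using weyl_pi_outside[OF n that] by (induction r) simp_all
  show "(weyl_pi n ^^ r) x j = id x j"
  proof (cases "j \<in> {1..n}")
    case True
    then show ?thesis
      using aff_coord_pi_power[OF n, of j r x] rot_multiple[OF _ r, of j] by (simp add: aff_coord_def)
  qed (simp add: out)
qed

text \<open>
  The vertex opposite to the wall of \<open>s\<^sub>m\<close>. In type \<open>A\<close> all fundamental weights are minuscule, so the
  vertices of the alcove are \<open>0, \<omega>\<^sub>1, \<dots>, \<omega>\<^sub>n\<close>.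
\<close>

definition alcove_vertex :: "nat \<Rightarrow> weight" where
  "alcove_vertex m = (if m = 0 then (\<lambda>_. 0) else fund_weight m)"

lemma aff_coord_vertex: "m \<le> n \<Longrightarrow> j \<le> n \<Longrightarrow> aff_coord n (alcove_vertex m) j = (if j = m then 1 else 0)"
  by (auto simp: aff_coord_def alcove_vertex_def fund_weight_def)

lemma aff_refl_vertex:
  assumes "i \<noteq> m" "i \<le> n" "m \<le> n"
  shows "aff_refl n i (alcove_vertex m) = alcove_vertex m"
proof (cases "i = 0")
  case True
  then show ?thesis using assms by (auto simp: aff_refl_def alcove_vertex_def fund_weight_def fun_eq_iff)
next
  case False
  then show ?thesis using assms by (auto simp: aff_refl_def alcove_vertex_def fund_weight_def fun_eq_iff)
qed

lemma comp_word_vertex: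
  assumes "set is \<subseteq> {0..n}" "m \<notin> set is" "m \<le> n"
  shows "comp_word (aff_refl n) is (alcove_vertex m) = alcove_vertex m"
  using assms(1,2)
proof (induction "is")
  case (Cons i "is")
  then have "i \<noteq> m" "i \<le> n" by auto
  with Cons assms(3) show ?case by (simp add: comp_word_Cons aff_refl_vertex)
qed (simp add: comp_word_def)

text \<open>
  The weight \<open>\<epsilon>\<^bsub>p+1\<^esub> = \<omega>\<^bsub>p+1\<^esub> - \<omega>\<^sub>p\<close>, where \<open>\<omega>\<^sub>0 = \<omega>\<^bsub>n+1\<^esub> = 0\<close>. The finite reflections permute these
  weights as adjacent transpositions.
\<close>

definition eps_weight :: "nat \<Rightarrow> nat \<Rightarrow> weight" where
  "eps_weight n p j = (if j = Suc p \<and> j \<le> n then 1 else 0) - (if j = p \<and> p \<ge> 1 then 1 else 0)"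

lemma aff_refl_eps:
  assumes "i \<in> {1..n}" "p \<le> n"
  shows "aff_refl n i (eps_weight n p) = eps_weight n (if i = Suc p then Suc p else if i = p then p - 1 else p)"
  using assms by (auto simp: fun_eq_iff aff_refl_finite eps_weight_def)

text \<open>
  Each letter moves \<open>\<epsilon>\<^bsub>p+1\<^esub>\<close> by at most one position, so a word that takes \<open>\<epsilon>\<^sub>1\<close> to \<open>\<epsilon>\<^bsub>m+1\<^esub>\<close> in \<open>m\<close> letters
  must move it up at every step, and this determines the letters.
\<close>

lemma comp_word_eps:
  "set is \<subseteq> {1..n} \<Longrightarrow> \<exists>p. p \<le> length is \<and> p \<le> n \<and>
     comp_word (aff_refl n) is (eps_weight n 0) = eps_weight n p \<and>
     (p = length is \<longrightarrow> is = rev [1..<p + 1])"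
proof (induction "is")
  case (Cons i "is")
  then obtain p where p: "p \<le> length is" "p \<le> n"
    "comp_word (aff_refl n) is (eps_weight n 0) = eps_weight n p"
    "p = length is \<longrightarrow> is = rev [1..<p + 1]" by auto
  have i: "i \<in> {1..n}" using Cons.prems by simp
  show ?case
    using i p by (intro exI[of _ "if i = Suc p then Suc p else if i = p then p - 1 else p"])
      (auto simp: comp_word_Cons aff_refl_eps)
qed (simp add: comp_word_def)

lemma coxeter_eps: "coxeter n (eps_weight n 0) = eps_weight n n"
proof -
  have "m \<le> n \<Longrightarrow> comp_word (aff_refl n) (rev [1..<m + 1]) (eps_weight n 0) = eps_weight n m" for m
    by (induction m) (simp_all add: comp_word_def aff_refl_eps)
  then show ?thesis by (simp add: coxeter_def)
qed

lemma eps_weight_last: "n \<ge> 1 \<Longrightarrow> p \<le> n \<Longrightarrow> eps_weight n p = eps_weight n n \<Longrightarrow> p = n"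
  by (drule fun_cong[of _ _ n]) (auto simp: eps_weight_def split: if_splits)

text \<open>
  A word with at most \<open>n\<close> letters omits one of the \<open>n + 1\<close> nodes, say \<open>m\<close>, and then fixes the vertex
  opposite to that wall. Hence \<open>s\<^sub>n \<cdots> s\<^sub>1\<close> maps this vertex to a vertex of the alcove, whose affine
  coordinates are nonnegative. The last coordinate of \<open>s\<^sub>n \<cdots> s\<^sub>1 \<omega>\<^sub>m\<close> is \<open>-1\<close> for \<open>m \<ge> 1\<close>, so \<open>m = 0\<close>.
  Since the origin is fixed, \<open>\<pi>\<^sup>r\<close> fixes it too, and \<open>n + 1\<close> divides \<open>r\<close>. Now the word consists of
  finite letters and equals \<open>s\<^sub>n \<cdots> s\<^sub>1\<close>; it takes \<open>\<epsilon>\<^sub>1\<close> to \<open>\<epsilon>\<^bsub>n+1\<^esub>\<close> in at most \<open>n\<close> letters, which leaves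
  only one possibility.
\<close>

lemma coxeter_expr_unique:
  assumes n: "n \<ge> 1" and w: "weyl_expr n (coxeter n) r is" and len: "length is \<le> n"
  shows "(n + 1) dvd r \<and> is = rev [1..<n + 1]"
proof -
  have s: "set is \<subseteq> {0..n}" and e: "coxeter n = (weyl_pi n ^^ r) \<circ> comp_word (aff_refl n) is"
    using w by (auto simp: weyl_expr_def)
  have vertex: "m = 0 \<and> (n + 1) dvd r" if m: "m \<le> n" "m \<notin> set is" for m
  proof -
    have v: "coxeter n (alcove_vertex m) = (weyl_pi n ^^ r) (alcove_vertex m)"
      using comp_word_vertex[OF s m(2,1)] by (simp add: e)
    have "aff_coord n (coxeter n (alcove_vertex m)) (rot n r j) \<ge> 0" if "j \<le> n" for j
      unfolding v using aff_coord_pi_power[OF n that] m(1) that by (simp add: aff_coord_vertex)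
    \<comment> \<open>The coordinate \<open>n\<close> is the one reached from \<open>rot n (n * r) n\<close> by \<open>r\<close> shifts.\<close>
    moreover have "n = rot n r (rot n (n * r) n)"
    proof -
      have "r + n * r = (n + 1) * r" by simp
      then have "(n + 1) dvd (r + n * r)" by (metis dvd_triv_left)
      then show ?thesis using rot_multiple[of n n "r + n * r"] by (simp only: rot_rot)
    qed
    ultimately have "coxeter n (alcove_vertex m) n \<ge> 0"
      using rot_le n by (metis aff_coord_def not_one_le_zero)
    then have m0: "m = 0"
      using coxeter_last[OF n, of "alcove_vertex m"] m(1)
      by (auto simp: alcove_vertex_def fund_weight_def split: if_splits)
    have "coxeter n (alcove_vertex 0) = alcove_vertex 0"
      unfolding coxeter_def by (rule comp_word_vertex) auto
    then have "aff_coord n (alcove_vertex 0) (rot n r 0) = 1"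
      using aff_coord_pi_power[OF n, of 0 r "alcove_vertex 0"] v m0 by (simp add: aff_coord_vertex)
    then have "rot n r 0 = 0"
      using aff_coord_vertex[of 0 n "rot n r 0"] by (simp add: rot_le split: if_splits)
    then show ?thesis using m0 by (simp add: rot_def dvd_eq_mod_eq_0)
  qed
  have "card (set is) < card {0..n}"
    using len card_length[of "is"] by simp
  then obtain m where "m \<in> {0..n}" "m \<notin> set is"
    using s by (metis List.finite_set card_mono not_less subsetI)
  then have 0: "0 \<notin> set is" and r: "(n + 1) dvd r"
    using vertex[of m] by auto
  have "coxeter n = comp_word (aff_refl n) is"
    using weyl_pi_power_id[OF n r] e by simp
  moreover have "set is \<subseteq> {1..n}"
    using s 0 by (metis atLeastAtMost_iff le_numeral_extra(3) less_one not_le subset_iff)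
  ultimately obtain p where p: "p \<le> length is" "p \<le> n" "eps_weight n n = eps_weight n p"
    "p = length is \<longrightarrow> is = rev [1..<p + 1]"
    using comp_word_eps[of "is" n] coxeter_eps[of n] by auto
  then have "p = n" using eps_weight_last[OF n] by metis
  then show ?thesis using p len r by auto
qed

lemma coxeter_expr: "weyl_expr n (coxeter n) 0 (rev [1..<n + 1])"
  by (auto simp: weyl_expr_def coxeter_def)

lemma reduced_expr_pi_inv_omega1:
  assumes n: "n \<ge> 1"
  shows "reduced_expr n (pi_inv_omega1 n) r is \<Longrightarrow> (n + 1) dvd r \<and> is = rev [1..<n + 1]"
    and "reduced_expr n (pi_inv_omega1 n) 0 (rev [1..<n + 1])"
proof -
  show "(n + 1) dvd r \<and> is = rev [1..<n + 1]" if "reduced_expr n (pi_inv_omega1 n) r is"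
  proof -
    have "length is \<le> length (rev [1..<n + 1])"
      using that coxeter_expr[of n] unfolding reduced_expr_def pi_inv_omega1_eq by blast
    then have "length is \<le> n" by (simp del: upt_Suc)
    then show ?thesis
      using that coxeter_expr_unique[OF n, of r "is"] unfolding reduced_expr_def pi_inv_omega1_eq by blast
  qed
  show "reduced_expr n (pi_inv_omega1 n) 0 (rev [1..<n + 1])"
    unfolding reduced_expr_def pi_inv_omega1_eq
    using coxeter_expr[of n] coxeter_expr_unique[OF n] by (metis length_rev length_upt add_diff_cancel_right' le_cases)
qed

section \<open>The evaluation homomorphism\<close>

context iquantum_affine
begin

lemma comp_word_closed:
  "set is \<subseteq> {..n} \<Longrightarrow> x \<in> carrier U \<Longrightarrow> comp_word (braidT n q) is x \<in> carrier U"
proof (induction "is")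
  case (Cons i "is")
  then show ?case
    by (auto simp: comp_word_Cons braidT_eq intro: alg_homD(1)[OF endo_hom[OF T_rels]])
qed (simp add: comp_word_def)

lemma braidTw_pi_inv_omega1:
  assumes "x \<in> carrier U"
  shows "braidTw n q (pi_inv_omega1 n) x = comp_word (braidT n q) (rev [1..<n + 1]) x"
proof -
  have n1: "n \<ge> 1" using n by simp
  obtain r "is" where s: "(SOME (k, is). reduced_expr n (pi_inv_omega1 n) k is) = (r, is)"
    by (cases "SOME (k, is). reduced_expr n (pi_inv_omega1 n) k is")
  have "case (r, is) of (k, is) \<Rightarrow> reduced_expr n (pi_inv_omega1 n) k is"
    unfolding s[symmetric]
    by (rule someI[of _ "(0, rev [1..<n + 1])"]) (use reduced_expr_pi_inv_omega1(2)[OF n1] in simp)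
  then have "(n + 1) dvd r" "is = rev [1..<n + 1]"
    using reduced_expr_pi_inv_omega1(1)[OF n1] by auto
  moreover have "comp_word (braidT n q) (rev [1..<n + 1]) x \<in> carrier U"
    using assms by (intro comp_word_closed) auto
  ultimately show ?thesis
    unfolding braidTw_def Let_def s by (simp add: braidTpi_power del: upt_Suc)
qed

definition Ufin_carrier :: "gen free_alg set set" where
  "Ufin_carrier = generate_ring U (range (scal n q) \<union> Bg n q ` {1..n} \<union> Kg n q ` {1..n}
     \<union> (\<lambda>i. inv\<^bsub>U\<^esub> Kg n q i) ` {1..n})"

lemma carrier_Ufin: "carrier (Ufin n q) = Ufin_carrier"
  by (simp add: Ufin_def Ufin_carrier_def)

lemma Ufin_generators:
  "scal n q c \<in> Ufin_carrier" "i \<in> {1..n} \<Longrightarrow> Bg n q i \<in> Ufin_carrier"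
  "i \<in> {1..n} \<Longrightarrow> Kg n q i \<in> Ufin_carrier" "i \<in> {1..n} \<Longrightarrow> inv\<^bsub>U\<^esub> Kg n q i \<in> Ufin_carrier"
  unfolding Ufin_carrier_def by (rule generate_ring.incl; blast)+

lemma Ufin_closed:
  assumes "x \<in> Ufin_carrier"
  shows "smul n q c x \<in> Ufin_carrier" "y \<in> Ufin_carrier \<Longrightarrow> x \<oplus>\<^bsub>U\<^esub> y \<in> Ufin_carrier"
    "y \<in> Ufin_carrier \<Longrightarrow> x \<otimes>\<^bsub>U\<^esub> y \<in> Ufin_carrier"
    "y \<in> Ufin_carrier \<Longrightarrow> vbracket n q v x y \<in> Ufin_carrier"
proof -
  have add: "x \<oplus>\<^bsub>U\<^esub> y \<in> Ufin_carrier" and mult: "x \<otimes>\<^bsub>U\<^esub> y \<in> Ufin_carrier"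
    if "x \<in> Ufin_carrier" "y \<in> Ufin_carrier" for x y
    using that by (simp_all add: Ufin_carrier_def generate_ring.eng_add generate_ring.eng_mult)
  have neg: "\<ominus>\<^bsub>U\<^esub> x \<in> Ufin_carrier" if "x \<in> Ufin_carrier" for x
    using that by (simp add: Ufin_carrier_def generate_ring.a_inv)
  show "y \<in> Ufin_carrier \<Longrightarrow> x \<oplus>\<^bsub>U\<^esub> y \<in> Ufin_carrier" "y \<in> Ufin_carrier \<Longrightarrow> x \<otimes>\<^bsub>U\<^esub> y \<in> Ufin_carrier"
    "smul n q c x \<in> Ufin_carrier" "y \<in> Ufin_carrier \<Longrightarrow> vbracket n q v x y \<in> Ufin_carrier"
    using assms by (simp_all add: smul_def vbracket_def a_minus_def add mult neg Ufin_generators)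
qed

lemma chain_in_Ufin:
  "1 \<le> l \<Longrightarrow> l + m \<le> n \<Longrightarrow> component (chain q B l m) n q \<in> Ufin_carrier"
  by (induction m arbitrary: l)
    (auto simp: component_generators component_qbr intro!: Ufin_closed Ufin_generators)

lemma kchain_in_Ufin:
  assumes "1 \<le> l" "l + m \<le> n"
  shows "component (kchain K l m) n q \<in> Ufin_carrier" "component (kchain KI l m) n q \<in> Ufin_carrier"
  using assms by (induction m arbitrary: l)
    (auto simp: component_generators component_simps intro!: Ufin_closed Ufin_generators)

abbreviation "ev a \<equiv> endo n q (evalB n q a B KI) (evalK n a K KI) (evalK n (inverse a) KI K)"

lemma ev_rels: "a \<noteq> 0 \<Longrightarrow> iquantum_rels n q (evalB n q a B KI) (evalK n a K KI) (evalK n (inverse a) KI K)"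
  by (rule gen.iquantum_rels_ev)

lemma Uprod_eval_eval:
  assumes R: "iquantum_rels n q b k ki" and "j \<le> n"
  shows "Uprod_eval n q b k ki (evalB n q a B KI j) = evalB n q a b ki j"
    "Uprod_eval n q b k ki (evalK n a K KI j) = evalK n a k ki j"
  using assms(2) n by (auto simp: evalB_def evalK_def Uprod_eval_simps[OF R] Uprod_eval_chain[OF R] Uprod_eval_kchain[OF R])

lemma ev_generators:
  assumes a: "a \<noteq> 0"
  shows "ev a (Bg n q 0) = smul n q a (component (kchain KI 1 (n - 1) * chain q B 1 (n - 1)) n q)"
    "ev a (Kg n q 0) = smul n q (a ^ 2) (component (kchain KI 1 (n - 1)) n q)"
    "ev a (inv\<^bsub>U\<^esub> Kg n q 0) = smul n q (inverse a ^ 2) (component (kchain K 1 (n - 1)) n q)"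
    "i \<in> {1..n} \<Longrightarrow> ev a (Bg n q i) = Bg n q i" "i \<in> {1..n} \<Longrightarrow> ev a (Kg n q i) = Kg n q i"
    "i \<in> {1..n} \<Longrightarrow> ev a (inv\<^bsub>U\<^esub> Kg n q i) = inv\<^bsub>U\<^esub> Kg n q i"
proof -
  have g: "ev a (Bg n q i) = component (evalB n q a B KI i) n q" "ev a (Kg n q i) = component (evalK n a K KI i) n q"
    "ev a (inv\<^bsub>U\<^esub> Kg n q i) = component (evalK n (inverse a) KI K i) n q" if "i \<le> n" for i
    using endo_generators[OF ev_rels[OF a] that] .
  show "ev a (Bg n q 0) = smul n q a (component (kchain KI 1 (n - 1) * chain q B 1 (n - 1)) n q)"
    "ev a (Kg n q 0) = smul n q (a ^ 2) (component (kchain KI 1 (n - 1)) n q)"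
    "ev a (inv\<^bsub>U\<^esub> Kg n q 0) = smul n q (inverse a ^ 2) (component (kchain K 1 (n - 1)) n q)"
    unfolding g[OF le0] by (simp_all add: evalB_def evalK_def component_simps)
  show "i \<in> {1..n} \<Longrightarrow> ev a (Bg n q i) = Bg n q i" "i \<in> {1..n} \<Longrightarrow> ev a (Kg n q i) = Kg n q i"
    "i \<in> {1..n} \<Longrightarrow> ev a (inv\<^bsub>U\<^esub> Kg n q i) = inv\<^bsub>U\<^esub> Kg n q i"
    by (subst g; simp add: evalB_def evalK_def component_generators)+
qed

text \<open>
  The images of \<open>B\<^sub>0\<close>, \<open>K\<^sub>0\<close> and \<open>K\<^sub>0\<^sup>-\<^sup>1\<close> are expressed in the generators of finite type.
\<close>

lemma ev_in_Ufin:
  assumes a: "a \<noteq> 0" and x: "x \<in> carrier U"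
  shows "ev a x \<in> Ufin_carrier"
proof -
  note hom = alg_homD[OF endo_hom[OF ev_rels[OF a]]]
  have le: "1 + (n - 1) \<le> n" using n by simp
  note top = chain_in_Ufin[OF order_refl le] kchain_in_Ufin[OF order_refl le]
  have 0: "ev a (Bg n q 0) \<in> Ufin_carrier" "ev a (Kg n q 0) \<in> Ufin_carrier" "ev a (inv\<^bsub>U\<^esub> Kg n q 0) \<in> Ufin_carrier"
    unfolding ev_generators[OF a] component_simps(4) by (intro Ufin_closed top)+
  have "ev a (Bg n q i) \<in> Ufin_carrier" "ev a (Kg n q i) \<in> Ufin_carrier" "ev a (inv\<^bsub>U\<^esub> Kg n q i) \<in> Ufin_carrier"
    if "i \<le> n" for i
    using that 0 ev_generators(4-6)[OF a, of i] Ufin_generators(2-4)[of i] by (cases "i = 0"; simp)+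
  note gens = this
  show ?thesis
    using x by (induction rule: Uaff_induct) (simp_all add: gens hom Ufin_generators Ufin_closed)
qed

lemma ev_alg_hom:
  assumes a: "a \<noteq> 0"
  shows "ev a \<in> alg_hom (scal n q) U (Ufin n q)"
proof -
  have "ev a \<in> ring_hom U (Ufin n q)"
    using alg_homD(2-4)[OF endo_hom[OF ev_rels[OF a]]] ev_in_Ufin[OF a]
    by (intro ring_hom_memI) (simp_all add: carrier_Ufin, simp_all add: Ufin_def)
  then show ?thesis
    using alg_homD(5)[OF endo_hom[OF ev_rels[OF a]]] by (simp add: alg_hom_def)
qed

text \<open>
  Both composites are homomorphisms, and on generators they are compared by \<open>eval_braid\<close>.
\<close>

lemma ev_equivariant:
  assumes a: "a \<noteq> 0" and i: "i \<in> {1..n}" and x: "x \<in> carrier U"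
  shows "ev a (braidT n q i x) = braidT n q i (ev a x)"
proof -
  have le: "i \<le> n" using i by simp
  note R = T_rels[OF le] and E = ev_rels[OF a]
  have "(ev a \<circ> T i) x = (T i \<circ> ev a) x"
  proof (rule alg_hom_eqI[OF alg_hom_compose[OF endo_hom[OF E] endo_hom[OF R]]
        alg_hom_compose[OF endo_hom[OF R] endo_hom[OF E]] _ _ x])
    fix j assume j: "j \<le> n"
    show "(ev a \<circ> T i) (Bg n q j) = (T i \<circ> ev a) (Bg n q j)"
      "(ev a \<circ> T i) (Kg n q j) = (T i \<circ> ev a) (Kg n q j)"
      using j by (simp_all add: endo_generators[OF R] endo_generators[OF E] endo_component
          Uprod_eval_braid[OF E le] Uprod_eval_eval[OF R] gen.eval_braid[OF i, of _ _ "inverse a"])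
  qed
  then show ?thesis by (simp add: braidT_eq[OF le])
qed

lemma ev_Celt:
  assumes a: "a \<noteq> 0"
  shows "ev a (Celt n q) = scal n q (a\<^sup>2)"
proof -
  note E = ev_rels[OF a]
  have u: "[0..<n + 1] = 0 # [1..<n + 1]" by (simp add: upt_rec)
  have k: "prod_list (map (evalK n a K KI) [1..<n + 1]) = kchain K 1 (n - 1)"
    unfolding kchain_prod_list using n
    by (intro arg_cong[of _ _ prod_list] map_cong) (auto simp: evalK_def)
  \<comment> \<open>The factors \<open>M\<^sup>-\<^sup>1\<close> at node \<open>0\<close> and \<open>M\<close> from the other nodes cancel.\<close>
  have "kmon n (evalK n a K KI) (evalK n (inverse a) KI K) (\<lambda>_. 1) = evalK n a K KI 0 * kchain K 1 (n - 1)"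
    unfolding kmon_def u using k by (simp add: zpow_simps(2) del: upt_Suc)
  also have "\<dots> = a\<^sup>2 *\<^sub>C 1"
    using gen.kchain_units(2)[of 1 "n - 1"] n by (simp add: evalK_def)
  finally show ?thesis
    by (simp add: Celt_def Kmon_eq endo_component Uprod_eval_kmon[OF E] component_scal)
qed

end

theorem theorem5p1:
  fixes n :: nat and q a :: complex
  assumes "n \<ge> 2"
    and "q \<noteq> 0" and "\<forall>m > 0. q ^ m \<noteq> 1"
    and "a \<noteq> 0"
  shows "\<exists>ev \<in> alg_hom (scal n q) (Uaff n q) (Ufin n q).
     (\<forall>i \<in> {1..n}. \<forall>x \<in> carrier (Uaff n q). ev (braidT n q i x) = braidT n q i (ev x)) \<and>
     (\<forall>i \<in> {1..n}. ev (Bg n q i) = Bg n q i \<and> ev (Kg n q i) = Kg n q i) \<and>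
     ev (Bg n q 0) = smul n q a (braidTw n q (pi_inv_omega1 n) (Bg n q 1)) \<and>
     ev (Kg n q 0) = smul n q (a ^ 2) (braidTw n q (pi_inv_omega1 n) (Kg n q 1)) \<and>
     ev (Bg n q 0) = smul n q a (comp_word (braidT n q) (rev [1..<n + 1]) (Bg n q 1)) \<and>
     ev (Bg n q 0) = smul n q a
       (prod_of (Uaff n q) (map (\<lambda>i. inv\<^bsub>Uaff n q\<^esub> Kg n q i) [1..<n + 1])
        \<otimes>\<^bsub>Uaff n q\<^esub> nested_vbracket n q q (map (Bg n q) [1..<n + 1])) \<and>
     ev (Kg n q 0) = smul n q (a ^ 2) (comp_word (braidT n q) (rev [1..<n + 1]) (Kg n q 1)) \<and>
     ev (Kg n q 0) = smul n q (a ^ 2)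
       (prod_of (Uaff n q) (map (\<lambda>i. inv\<^bsub>Uaff n q\<^esub> Kg n q i) [1..<n + 1])) \<and>
     ev (Celt n q) = scal n q (a ^ 2)"
proof -
  interpret iquantum_affine q "inverse q" n
    using assms by unfold_locales auto
  have le: "1 + (n - 1) \<le> n" and n1: "n - 1 + 1 \<le> n" "n - 1 + 2 = n + 1" "1 + (n - 1) + 1 = n + 1"
    using n by auto
  have word: "comp_word (braidT n q) (rev [1..<n + 1]) (Bg n q 1)
      = component (kchain KI 1 (n - 1) * chain q B 1 (n - 1)) n q"
    "comp_word (braidT n q) (rev [1..<n + 1]) (Kg n q 1) = component (kchain KI 1 (n - 1)) n q"
    using descending_word_value[OF n1(1)] unfolding n1(2) by auto
  have prods: "component (kchain KI 1 (n - 1)) n q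
      = prod_of (Uaff n q) (map (\<lambda>i. inv\<^bsub>Uaff n q\<^esub> Kg n q i) [1..<n + 1])"
    "component (chain q B 1 (n - 1)) n q = nested_vbracket n q q (map (Bg n q) [1..<n + 1])"
    using component_kchain[OF le] component_chain[OF order_refl le] unfolding n1(3) .
  have tw: "braidTw n q (pi_inv_omega1 n) (Bg n q 1) = comp_word (braidT n q) (rev [1..<n + 1]) (Bg n q 1)"
    "braidTw n q (pi_inv_omega1 n) (Kg n q 1) = comp_word (braidT n q) (rev [1..<n + 1]) (Kg n q 1)"
    using n by (intro braidTw_pi_inv_omega1 Uaff_closed; simp)+
  show ?thesis
  proof (intro bexI[of _ "ev a"] conjI ballI)
    show "ev a (Bg n q i) = Bg n q i" "ev a (Kg n q i) = Kg n q i" if "i \<in> {1..n}" for i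
      using that by (rule ev_generators[OF assms(4)])+
    show "ev a (Bg n q 0) = smul n q a
       (prod_of (Uaff n q) (map (\<lambda>i. inv\<^bsub>Uaff n q\<^esub> Kg n q i) [1..<n + 1])
        \<otimes>\<^bsub>Uaff n q\<^esub> nested_vbracket n q q (map (Bg n q) [1..<n + 1]))"
      unfolding ev_generators(1)[OF assms(4)] component_simps(4) prods ..
    show "ev a (Kg n q 0) = smul n q (a ^ 2)
       (prod_of (Uaff n q) (map (\<lambda>i. inv\<^bsub>Uaff n q\<^esub> Kg n q i) [1..<n + 1]))"
      unfolding ev_generators(2)[OF assms(4)] prods ..
  qed (simp_all only: ev_alg_hom[OF assms(4)] ev_equivariant[OF assms(4)] ev_Celt[OF assms(4)] tw word
      ev_generators(1,2)[OF assms(4)])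
qed

end
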